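(* Let $L$ be an oriented link. Given $j\in\mathbb{Z}$ there is a spectral sequence with $E_1$-page determined by the mod 2 Khovanov homology $\mathrm{KH}_{\mathbb{F}_2}^{*,*}(L)$ of $L$, converging to the graded Bar-Natan homology $\mathrm{BN}^{*,j}(L)$. The $E_2$-page can be determined using the endomorphism $\beta_*$ of $\mathrm{KH}_{\mathbb{F}_2}^{*,*}(L)$.
   Context: Let $D$ be a diagram of $L$ with $n$ ordered crossings, $n_+$ positive and $n_-$ negative. For $\alpha\in\{0,1\}^n$ let $D_\alpha$ be the complete smoothing in which the $r$-th crossing receives its $\alpha_r$-smoothing (the oriented smoothing of a positive crossing is its 0-smoothing and that of a negative crossing its 1-smoothing). Let $A=\mathbb{F}_2\{1,x\}$ with $\deg 1=1$, $\deg x=-1$, and let $V_\alpha$ be the tensor product over $\mathbb{F}_2$ of copies of $A$, one for each circle of $D_\alpha$. Set $\overline{\mathcal C}^{i}=\bigoplus_{|\alpha|-n_-=i}V_\alpha$, where $|\alpha|$ is the number of 1's in $\alpha$; $i$ is the homological grading. Give homogeneous $v\in V_\alpha\subset\overline{\mathcal C}^{i}$ the $q$-grading $q(v)=\deg(v)+i+n_+-n_-$, and write $\overline{\mathcal C}^{i,j}$ for the part of $\overline{\mathcal C}^{i}$ of $q$-grading $j$. Bidegrees are written (homological degree, $q$-degree). Given a pair of maps (a merge map and a split map), the associated cube map sends $v$ in the summand of $\alpha$ to the sum, over all edges $\alpha\to\alpha'$ of the cube (one entry changed from 0 to 1), of the result of applying the merge or split map to the tensor factors of the circles that merge or split and the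 identity to the other tensor factors. - Mod 2 Khovanov homology: the differential $\partial$ on $\overline{\mathcal C}^{*,*}$, of bidegree $(1,0)$, is the cube map of $\overline m(1,1)=1$, $\overline m(1,x)=\overline m(x,1)=x$, $\overline m(x,x)=0$ and $\overline\Delta(1)=1\otimes x+x\otimes 1$, $\overline\Delta(x)=x\otimes x$. Its homology is $\mathrm{KH}_{\mathbb{F}_2}^{*,*}(L)$. - The endomorphism $\beta_*$: let $\beta\colon\overline{\mathcal C}^{i,j}\to\overline{\mathcal C}^{i+1,j+2}$ be the cube map of $\tilde m(1,1)=\tilde m(1,x)=\tilde m(x,1)=0$, $\tilde m(x,x)=x$ and $\tilde\Delta(1)=1\otimes 1$, $\tilde\Delta(x)=0$. It is a map of complexes with respect to $\partial$ and $\beta^2=0$, and so it induces $\beta_*\colon\mathrm{KH}_{\mathbb{F}_2}^{i,j}(L)\to\mathrm{KH}_{\mathbb{F}_2}^{i+1,j+2}(L)$, which has bidegree $(1,2)$, satisfies $\beta_*^2=0$ and does not depend on the chosen diagram of $L$. - Graded Bar-Natan homology: let $\mathcal C^{*,*}=\overline{\mathcal C}^{*,*}\otimes_{\mathbb{F}_2}\mathbb{F}_2[u]$, where $u$ has bidegree $(0,-2)$, with differential $d$ of bidegree $(1,0)$ given by the $\mathbb{F}_2[u]$-linear cube map of $m(1,1)=1$, $m(1,x)=m(x,1)=x$, $m(x,x)=ux$ and $\Delta(1)=1\otimes x+x\otimes 1+u\,1\otimes 1$, $\Delta(x)=x\otimes x$. Then $\mathrm{BN}^{i,j}(L)=H^i(\mathcal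 C^{*,j},d)$, where $\mathcal C^{*,j}$ is the subcomplex of $q$-grading $j$; it is a link invariant. *)

theory Defs
  imports
    "HOL-Algebra.Coset"
    "HOL-Algebra.Elementary_Groups"
    "HOL-Library.FuncSet"
    "HOL-Library.Z2"
    "HOL-Computational_Algebra.Polynomial"
begin

section \<open>Oriented link diagrams\<close>

text \<open>
  A diagram is given by its arcs (the edges of the underlying 4-valent plane graph, together with
  one arc for every circle component without crossings) and its ordered list of crossings.  A
  crossing is turned so that both of its strands point upwards; its strands are then
  \<open>sw\<close> to \<open>ne\<close> and \<open>se\<close> to \<open>nw\<close>, so the arcs \<open>sw\<close> and \<open>se\<close> come in and the arcs \<open>nw\<close> and \<open>ne\<close> go
  out.  The strand from \<open>sw\<close> to \<open>ne\<close> is the over-strand exactly if the crossing is positive.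
\<close>

datatype crossing = Crossing (positive: bool) (sw: nat) (se: nat) (nw: nat) (ne: nat)

datatype diagram = Diagram (arcs: "nat set") (crossings: "crossing list")

definition eq_class :: "('a \<Rightarrow> 'a \<Rightarrow> bool) \<Rightarrow> 'a \<Rightarrow> 'a set" where
  "eq_class R a = {b. equivclp R a b}"

definition incoming :: "diagram \<Rightarrow> nat list" where
  "incoming D = concat (map (\<lambda>c. [sw c, se c]) (crossings D))"

definition outgoing :: "diagram \<Rightarrow> nat list" where
  "outgoing D = concat (map (\<lambda>c. [nw c, ne c]) (crossings D))"

definition well_formed :: "diagram \<Rightarrow> bool" where
  "well_formed D \<longleftrightarrow> finite (arcs D) \<and> distinct (incoming D) \<and> distinct (outgoing D) \<and>
     set (incoming D) = set (outgoing D) \<and> set (incoming D) \<subseteq> arcs D"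

text \<open>
  Planarity of the 4-valent graph with the cyclic order of arcs at each crossing is expressed by
  Euler's formula.  The regions are the classes of sides of arcs, where two sides are identified
  if they bound the same one of the four corners of a crossing (sides are named with respect to the
  orientation of the arc).  As every connected component has Euler characteristic at most 2, the
  formula says that every component is a plane graph.  The relative position of different
  components in the plane is not recorded; it affects neither the link nor the chain complexes.
\<close>

datatype side = Left | Right

definition same_corner :: "diagram \<Rightarrow> nat \<times> side \<Rightarrow> nat \<times> side \<Rightarrow> bool" where
  "same_corner D s t \<longleftrightarrow> (\<exists>c \<in> set (crossings D).
     (s, t) \<in> {((sw c, Left), (nw c, Left)), ((nw c, Right), (ne c, Left)),
               ((ne c, Right), (se c, Right)), ((se c, Left), (sw c, Right))})"

definition share_crossing :: "diagram \<Rightarrow> nat \<Rightarrow> nat \<Rightarrow> bool" where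
  "share_crossing D a b \<longleftrightarrow>
     (\<exists>c \<in> set (crossings D). a \<in> {sw c, se c, nw c, ne c} \<and> b \<in> {sw c, se c, nw c, ne c})"

definition planar :: "diagram \<Rightarrow> bool" where
  "planar D \<longleftrightarrow>
     (let edges = set (incoming D);
          regions = eq_class (same_corner D) ` (edges \<times> UNIV);
          components = eq_class (share_crossing D) ` edges
      in int (length (crossings D)) - int (card edges) + int (card regions)
           = 2 * int (card components))"

definition oriented_link_diagram :: "diagram \<Rightarrow> bool" where
  "oriented_link_diagram D \<longleftrightarrow> well_formed D \<and> planar D"

definition n_pos :: "diagram \<Rightarrow> nat" where
  "n_pos D = length (filter positive (crossings D))"

definition n_neg :: "diagram \<Rightarrow> nat" where
  "n_neg D = length (filter (\<lambda>c. \<not> positive c) (crossings D))"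


section \<open>Smoothings and enhanced states\<close>

text \<open>
  A vertex \<open>\<alpha>\<close> of the cube is represented by the set of those \<open>r < n\<close> whose entry is 1.  The
  oriented smoothing of a crossing joins \<open>sw\<close> to \<open>nw\<close> and \<open>se\<close> to \<open>ne\<close>; it is the 0-smoothing of a
  positive crossing and the 1-smoothing of a negative one.  The other smoothing joins \<open>sw\<close> to \<open>se\<close>
  and \<open>nw\<close> to \<open>ne\<close>.  A circle of a smoothing is represented by the set of its arcs.
\<close>

definition joined :: "diagram \<Rightarrow> nat set \<Rightarrow> nat \<Rightarrow> nat \<Rightarrow> bool" where
  "joined D \<alpha> a b \<longleftrightarrow> (\<exists>r < length (crossings D). let c = crossings D ! r in
     if positive c \<longleftrightarrow> r \<notin> \<alpha> then (a, b) \<in> {(sw c, nw c), (se c, ne c)}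
     else (a, b) \<in> {(sw c, se c), (nw c, ne c)})"

definition circle :: "diagram \<Rightarrow> nat set \<Rightarrow> nat \<Rightarrow> nat set" where
  "circle D \<alpha> a = eq_class (joined D \<alpha>) a"

definition circles :: "diagram \<Rightarrow> nat set \<Rightarrow> nat set set" where
  "circles D \<alpha> = circle D \<alpha> ` arcs D"

text \<open>The basis \<open>1, x\<close> of \<open>A\<close>.\<close>

datatype label = One | X

fun label_deg :: "label \<Rightarrow> int" where
  "label_deg One = 1"
| "label_deg X = -1"

text \<open>
  The labellings of the circles of \<open>D\<^sub>\<alpha>\<close> by \<open>1\<close> and \<open>x\<close> form the standard basis of the tensor
  product \<open>V\<^sub>\<alpha>\<close>; a basis element of the whole complex is a pair of \<open>\<alpha>\<close> and such a labelling.
\<close>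

type_synonym gen = "nat set \<times> (nat set \<Rightarrow> label)"

definition gens :: "diagram \<Rightarrow> gen set" where
  "gens D = (SIGMA \<alpha> : Pow {..<length (crossings D)}. circles D \<alpha> \<rightarrow>\<^sub>E UNIV)"

definition hdeg :: "diagram \<Rightarrow> gen \<Rightarrow> int" where
  "hdeg D g = int (card (fst g)) - int (n_neg D)"

definition qdeg :: "diagram \<Rightarrow> gen \<Rightarrow> int" where
  "qdeg D g = (\<Sum>c \<in> circles D (fst g). label_deg (snd g c)) + hdeg D g + int (n_pos D) - int (n_neg D)"


section \<open>Cube maps\<close>

text \<open>
  A merge map is given by its structure constants: \<open>m a b k\<close> is the coefficient of \<open>k\<close> in
  \<open>m(a, b)\<close>.  Likewise, \<open>\<Delta> a k l\<close> is the coefficient of \<open>k \<otimes> l\<close> in \<open>\<Delta>(a)\<close>.  All the merge and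
  split maps below are symmetric.

  In either smoothing of a crossing the arcs \<open>sw\<close> and \<open>ne\<close> lie on different ones of the two local
  strands, so their circles are the circles that touch the crossing.
\<close>

type_synonym 'r structure_constants = "label \<Rightarrow> label \<Rightarrow> label \<Rightarrow> 'r"

definition edge_coeff ::
  "diagram \<Rightarrow> 'r::comm_ring_1 structure_constants \<Rightarrow> 'r structure_constants \<Rightarrow> nat \<Rightarrow> gen \<Rightarrow> gen \<Rightarrow> 'r"
where
  "edge_coeff D m \<Delta> r g g' =
     (let (\<alpha>, s) = g; (\<alpha>', s') = g'; c = crossings D ! r;
          a = circle D \<alpha> (sw c); b = circle D \<alpha> (ne c);
          a' = circle D \<alpha>' (sw c); b' = circle D \<alpha>' (ne c)
      in if \<exists>k \<in> circles D \<alpha> - {a, b}. s' k \<noteq> s k then 0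
         else if a \<noteq> b \<and> a' = b' then m (s a) (s b) (s' a')
         else if a = b \<and> a' \<noteq> b' then \<Delta> (s a) (s' a') (s' b')
         else 0)"

definition cube_map ::
  "diagram \<Rightarrow> 'r::comm_ring_1 structure_constants \<Rightarrow> 'r structure_constants \<Rightarrow> (gen \<Rightarrow> 'r) \<Rightarrow> gen \<Rightarrow> 'r"
where
  "cube_map D m \<Delta> v g' =
     (if g' \<in> gens D
      then \<Sum>g \<in> gens D. \<Sum>r | r < length (crossings D) \<and> r \<notin> fst g \<and> fst g' = insert r (fst g).
             v g * edge_coeff D m \<Delta> r g g'
      else 0)"

fun kh_m :: "bit structure_constants" where
  "kh_m One One k = of_bool (k = One)"
| "kh_m One X k = of_bool (k = X)"
| "kh_m X One k = of_bool (k = X)"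
| "kh_m X X k = 0"

fun kh_\<Delta> :: "bit structure_constants" where
  "kh_\<Delta> One k l = of_bool (k = One \<and> l = X) + of_bool (k = X \<and> l = One)"
| "kh_\<Delta> X k l = of_bool (k = X \<and> l = X)"

fun beta_m :: "bit structure_constants" where
  "beta_m One One k = 0"
| "beta_m One X k = 0"
| "beta_m X One k = 0"
| "beta_m X X k = of_bool (k = X)"

fun beta_\<Delta> :: "bit structure_constants" where
  "beta_\<Delta> One k l = of_bool (k = One \<and> l = One)"
| "beta_\<Delta> X k l = 0"

definition u :: "bit poly" where
  "u = [:0, 1:]"

fun bn_m :: "bit poly structure_constants" where
  "bn_m One One k = of_bool (k = One)"
| "bn_m One X k = of_bool (k = X)"
| "bn_m X One k = of_bool (k = X)"
| "bn_m X X k = u * of_bool (k = X)"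

fun bn_\<Delta> :: "bit poly structure_constants" where
  "bn_\<Delta> One k l = of_bool (k = One \<and> l = X) + of_bool (k = X \<and> l = One) + u * of_bool (k = One \<and> l = One)"
| "bn_\<Delta> X k l = of_bool (k = X \<and> l = X)"

definition kh_diff :: "diagram \<Rightarrow> (gen \<Rightarrow> bit) \<Rightarrow> gen \<Rightarrow> bit" where
  "kh_diff D = cube_map D kh_m kh_\<Delta>"

definition beta :: "diagram \<Rightarrow> (gen \<Rightarrow> bit) \<Rightarrow> gen \<Rightarrow> bit" where
  "beta D = cube_map D beta_m beta_\<Delta>"

definition bn_diff :: "diagram \<Rightarrow> (gen \<Rightarrow> bit poly) \<Rightarrow> gen \<Rightarrow> bit poly" where
  "bn_diff D = cube_map D bn_m bn_\<Delta>"


section \<open>Chain groups and homology\<close>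

text \<open>
  A vector space over the field with two elements is the same thing as an abelian group in which
  every element is its own inverse, and its linear maps, subspaces and quotients are those of the
  group.  Vector spaces are therefore represented by (multiplicatively written) groups.
\<close>

definition f2_space :: "'a monoid \<Rightarrow> bool" where
  "f2_space G \<longleftrightarrow> comm_group G \<and> (\<forall>x \<in> carrier G. x \<otimes>\<^bsub>G\<^esub> x = \<one>\<^bsub>G\<^esub>)"

definition pointwise_group :: "('g \<Rightarrow> 'r::ab_group_add) set \<Rightarrow> ('g \<Rightarrow> 'r) monoid" where
  "pointwise_group S = \<lparr>carrier = S, monoid.mult = (\<lambda>v w g. v g + w g), one = (\<lambda>_. 0)\<rparr>"

definition kh_chain :: "diagram \<Rightarrow> int \<Rightarrow> int \<Rightarrow> (gen \<Rightarrow> bit) monoid" where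
  "kh_chain D i j = pointwise_group
     {v. \<forall>g. v g \<noteq> 0 \<longrightarrow> g \<in> gens D \<and> hdeg D g = i \<and> qdeg D g = j}"

text \<open>The element \<open>g \<otimes> u\<^sup>k\<close> has \<open>q\<close>-grading \<open>qdeg D g - 2 * k\<close>.\<close>

definition bn_chain :: "diagram \<Rightarrow> int \<Rightarrow> int \<Rightarrow> (gen \<Rightarrow> bit poly) monoid" where
  "bn_chain D i j = pointwise_group
     {v. \<forall>g k. coeff (v g) k \<noteq> 0 \<longrightarrow> g \<in> gens D \<and> hdeg D g = i \<and> qdeg D g - 2 * int k = j}"

text \<open>The homology at \<open>B\<close> of \<open>A \<rightarrow> B \<rightarrow> C\<close> with maps \<open>f\<close> and \<open>g\<close>.\<close>

definition homology ::
  "('a \<Rightarrow> 'b) \<Rightarrow> ('b \<Rightarrow> 'c) \<Rightarrow> 'a monoid \<Rightarrow> 'b monoid \<Rightarrow> 'c monoid \<Rightarrow> 'b set monoid" where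
  "homology f g A B C = (B\<lparr>carrier := kernel B C g\<rparr>) Mod (f ` carrier A)"

definition KH :: "diagram \<Rightarrow> int \<Rightarrow> int \<Rightarrow> (gen \<Rightarrow> bit) set monoid" where
  "KH D i j = homology (kh_diff D) (kh_diff D)
     (kh_chain D (i - 1) j) (kh_chain D i j) (kh_chain D (i + 1) j)"

definition BN :: "diagram \<Rightarrow> int \<Rightarrow> int \<Rightarrow> (gen \<Rightarrow> bit poly) set monoid" where
  "BN D i j = homology (bn_diff D) (bn_diff D)
     (bn_chain D (i - 1) j) (bn_chain D i j) (bn_chain D (i + 1) j)"

text \<open>
  The map from \<open>KH D i j\<close> to \<open>KH D (i + 1) (j + 2)\<close> induced by \<open>beta\<close>: the class \<open>Z\<close> is sent to the
  class of \<open>beta D z\<close> for any \<open>z \<in> Z\<close>.  All the sets in the union are equal.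
\<close>

definition beta_star :: "diagram \<Rightarrow> int \<Rightarrow> int \<Rightarrow> (gen \<Rightarrow> bit) set \<Rightarrow> (gen \<Rightarrow> bit) set" where
  "beta_star D i j Z =
     (\<Union>z \<in> Z. (kh_diff D ` carrier (kh_chain D i (j + 2))) #>\<^bsub>kh_chain D (i + 1) (j + 2)\<^esub> beta D z)"


section \<open>Spectral sequences\<close>

text \<open>
  Cohomologically graded spectral sequences of vector spaces over the field with two elements,
  starting with the page \<open>E 1\<close>; the differential \<open>d r p q\<close> goes from \<open>E r p q\<close> to
  \<open>E r (p + r) (q - r + 1)\<close>.
\<close>

definition spectral_sequence ::
  "(nat \<Rightarrow> int \<Rightarrow> int \<Rightarrow> 'a monoid) \<Rightarrow> (nat \<Rightarrow> int \<Rightarrow> int \<Rightarrow> 'a \<Rightarrow> 'a) \<Rightarrow> bool" where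
  "spectral_sequence E d \<longleftrightarrow> (\<forall>r \<ge> 1. \<forall>p q.
     f2_space (E r p q) \<and>
     d r p q \<in> hom (E r p q) (E r (p + int r) (q - int r + 1)) \<and>
     (\<forall>x \<in> carrier (E r p q).
        d r (p + int r) (q - int r + 1) (d r p q x) = \<one>\<^bsub>E r (p + 2 * int r) (q - 2 * int r + 2)\<^esub>) \<and>
     E (Suc r) p q \<cong>
       homology (d r (p - int r) (q + int r - 1)) (d r p q)
         (E r (p - int r) (q + int r - 1)) (E r p q) (E r (p + int r) (q - int r + 1)))"

text \<open>
  Convergence to the graded vector space \<open>H\<close>: each \<open>H n\<close> has a finite decreasing filtration
  \<open>F p n\<close>, and for all \<open>p\<close> and \<open>q\<close> the differentials from and to \<open>E r p q\<close> vanish for large \<open>r\<close>,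
  when \<open>E r p q\<close> (which then is \<open>E\<^sub>\<infinity>\<close> at this place) is the graded piece
  \<open>F p (p + q) / F (p + 1) (p + q)\<close> of \<open>H (p + q)\<close>.
\<close>

definition converges_to ::
  "(nat \<Rightarrow> int \<Rightarrow> int \<Rightarrow> 'a monoid) \<Rightarrow> (nat \<Rightarrow> int \<Rightarrow> int \<Rightarrow> 'a \<Rightarrow> 'a) \<Rightarrow> (int \<Rightarrow> 'b monoid) \<Rightarrow> bool" where
  "converges_to E d H \<longleftrightarrow> (\<exists>F :: int \<Rightarrow> int \<Rightarrow> 'b set.
     (\<forall>n. f2_space (H n)) \<and>
     (\<forall>p n. subgroup (F p n) (H n) \<and> F (p + 1) n \<subseteq> F p n) \<and>
     (\<forall>n. (\<exists>p. F p n = carrier (H n)) \<and> (\<exists>p. F p n = {\<one>\<^bsub>H n\<^esub>})) \<and>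
     (\<forall>p q. \<exists>R \<ge> 1. \<forall>r \<ge> R.
        (\<forall>x \<in> carrier (E r p q). d r p q x = \<one>\<^bsub>E r (p + int r) (q - int r + 1)\<^esub>) \<and>
        (\<forall>x \<in> carrier (E r (p - int r) (q + int r - 1)).
           d r (p - int r) (q + int r - 1) x = \<one>\<^bsub>E r p q\<^esub>) \<and>
        E r p q \<cong> ((H (p + q))\<lparr>carrier := F p (p + q)\<rparr>) Mod (F (p + 1) (p + q))))"

end

theory Submission
  imports Defs "HOL-Library.Function_Algebras"
begin

text \<open>
  The Bar-Natan complex is filtered by powers of \<open>u\<close>.  Its differential is \<open>\<partial> + u \<beta>\<close>, so the
  associated graded complex in filtration degree \<open>p\<close> is the Khovanov complex in \<open>q\<close>-grading
  \<open>j + 2 p\<close> and the differential on the first page is \<open>\<beta>\<^sub>*\<close>.  The filtration is bounded because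
  there are finitely many generators, which gives convergence.

  That the differential squares to zero is checked after applying the two ring homomorphisms from
  the Frobenius algebra to the polynomial ring.  There every edge of the cube acts as 1 or as \<open>u\<close>,
  according to whether circles merge or split, and the two paths around a face agree because the
  number of splits is determined by the numbers of circles at the ends.  This needs planarity:
  an edge must never leave the number of circles unchanged.
\<close>

section \<open>Quotients and homology of vector spaces over the field with two elements\<close>

text \<open>Euler's formula speaks about regions, whereas the edges to be excluded are seen on
  smoothings; a checkerboard colouring connects the two. It comes out of a count of vectors over the
  field with two elements, and it turns the circles of a smoothing into cycles of a permutation,
  where composition with a transposition always cuts one cycle or joins two. It suffices to test
  \<open>d (d v)\<close> after applying the ring homomorphisms because their matrix has determinant
  \<open>u\<close>, which can be cancelled in a polynomial ring over a field. The homomorphism is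
  chosen independently on each circle. Such a choice is recorded by a set \<open>S\<close> of arcs
  and not by a set of circles, so that the same \<open>S\<close> makes sense at all vertices of a
  face of the cube. The relations between \<partial> and \<beta> are not checked on the cube; they
  are read off from the powers of \<open>u\<close> in the square of the Bar-Natan
  differential.\<close>

definition f2_subspace :: "'a::ab_group_add set \<Rightarrow> bool" where
  "f2_subspace S \<longleftrightarrow> 0 \<in> S \<and> (\<forall>x\<in>S. \<forall>y\<in>S. x + y \<in> S) \<and> (\<forall>x\<in>S. x + x = 0)"

definition add_group :: "'a::ab_group_add set \<Rightarrow> 'a monoid" where
  "add_group S = \<lparr>carrier = S, monoid.mult = (+), one = 0\<rparr>"

definition coset :: "'a::ab_group_add set \<Rightarrow> 'a \<Rightarrow> 'a set" where
  "coset T x = (\<lambda>t. t + x) ` T"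

definition quotient_space :: "'a::ab_group_add set \<Rightarrow> 'a set \<Rightarrow> 'a set monoid" where
  "quotient_space S T = add_group S Mod T"

text \<open>Has the shape of \<open>beta_star\<close>, which thereby becomes an instance. The union
  is over equal cosets as soon as the additive map \<open>f\<close> carries the subspace divided out
  in the source into \<open>T\<close>.\<close>

definition quotient_map :: "'b::ab_group_add set \<Rightarrow> ('a \<Rightarrow> 'b) \<Rightarrow> 'a set \<Rightarrow> 'b set" where
  "quotient_map T f Q = (\<Union>x\<in>Q. coset T (f x))"

lemma add_group_simps [simp]:
  "carrier (add_group S) = S" "x \<otimes>\<^bsub>add_group S\<^esub> y = x + y" "\<one>\<^bsub>add_group S\<^esub> = 0"
  by (simp_all add: add_group_def)

lemma r_coset_add_group [simp]: "T #>\<^bsub>add_group S\<^esub> x = coset T x"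
  by (auto simp: r_coset_def coset_def)

lemma pointwise_group_eq: "pointwise_group S = add_group S"
  by (simp add: pointwise_group_def add_group_def plus_fun_def zero_fun_def fun_eq_iff)

lemma f2_subspaceD:
  assumes "f2_subspace S"
  shows "0 \<in> S" "x \<in> S \<Longrightarrow> y \<in> S \<Longrightarrow> x + y \<in> S" "x \<in> S \<Longrightarrow> x + x = 0"
  using assms by (auto simp: f2_subspace_def)

lemma f2_add_cancel:
  assumes "f2_subspace S" "x \<in> S"
  shows "x + (x + y) = y"
  using f2_subspaceD(3)[OF assms] by (simp flip: add.assoc)

lemma comm_group_add_group:
  assumes S: "f2_subspace S"
  shows "comm_group (add_group S)"
proof (rule comm_groupI)
  show "\<exists>y\<in>carrier (add_group S). y \<otimes>\<^bsub>add_group S\<^esub> x = \<one>\<^bsub>add_group S\<^esub>"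
    if "x \<in> carrier (add_group S)" for x
    using f2_subspaceD(3)[OF S] that by auto
qed (use f2_subspaceD[OF S] in \<open>auto simp: algebra_simps\<close>)

lemma f2_space_add_group: "f2_subspace S \<Longrightarrow> f2_space (add_group S)"
  using comm_group_add_group f2_subspaceD(3) by (auto simp: f2_space_def)

lemma subgroup_add_group:
  assumes S: "f2_subspace S" and T: "f2_subspace T" and "T \<subseteq> S"
  shows "subgroup T (add_group S)"
proof -
  interpret comm_group "add_group S" by (rule comm_group_add_group[OF S])
  show ?thesis
  proof (rule subgroupI)
    fix x assume x: "x \<in> T"
    have "inv\<^bsub>add_group S\<^esub> x = x"
      by (rule inv_equality) (use x assms f2_subspaceD(3)[OF T] in auto)
    with x show "inv\<^bsub>add_group S\<^esub> x \<in> T" by simp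
  qed (use f2_subspaceD[OF T] assms in auto)
qed

lemma normal_add_group:
  assumes S: "f2_subspace S" and T: "f2_subspace T" and "T \<subseteq> S"
  shows "T \<lhd> add_group S"
  by (rule comm_group.subgroup_imp_normal[OF comm_group_add_group[OF S] subgroup_add_group[OF assms]])

lemma comm_group_restrict:
  assumes "comm_group G" "subgroup H G"
  shows "comm_group (G\<lparr>carrier := H\<rparr>)"
proof -
  interpret G: comm_group G by (rule assms(1))
  interpret H: subgroup H G by (rule assms(2))
  have "group (G\<lparr>carrier := H\<rparr>)" by (rule H.subgroup_is_group[OF G.is_group])
  then show ?thesis using H.subset G.m_comm by (intro group.group_comm_groupI) auto
qed

lemma f2_space_Mod:
  assumes G: "f2_space G" and H: "subgroup H G"
  shows "f2_space (G Mod H)"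
proof -
  interpret comm_group G using G by (simp add: f2_space_def)
  interpret N: normal H G by (rule subgroup_imp_normal[OF H])
  have "Q <#>\<^bsub>G\<^esub> Q = H" if Q: "Q \<in> rcosets\<^bsub>G\<^esub> H" for Q
  proof -
    obtain x where x: "x \<in> carrier G" "Q = H #>\<^bsub>G\<^esub> x" using Q by (auto simp: RCOSETS_def)
    then have "Q <#>\<^bsub>G\<^esub> Q = H #>\<^bsub>G\<^esub> (x \<otimes>\<^bsub>G\<^esub> x)" by (simp add: N.rcos_sum)
    also have "\<dots> = H" using G x by (simp add: f2_space_def N.is_subgroup coset_mult_one N.subset)
    finally show ?thesis .
  qed
  then show ?thesis
    using abelian_FactGroup[OF H] by (simp add: f2_space_def FactGroup_def)
qed

lemma f2_space_restrict:
  assumes G: "f2_space G" and H: "subgroup H G"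
  shows "f2_space (G\<lparr>carrier := H\<rparr>)"
proof -
  interpret comm_group G using G by (simp add: f2_space_def)
  have "comm_group (G\<lparr>carrier := H\<rparr>)" by (rule comm_group_restrict[OF comm_group_axioms H])
  then show ?thesis using G subgroup.subset[OF H] by (auto simp: f2_space_def)
qed

lemma f2_space_quotient_space:
  assumes "f2_subspace S" "f2_subspace T" "T \<subseteq> S"
  shows "f2_space (quotient_space S T)"
  unfolding quotient_space_def
  by (intro f2_space_Mod f2_space_add_group subgroup_add_group assms)

lemma carrier_quotient_space: "carrier (quotient_space S T) = coset T ` S"
  by (auto simp: quotient_space_def FactGroup_def RCOSETS_def)

lemma one_quotient_space [simp]: "\<one>\<^bsub>quotient_space S T\<^esub> = T"
  by (simp add: quotient_space_def FactGroup_def)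

lemma coset_zero [simp]: "coset T 0 = T"
  by (simp add: coset_def)

lemma mult_quotient_space:
  assumes "f2_subspace S" "f2_subspace T" "T \<subseteq> S" "x \<in> S" "y \<in> S"
  shows "coset T x \<otimes>\<^bsub>quotient_space S T\<^esub> coset T y = coset T (x + y)"
  using normal.rcos_sum[OF normal_add_group[OF assms(1-3)], of x y] assms(4,5)
  by (simp add: quotient_space_def FactGroup_def)

lemma coset_hom:
  assumes "f2_subspace S" "f2_subspace T" "T \<subseteq> S"
  shows "coset T \<in> hom (add_group S) (quotient_space S T)"
  using mult_quotient_space[OF assms] by (auto simp: hom_def carrier_quotient_space)

text \<open>Cosets are compared through \<open>x + y\<close> instead of \<open>x - y\<close>, since
  every element is its own inverse.\<close>

lemma coset_eq_iff:
  assumes S: "f2_subspace S" and T: "f2_subspace T" and "T \<subseteq> S" "x \<in> S" "y \<in> S"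
  shows "coset T x = coset T y \<longleftrightarrow> x + y \<in> T"
proof
  assume "coset T x = coset T y"
  moreover have "x \<in> coset T x" using f2_subspaceD(1)[OF T] by (force simp: coset_def)
  ultimately obtain t where "t \<in> T" "x = t + y" by (auto simp: coset_def)
  then show "x + y \<in> T" using f2_subspaceD(3)[OF S \<open>y \<in> S\<close>] by (simp add: add.assoc)
next
  assume xy: "x + y \<in> T"
  have *: "coset T a \<subseteq> coset T b" if "a + b \<in> T" "a \<in> S" "b \<in> S" for a b
  proof
    fix z assume "z \<in> coset T a"
    then obtain t where t: "t \<in> T" "z = t + a" by (auto simp: coset_def)
    have "z = (t + (a + b)) + b"
      using f2_subspaceD(3)[OF S \<open>b \<in> S\<close>] t by (simp add: add.assoc)
    moreover have "t + (a + b) \<in> T" using f2_subspaceD(2)[OF T] t that by blast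
    ultimately show "z \<in> coset T b" unfolding coset_def by (rule image_eqI)
  qed
  show "coset T x = coset T y" using *[of x y] *[of y x] xy assms by (auto simp: add.commute)
qed

lemma coset_eq_one_iff:
  assumes "f2_subspace S" "f2_subspace T" "T \<subseteq> S" "x \<in> S"
  shows "coset T x = T \<longleftrightarrow> x \<in> T"
  using coset_eq_iff[OF assms, of 0] f2_subspaceD(1)[OF assms(1)] by simp

lemma quotient_map_coset:
  assumes S: "f2_subspace S" and T: "f2_subspace T" "T \<subseteq> S"
    and S': "f2_subspace S'" and T': "f2_subspace T'" "T' \<subseteq> S'"
    and add: "\<And>x y. x \<in> S \<Longrightarrow> y \<in> S \<Longrightarrow> f (x + y) = f x + f y"
    and im: "\<And>x. x \<in> S \<Longrightarrow> f x \<in> S'" and imT: "\<And>x. x \<in> T \<Longrightarrow> f x \<in> T'"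
    and x: "x \<in> S"
  shows "quotient_map T' f (coset T x) = coset T' (f x)"
proof -
  have "coset T' (f (t + x)) = coset T' (f x)" if "t \<in> T" for t
  proof -
    have tS: "t \<in> S" using that T by auto
    have "f (t + x) + f x = f t + (f x + f x)" using add[OF tS x] by (simp add: add.assoc)
    then have "f (t + x) + f x \<in> T'" using imT[OF that] f2_subspaceD(3)[OF S' im[OF x]] by simp
    then show ?thesis using coset_eq_iff[OF S' T'] im f2_subspaceD(2)[OF S tS x] x by auto
  qed
  then show ?thesis using f2_subspaceD(1)[OF T(1)]
    by (auto simp: quotient_map_def coset_def[of T])
qed

lemma quotient_map_hom:
  assumes S: "f2_subspace S" and T: "f2_subspace T" "T \<subseteq> S"
    and S': "f2_subspace S'" and T': "f2_subspace T'" "T' \<subseteq> S'"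
    and add: "\<And>x y. x \<in> S \<Longrightarrow> y \<in> S \<Longrightarrow> f (x + y) = f x + f y"
    and im: "\<And>x. x \<in> S \<Longrightarrow> f x \<in> S'" and imT: "\<And>x. x \<in> T \<Longrightarrow> f x \<in> T'"
  shows "quotient_map T' f \<in> hom (quotient_space S T) (quotient_space S' T')"
proof (rule homI)
  note qc = quotient_map_coset[OF assms]
  show "quotient_map T' f Q \<in> carrier (quotient_space S' T')" if "Q \<in> carrier (quotient_space S T)" for Q
    using that qc im by (auto simp: carrier_quotient_space)
  show "quotient_map T' f (Q \<otimes>\<^bsub>quotient_space S T\<^esub> Y)
      = quotient_map T' f Q \<otimes>\<^bsub>quotient_space S' T'\<^esub> quotient_map T' f Y"
    if "Q \<in> carrier (quotient_space S T)" "Y \<in> carrier (quotient_space S T)" for Q Y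
    using that qc im add mult_quotient_space[OF S T] mult_quotient_space[OF S' T'] f2_subspaceD(2)[OF S]
    by (auto simp: carrier_quotient_space)
qed

text \<open>The first isomorphism theorem. The isomorphism is kept explicit, with its values on
  cosets, because the comparison of differentials has to evaluate it on representatives.\<close>

lemma Mod_iso:
  assumes "group G" "group H" "h \<in> hom G H" "h ` carrier G = carrier H"
    and L: "L = {x \<in> carrier G. h x = \<one>\<^bsub>H\<^esub>}"
  shows "(\<lambda>Q. the_elem (h ` Q)) \<in> iso (G Mod L) H"
    and "x \<in> carrier G \<Longrightarrow> the_elem (h ` (L #>\<^bsub>G\<^esub> x)) = h x"
proof -
  interpret group_hom G H h using assms by (simp add: group_hom_def group_hom_axioms_def)
  have L': "L = kernel G H h" by (simp add: L kernel_def)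
  show "(\<lambda>Q. the_elem (h ` Q)) \<in> iso (G Mod L) H"
    unfolding L' by (rule FactGroup_iso_set[OF assms(4)])
  assume x: "x \<in> carrier G"
  have "h ` (L #>\<^bsub>G\<^esub> x) = {h x}"
    using x G.one_closed hom_one by (force simp: r_coset_def L)
  then show "the_elem (h ` (L #>\<^bsub>G\<^esub> x)) = h x" by simp
qed

text \<open>The map \<open>h\<close> from \<open>K\<close> into the cycles of \<open>B\<close> may
  have a kernel, and it has to reach a cycle only up to a boundary; \<open>L\<close> is what it
  sends to boundaries. With \<open>K\<close> the approximate cycles of level \<open>r + 1\<close>
  this computes the homology of page \<open>r\<close>.\<close>

lemma homology_iso:
  assumes A: "group A" and B: "comm_group B" and C: "group C"
    and f: "f \<in> hom A B" and g: "g \<in> hom B C"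
    and gf: "\<And>a. a \<in> carrier A \<Longrightarrow> g (f a) = \<one>\<^bsub>C\<^esub>"
    and K: "group K" and h: "h \<in> hom K B" and gh: "\<And>x. x \<in> carrier K \<Longrightarrow> g (h x) = \<one>\<^bsub>C\<^esub>"
    and surj: "\<And>b. b \<in> carrier B \<Longrightarrow> g b = \<one>\<^bsub>C\<^esub> \<Longrightarrow>
                 \<exists>x\<in>carrier K. \<exists>a\<in>carrier A. b = f a \<otimes>\<^bsub>B\<^esub> h x"
    and L: "L = {x \<in> carrier K. h x \<in> f ` carrier A}"
  shows "K Mod L \<cong> homology f g A B C"
proof -
  interpret B: comm_group B by (rule B)
  interpret f: group_hom A B f using A B.is_group f by (simp add: group_hom_def group_hom_axioms_def)
  interpret g: group_hom B C g using C B.is_group g by (simp add: group_hom_def group_hom_axioms_def)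
  define N where "N = B\<lparr>carrier := kernel B C g\<rparr>"
  have N: "comm_group N" unfolding N_def by (rule comm_group_restrict[OF B g.subgroup_kernel])
  interpret N: comm_group N by (rule N)
  have "subgroup (f ` carrier A) B" by (rule f.img_is_subgroup)
  then have sub: "subgroup (f ` carrier A) N"
    unfolding N_def using gf f.hom_closed g.subgroup_kernel
    by (auto simp: kernel_def intro!: B.subgroup_incl)
  have "f ` carrier A \<lhd> N" by (rule N.subgroup_imp_normal[OF sub])
  then interpret I: normal "f ` carrier A" N .
  define k where "k = (\<lambda>x. (f ` carrier A) #>\<^bsub>N\<^esub> h x)"
  have hN: "h x \<in> carrier N" if "x \<in> carrier K" for x
    using gh[OF that] hom_in_carrier[OF h that] by (simp add: N_def kernel_def)
  have "k \<in> hom K (N Mod (f ` carrier A))"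
  proof (rule homI)
    show "k x \<in> carrier (N Mod (f ` carrier A))" if "x \<in> carrier K" for x
      using hN[OF that] by (auto simp: k_def FactGroup_def RCOSETS_def)
    show "k (x \<otimes>\<^bsub>K\<^esub> y) = k x \<otimes>\<^bsub>N Mod (f ` carrier A)\<^esub> k y"
      if "x \<in> carrier K" "y \<in> carrier K" for x y
    proof -
      have "h (x \<otimes>\<^bsub>K\<^esub> y) = h x \<otimes>\<^bsub>N\<^esub> h y" using hom_mult[OF h that] by (simp add: N_def)
      then show ?thesis by (simp add: k_def FactGroup_def I.rcos_sum hN that)
    qed
  qed
  moreover have "k ` carrier K = carrier (N Mod (f ` carrier A))"
  proof (intro subset_antisym subsetI)
    fix Q assume "Q \<in> carrier (N Mod (f ` carrier A))"
    then obtain b where b: "b \<in> carrier N" "Q = (f ` carrier A) #>\<^bsub>N\<^esub> b"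
      by (auto simp: FactGroup_def RCOSETS_def)
    then obtain x a where xa: "x \<in> carrier K" "a \<in> carrier A" "b = f a \<otimes>\<^bsub>N\<^esub> h x"
      using surj[of b] by (auto simp: N_def kernel_def)
    \<comment> \<open>The boundary \<open>f a\<close> is absorbed by the subgroup of boundaries, so
      \<open>h x\<close> represents the same class as \<open>b\<close>.\<close>
    have "(f ` carrier A) #>\<^bsub>N\<^esub> (f a \<otimes>\<^bsub>N\<^esub> h x) = (f ` carrier A) #>\<^bsub>N\<^esub> h x"
      using xa hN I.subset N.coset_join2[OF _ sub, of "f a"]
      by (metis N.coset_mult_assoc imageI subsetD)
    then show "Q \<in> k ` carrier K" using b xa by (auto simp: k_def)
  qed (use \<open>k \<in> _\<close> in \<open>auto simp: hom_def\<close>)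
  moreover have "L = {x \<in> carrier K. k x = \<one>\<^bsub>N Mod (f ` carrier A)\<^esub>}"
    unfolding L k_def using hN N.coset_join2[OF _ sub] N.coset_join1[OF _ _ sub] I.subset
    by (auto simp: FactGroup_def)
  ultimately have "(\<lambda>Q. the_elem (k ` Q)) \<in> iso (K Mod L) (N Mod (f ` carrier A))"
    by (intro Mod_iso K I.factorgroup_is_group)
  then show ?thesis by (auto simp: is_iso_def homology_def N_def)
qed

text \<open>A commutative ladder of isomorphisms. \<open>homology_iso\<close> is applied with the
  cycles of \<open>B\<close> as \<open>K\<close>; injectivity of \<open>c\<close> reflects cycles
  and that of \<open>b\<close> reflects boundaries.\<close>

lemma homology_iso_homology:
  assumes A: "group A" and B: "comm_group B" and C: "group C"
    and f: "f \<in> hom A B" and g: "g \<in> hom B C"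
    and gf: "\<And>a. a \<in> carrier A \<Longrightarrow> g (f a) = \<one>\<^bsub>C\<^esub>"
    and A': "group A'" and B': "comm_group B'" and C': "group C'"
    and f': "f' \<in> hom A' B'" and g': "g' \<in> hom B' C'"
    and a: "a \<in> iso A A'" and b: "b \<in> iso B B'" and c: "c \<in> iso C C'"
    and ba: "\<And>x. x \<in> carrier A \<Longrightarrow> b (f x) = f' (a x)"
    and cb: "\<And>x. x \<in> carrier B \<Longrightarrow> c (g x) = g' (b x)"
  shows "homology f g A B C \<cong> homology f' g' A' B' C'"
proof -
  interpret B: comm_group B by (rule B)
  interpret B': comm_group B' by (rule B')
  interpret b: group_hom B B' b using B.is_group B'.is_group b
    by (simp add: iso_def group_hom_def group_hom_axioms_def)
  interpret c: group_hom C C' c using C C' c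
    by (simp add: iso_def group_hom_def group_hom_axioms_def)
  interpret g: group_hom B C g using C B.is_group g by (simp add: group_hom_def group_hom_axioms_def)
  have aim: "a ` carrier A = carrier A'" and bim: "b ` carrier B = carrier B'"
    and binj: "inj_on b (carrier B)" and cinj: "inj_on c (carrier C)"
    using a b c by (auto simp: iso_def bij_betw_def)
  note fcl = hom_in_carrier[OF f]
  note gcl = hom_in_carrier[OF g]
  have ker: "g' (b x) = \<one>\<^bsub>C'\<^esub> \<longleftrightarrow> g x = \<one>\<^bsub>C\<^esub>" if "x \<in> carrier B" for x
    using cb[OF that] inj_onD[OF cinj, of "g x" "\<one>\<^bsub>C\<^esub>"] gcl[OF that] by auto
  define K where "K = B\<lparr>carrier := kernel B C g\<rparr>"
  have K: "comm_group K" unfolding K_def by (rule comm_group_restrict[OF B g.subgroup_kernel])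
  have "K Mod (f ` carrier A) \<cong> homology f' g' A' B' C'"
  proof (rule homology_iso[OF A' B' C' f' g' _ _ , where h=b])
    show "g' (f' y) = \<one>\<^bsub>C'\<^esub>" if y: "y \<in> carrier A'" for y
    proof -
      obtain x where x: "x \<in> carrier A" "y = a x" using aim y by auto
      then show ?thesis using ker[OF fcl[OF x(1)]] ba gf by simp
    qed
    show "group K" using K by (simp add: comm_group_def)
    show "b \<in> hom K B'" using b.homh by (auto simp: hom_def K_def kernel_def)
    show "g' (b x) = \<one>\<^bsub>C'\<^esub>" if "x \<in> carrier K" for x
      using ker that by (auto simp: K_def kernel_def)
    show "\<exists>x\<in>carrier K. \<exists>a\<in>carrier A'. y = f' a \<otimes>\<^bsub>B'\<^esub> b x"
      if y: "y \<in> carrier B'" "g' y = \<one>\<^bsub>C'\<^esub>" for y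
    proof -
      obtain x where x: "x \<in> carrier B" "y = b x" using bim y by auto
      have A1: "\<one>\<^bsub>A'\<^esub> \<in> carrier A'" using A' by (simp add: group.is_monoid monoid.one_closed)
      have "f' \<one>\<^bsub>A'\<^esub> = \<one>\<^bsub>B'\<^esub>" using hom_one[OF f' A' B'.is_group] .
      moreover have "x \<in> carrier K" using x y ker by (simp add: K_def kernel_def)
      ultimately show ?thesis using x A1 y(1) by force
    qed
    have "b x \<in> f' ` carrier A' \<longleftrightarrow> x \<in> f ` carrier A" if x: "x \<in> carrier B" for x
    proof -
      have "f' ` carrier A' = b ` (f ` carrier A)"
        using ba aim by (metis (no_types, lifting) image_cong image_image)
      moreover have "f ` carrier A \<subseteq> carrier B" using fcl by auto
      ultimately show ?thesis using inj_on_image_mem_iff[OF binj x] by metis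
    qed
    then show "f ` carrier A = {x \<in> carrier K. b x \<in> f' ` carrier A'}"
      using gf fcl by (auto simp: K_def kernel_def)
  qed
  then show ?thesis by (simp add: homology_def K_def)
qed

section \<open>Spectral sequence of a filtered complex\<close>

text \<open>The grading and the filtration are carried by the sets \<open>Fil p n\<close> inside one
  type, so additivity and \<open>d (d x) = 0\<close> are demanded on \<open>Fil 0 n\<close>. The
  filtration is constant up to index 0, and the index where it reaches zero may depend on
  \<open>n\<close>.\<close>

locale filtered_complex =
  fixes Fil :: "int \<Rightarrow> int \<Rightarrow> 'a::ab_group_add set" and d :: "'a \<Rightarrow> 'a"
  assumes Fil_subspace: "f2_subspace (Fil p n)"
    and Fil_antimono: "p \<le> p' \<Longrightarrow> Fil p' n \<subseteq> Fil p n"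
    and Fil_nonpos: "p \<le> 0 \<Longrightarrow> Fil p n = Fil 0 n"
    and Fil_bounded: "\<exists>p. Fil p n = {0}"
    and d_add: "x \<in> Fil 0 n \<Longrightarrow> y \<in> Fil 0 n \<Longrightarrow> d (x + y) = d x + d y"
    and d_Fil: "x \<in> Fil p n \<Longrightarrow> d x \<in> Fil p (n + 1)"
    and d_d: "x \<in> Fil 0 n \<Longrightarrow> d (d x) = 0"
begin

text \<open>The usual approximate cycles. Levels are integers so that the level \<open>r - 1\<close>
  occurring in \<open>B\<close> calls for no case distinction.\<close>

definition Z :: "int \<Rightarrow> int \<Rightarrow> int \<Rightarrow> 'a set" where
  "Z r p n = {x \<in> Fil p n. d x \<in> Fil (p + r) (n + 1)}"

text \<open>The first summand is all of \<open>Z r p n\<close> that has filtration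
  \<open>p + 1\<close>, since \<open>(p + 1) + (r - 1) = p + r\<close>. The second consists of the
  boundaries that reach filtration \<open>p\<close> from \<open>r - 1\<close> steps before. Hence
  the page is simply \<open>Z\<close> modulo \<open>B\<close>.\<close>

definition B :: "int \<Rightarrow> int \<Rightarrow> int \<Rightarrow> 'a set" where
  "B r p n = {x + d y | x y. x \<in> Z (r - 1) (p + 1) n \<and> y \<in> Z (r - 1) (p - r + 1) (n - 1)}"

definition page :: "nat \<Rightarrow> int \<Rightarrow> int \<Rightarrow> 'a set monoid" where
  "page r p q = quotient_space (Z (int r) p (p + q)) (B (int r) p (p + q))"

definition page_d :: "nat \<Rightarrow> int \<Rightarrow> int \<Rightarrow> 'a set \<Rightarrow> 'a set" where
  "page_d r p q = quotient_map (B (int r) (p + int r) (p + q + 1)) d"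

definition cycles :: "int \<Rightarrow> 'a set" where
  "cycles n = {x \<in> Fil 0 n. d x = 0}"

lemma Fil_0: "x \<in> Fil p n \<Longrightarrow> x \<in> Fil 0 n"
  using Fil_antimono[of 0 p n] Fil_nonpos[of p n] by (cases "p \<le> 0") auto

lemma d_add': "x \<in> Fil p n \<Longrightarrow> y \<in> Fil p' n \<Longrightarrow> d (x + y) = d x + d y"
  using Fil_0 d_add by blast

lemma d_zero: "d 0 = 0"
  using d_add[of 0 0 0] f2_subspaceD(1)[OF Fil_subspace[of 0 0]] by simp

lemma d_d': "x \<in> Fil p n \<Longrightarrow> d (d x) = 0"
  using Fil_0 d_d by blast

lemma Z_subspace: "f2_subspace (Z r p n)"
  using f2_subspaceD[OF Fil_subspace] d_add' d_zero
  by (auto simp: f2_subspace_def Z_def)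

lemma Z_mono: "p \<le> p' \<Longrightarrow> p + r \<le> p' + r' \<Longrightarrow> Z r' p' n \<subseteq> Z r p n"
  using Fil_antimono[of p p' n] Fil_antimono[of "p + r" "p' + r'" "n + 1"] by (auto simp: Z_def)

lemma Z_imp_Fil: "x \<in> Z r p n \<Longrightarrow> x \<in> Fil p n"
  by (simp add: Z_def)

text \<open>The level \<open>r'\<close> is arbitrary because \<open>d (d y) = 0\<close> lies in
  every filtration step.\<close>

lemma d_Z: "y \<in> Z r p n \<Longrightarrow> p + r = p' \<Longrightarrow> n + 1 = n' \<Longrightarrow> d y \<in> Z r' p' n'"
  using f2_subspaceD(1)[OF Fil_subspace] by (auto simp: Z_def d_d')

lemma B_subset_Z: "B r p n \<subseteq> Z r p n"
proof
  fix z assume "z \<in> B r p n"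
  then obtain x y where xy: "z = x + d y" "x \<in> Z (r - 1) (p + 1) n" "y \<in> Z (r - 1) (p - r + 1) (n - 1)"
    by (auto simp: B_def)
  have "x \<in> Z r p n" using xy(2) Z_mono[of p "p + 1" r "r - 1" n] by auto
  moreover have "d y \<in> Z r p n" by (rule d_Z[OF xy(3)]) auto
  ultimately show "z \<in> Z r p n" using xy(1) f2_subspaceD(2)[OF Z_subspace] by blast
qed

lemma B_subspace: "f2_subspace (B r p n)"
proof -
  have "x \<in> B r p n \<Longrightarrow> x + x = 0" for x
    using B_subset_Z f2_subspaceD(3)[OF Z_subspace] by blast
  moreover have "0 \<in> B r p n" using f2_subspaceD(1)[OF Z_subspace] d_zero
    by (force simp: B_def)
  moreover have "z + z' \<in> B r p n" if z: "z \<in> B r p n" and z': "z' \<in> B r p n" for z z'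
  proof -
    obtain x y where xy: "z = x + d y" "x \<in> Z (r - 1) (p + 1) n" "y \<in> Z (r - 1) (p - r + 1) (n - 1)"
      using z by (auto simp: B_def)
    obtain x' y' where xy': "z' = x' + d y'" "x' \<in> Z (r - 1) (p + 1) n" "y' \<in> Z (r - 1) (p - r + 1) (n - 1)"
      using z' by (auto simp: B_def)
    have "z + z' = (x + x') + d (y + y')"
      using xy xy' d_add'[OF Z_imp_Fil Z_imp_Fil] by (simp add: algebra_simps)
    then show ?thesis using xy xy' f2_subspaceD(2)[OF Z_subspace] unfolding B_def by blast
  qed
  ultimately show ?thesis by (auto simp: f2_subspace_def)
qed

text \<open>Below 0 the steps \<open>p\<close> and \<open>p + 1\<close> of the filtration coincide,
  so the first summand of \<open>B\<close> is already everything.\<close>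

lemma B_nonpos: "p < 0 \<Longrightarrow> B r p n = Z r p n"
proof (rule subset_antisym[OF B_subset_Z])
  assume "p < 0"
  then have "Z r p n = Z (r - 1) (p + 1) n"
    using Fil_nonpos[of p n] Fil_nonpos[of "p + 1" n] by (simp add: Z_def)
  then show "Z r p n \<subseteq> B r p n" using f2_subspaceD(1)[OF Z_subspace] d_zero
    by (force simp: B_def)
qed

lemma B_zero_subset: "Fil p n = {0} \<Longrightarrow> Z r p n = {0} \<and> B r p n = {0}"
  using f2_subspaceD(1)[OF Z_subspace, of r p n] f2_subspaceD(1)[OF B_subspace, of r p n]
    B_subset_Z[of r p n] by (auto simp: Z_def)

lemma page_f2: "f2_space (page r p q)"
  unfolding page_def by (intro f2_space_quotient_space Z_subspace B_subspace B_subset_Z)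

lemma page_group: "comm_group (page r p q)" "group (page r p q)"
  using page_f2[of r p q] by (auto simp: f2_space_def comm_group_def)

lemma trivial_quotient_space: "f2_subspace S \<Longrightarrow> trivial_group (quotient_space S S)"
  using f2_space_quotient_space[of S S] coset_eq_one_iff[of S S] f2_subspaceD(1)[of S]
  by (force simp: trivial_group_def f2_space_def comm_group_def carrier_quotient_space)

lemma page_neg: "p < 0 \<Longrightarrow> trivial_group (page r p q)"
  unfolding page_def by (simp add: B_nonpos trivial_quotient_space Z_subspace)

text \<open>If \<open>x = y + d z\<close>, then \<open>d x = d y\<close>, and \<open>y\<close> has
  just the level and the filtration demanded in the second summand of \<open>B\<close> at
  \<open>p + r\<close>.\<close>

lemma d_ZB:
  assumes "n' = n + 1" "p' = p + r"
  shows "x \<in> Z r p n \<Longrightarrow> d x \<in> Z r p' n'" "x \<in> B r p n \<Longrightarrow> d x \<in> B r p' n'"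
proof -
  show "x \<in> Z r p n \<Longrightarrow> d x \<in> Z r p' n'" using assms by (intro d_Z) auto
  assume "x \<in> B r p n"
  then obtain y z where yz: "x = y + d z" "y \<in> Z (r - 1) (p + 1) n" "z \<in> Z (r - 1) (p - r + 1) (n - 1)"
    by (auto simp: B_def)
  have "d z \<in> Fil p n" using yz(3) by (auto simp: Z_def)
  then have "d x = 0 + d y" using yz d_add'[OF Z_imp_Fil, of y "r - 1" "p + 1" n "d z" p] d_d'[OF Z_imp_Fil[OF yz(3)]]
    by simp
  then show "d x \<in> B r p' n'" using yz(2) assms f2_subspaceD(1)[OF Z_subspace]
    unfolding B_def by (force simp: algebra_simps)
qed

lemma page_d_coset:
  assumes "x \<in> Z (int r) p (p + q)"
  shows "page_d r p q (coset (B (int r) p (p + q)) x) = coset (B (int r) (p + int r) (p + q + 1)) (d x)"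
  unfolding page_d_def
  by (rule quotient_map_coset[OF Z_subspace B_subspace B_subset_Z Z_subspace B_subspace B_subset_Z])
    (use assms d_ZB d_add'[OF Z_imp_Fil Z_imp_Fil] in auto)

lemma page_d_hom: "page_d r p q \<in> hom (page r p q) (page r (p + int r) (q - int r + 1))"
proof -
  have *: "p + int r + (q - int r + 1) = p + q + 1" by simp
  show ?thesis
    unfolding page_d_def page_def *
    by (rule quotient_map_hom[OF Z_subspace B_subspace B_subset_Z Z_subspace B_subspace B_subset_Z])
      (use d_ZB d_add'[OF Z_imp_Fil Z_imp_Fil] in auto)
qed

lemma page_cases:
  assumes "Q \<in> carrier (page r p q)"
  obtains x where "x \<in> Z (int r) p (p + q)" "Q = coset (B (int r) p (p + q)) x"
  using assms by (auto simp: page_def carrier_quotient_space)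

lemma page_d_page_d:
  assumes "Q \<in> carrier (page r p q)"
  shows "page_d r (p + int r) (q - int r + 1) (page_d r p q Q)
    = \<one>\<^bsub>page r (p + 2 * int r) (q - 2 * int r + 2)\<^esub>"
proof -
  obtain x where x: "x \<in> Z (int r) p (p + q)" "Q = coset (B (int r) p (p + q)) x"
    using assms by (rule page_cases)
  have e: "p + int r + (q - int r + 1) = p + q + 1" by simp
  have "d x \<in> Z (int r) (p + int r) (p + int r + (q - int r + 1))"
    unfolding e using x d_ZB by auto
  from page_d_coset[OF this] show ?thesis
    using x d_d'[OF Z_imp_Fil[OF x(1)]]
    by (simp add: page_d_coset page_def) (simp add: algebra_simps)
qed

text \<open>The inclusion of the approximate cycles of level \<open>r + 1\<close> into those of
  level \<open>r\<close> induces the isomorphism. Two things have to be seen: each cycle of the page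
  has a representative of level \<open>r + 1\<close>, and those representing boundaries of the page
  form exactly \<open>B\<close> of level \<open>r + 1\<close>.\<close>

lemma page_Suc:
  assumes "r \<ge> 1"
  shows "page (Suc r) p q \<cong>
       homology (page_d r (p - int r) (q + int r - 1)) (page_d r p q)
         (page r (p - int r) (q + int r - 1)) (page r p q) (page r (p + int r) (q - int r + 1))"
  unfolding page_def[of "Suc r"] quotient_space_def
proof (rule homology_iso)
  let ?Z = "Z (int r) p (p + q)" and ?B = "B (int r) p (p + q)"
  let ?Z' = "Z (int (Suc r)) p (p + q)" and ?B' = "B (int (Suc r)) p (p + q)"
  let ?f = "page_d r (p - int r) (q + int r - 1)" and ?A = "page r (p - int r) (q + int r - 1)"
  have ZZ: "?Z' \<subseteq> ?Z" by (rule Z_mono) auto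
  have im_f: "?f ` carrier ?A = (\<lambda>y. coset ?B (d y)) ` Z (int r) (p - int r) (p + q - 1)"
  proof -
    have e: "p - int r + (q + int r - 1) = p + q - 1" by simp
    show ?thesis using page_d_coset[of _ r "p - int r" "q + int r - 1"]
      unfolding page_def carrier_quotient_space image_image e by (auto intro!: image_cong)
  qed
  show "group ?A" "comm_group (page r p q)" "group (page r (p + int r) (q - int r + 1))"
    "group (add_group ?Z')"
    using page_group comm_group_add_group[OF Z_subspace] by (auto simp: comm_group_def)
  show f: "?f \<in> hom ?A (page r p q)" using page_d_hom[of r "p - int r" "q + int r - 1"] by simp
  show "page_d r p q \<in> hom (page r p q) (page r (p + int r) (q - int r + 1))"
    by (rule page_d_hom)
  show "page_d r p q (?f a) = \<one>\<^bsub>page r (p + int r) (q - int r + 1)\<^esub>" if "a \<in> carrier ?A" for a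
    using page_d_page_d[OF that] by (simp add: algebra_simps)
  have "coset ?B \<in> hom (add_group ?Z) (page r p q)"
    unfolding page_def by (rule coset_hom[OF Z_subspace B_subspace B_subset_Z])
  then show "coset ?B \<in> hom (add_group ?Z') (page r p q)"
    using ZZ by (simp add: hom_def Pi_iff subset_iff)
  have one: "page_d r p q (coset ?B x) = \<one>\<^bsub>page r (p + int r) (q - int r + 1)\<^esub>
      \<longleftrightarrow> d x \<in> B (int r) (p + int r) (p + q + 1)" if x: "x \<in> ?Z" for x
  proof -
    have e: "p + int r + (q - int r + 1) = p + q + 1" by simp
    show ?thesis unfolding page_d_coset[OF x] page_def one_quotient_space e
      by (rule coset_eq_one_iff[OF Z_subspace B_subspace B_subset_Z d_ZB(1)[OF _ _ x]]) auto
  qed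
  show "page_d r p q (coset ?B x) = \<one>\<^bsub>page r (p + int r) (q - int r + 1)\<^esub>"
    if "x \<in> carrier (add_group ?Z')" for x
  proof -
    have x: "x \<in> ?Z'" using that by simp
    have "d x \<in> Z (int r - 1) (p + int r + 1) (p + q + 1)"
      using d_Z[OF x] by (simp add: algebra_simps)
    then have "d x + d 0 \<in> B (int r) (p + int r) (p + q + 1)"
      using f2_subspaceD(1)[OF Z_subspace] unfolding B_def by blast
    then show ?thesis using one x ZZ d_zero by auto
  qed
  show "\<exists>x\<in>carrier (add_group ?Z'). \<exists>a\<in>carrier ?A. b = ?f a \<otimes>\<^bsub>page r p q\<^esub> coset ?B x"
    if b: "b \<in> carrier (page r p q)" and gb: "page_d r p q b = \<one>\<^bsub>page r (p + int r) (q - int r + 1)\<^esub>" for b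
  proof -
    obtain z where z: "z \<in> ?Z" "b = coset ?B z" using b by (rule page_cases)
    then have "d z \<in> B (int r) (p + int r) (p + q + 1)" using one gb by simp
    then obtain y w where yw: "d z = y + d w" "y \<in> Z (int r - 1) (p + int r + 1) (p + q + 1)"
      "w \<in> Z (int r - 1) (p + 1) (p + q)" by (auto simp: B_def)
    \<comment> \<open>Adding \<open>w\<close> removes from \<open>d z\<close> the part
      \<open>d w\<close>, leaving \<open>y\<close> of deeper filtration. As \<open>w\<close> lies in
      \<open>B\<close>, the class of \<open>z\<close> is unchanged and \<open>a\<close> can be taken
      to be the unit.\<close>
    define x where "x = z + w"
    have wZ: "w \<in> ?Z" using yw(3) Z_mono[of p "p + 1" "int r" "int r - 1"] by auto
    have dw: "d w \<in> Z (int r) (p + int r) (p + q + 1)" using wZ d_ZB by auto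
    have "d x = y + (d w + d w)"
      using d_add'[OF Z_imp_Fil[OF z(1)] Z_imp_Fil[OF wZ]] yw(1) by (simp add: x_def add.assoc)
    then have dx: "d x = y" using f2_subspaceD(3)[OF Z_subspace dw] by simp
    have xZ: "x \<in> ?Z" using z(1) wZ f2_subspaceD(2)[OF Z_subspace] by (simp add: x_def)
    then have x: "x \<in> ?Z'" using yw(2) dx by (simp add: Z_def algebra_simps)
    have "w + d 0 \<in> ?B" using yw(3) f2_subspaceD(1)[OF Z_subspace] unfolding B_def by blast
    then have "z + x \<in> ?B" using d_zero by (simp add: x_def f2_add_cancel[OF Z_subspace z(1), of w])
    then have "b = coset ?B x" using z coset_eq_iff[OF Z_subspace B_subspace B_subset_Z z(1) xZ] by simp
    moreover have "\<one>\<^bsub>?A\<^esub> \<in> carrier ?A" using page_group by (simp add: group.is_monoid monoid.one_closed)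
    moreover have "?f \<one>\<^bsub>?A\<^esub> = \<one>\<^bsub>page r p q\<^esub>" by (rule hom_one[OF f page_group(2) page_group(2)])
    ultimately have "b = ?f \<one>\<^bsub>?A\<^esub> \<otimes>\<^bsub>page r p q\<^esub> coset ?B x" "\<one>\<^bsub>?A\<^esub> \<in> carrier ?A"
      using b page_group(2) by (simp_all add: group.is_monoid monoid.l_one)
    then show ?thesis using x by auto
  qed
  show "?B' = {x \<in> carrier (add_group ?Z'). coset ?B x \<in> ?f ` carrier ?A}"
  proof (intro subset_antisym subsetI)
    fix z assume z: "z \<in> ?B'"
    then obtain x y where xy: "z = x + d y" "x \<in> Z (int r) (p + 1) (p + q)" "y \<in> Z (int r) (p - int r) (p + q - 1)"
      by (auto simp: B_def)
    have zZ: "z \<in> ?Z'" using z B_subset_Z by blast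
    have dy: "d y \<in> ?Z" by (rule d_Z[OF xy(3)]) auto
    have "x \<in> Z (int r - 1) (p + 1) (p + q)" using xy(2) Z_mono[of "p + 1" "p + 1" "int r - 1" "int r"] by auto
    then have "x + d 0 \<in> ?B" using f2_subspaceD(1)[OF Z_subspace] unfolding B_def by blast
    then have "z + d y \<in> ?B" using xy(1) d_zero f2_subspaceD(3)[OF Z_subspace dy] by (simp add: add.assoc)
    then have "coset ?B z = coset ?B (d y)" using zZ ZZ dy
      by (subst coset_eq_iff[OF Z_subspace B_subspace B_subset_Z]) auto
    then show "z \<in> {x \<in> carrier (add_group ?Z'). coset ?B x \<in> ?f ` carrier ?A}"
      using zZ xy(3) by (auto simp: im_f)
  next
    fix z assume "z \<in> {x \<in> carrier (add_group ?Z'). coset ?B x \<in> ?f ` carrier ?A}"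
    then obtain y where y: "z \<in> ?Z'" "y \<in> Z (int r) (p - int r) (p + q - 1)" "coset ?B z = coset ?B (d y)"
      by (auto simp: im_f)
    have dy: "d y \<in> ?Z" by (rule d_Z[OF y(2)]) auto
    then have "z + d y \<in> ?B" using y ZZ coset_eq_iff[OF Z_subspace B_subspace B_subset_Z, of z _ _ _ "d y"] by auto
    then obtain w v where wv: "z + d y = w + d v" "w \<in> Z (int r - 1) (p + 1) (p + q)"
      "v \<in> Z (int r - 1) (p - int r + 1) (p + q - 1)" by (auto simp: B_def)
    have vZ: "v \<in> Z (int r) (p - int r) (p + q - 1)"
      using wv(3) Z_mono[of "p - int r" "p - int r + 1" "int r" "int r - 1"] by auto
    have dv: "d v \<in> ?Z" by (rule d_Z[OF vZ]) auto
    have "z = z + (d y + d y)" using f2_subspaceD(3)[OF Z_subspace dy] by simp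
    also have "\<dots> = w + (d v + d y)" using wv(1) by (simp flip: add.assoc)
    also have "d v + d y = d (v + y)" using d_add'[OF Z_imp_Fil[OF vZ] Z_imp_Fil[OF y(2)]] by simp
    finally have zw: "z = w + d (v + y)" .
    have vy: "v + y \<in> Z (int r) (p - int r) (p + q - 1)" using vZ y(2) f2_subspaceD(2)[OF Z_subspace] by blast
    \<comment> \<open>So far \<open>d w\<close> is only known to lie in filtration
      \<open>p + r\<close>. As \<open>d w = d z\<close>, it lies one step deeper, which raises the
      level of \<open>w\<close> from \<open>r - 1\<close> to \<open>r\<close>.\<close>
    have "d (d (v + y)) = 0" using vy d_d' Z_imp_Fil by blast
    moreover have "d (v + y) \<in> Fil p (p + q)" using d_Z[OF vy, of p "p + q"] Z_imp_Fil by auto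
    ultimately have "d z = d w" using d_add'[OF Z_imp_Fil[OF wv(2)], of "d (v + y)" p] zw by simp
    then have "w \<in> Z (int r) (p + 1) (p + q)" using wv(2) y(1) by (simp add: Z_def algebra_simps)
    then show "z \<in> ?B'" using zw vy by (auto simp: B_def)
  qed
qed

theorem spectral_sequence_page: "spectral_sequence page page_d"
  unfolding spectral_sequence_def
  using page_f2 page_d_hom page_d_page_d page_Suc by blast

section \<open>The limit term and convergence\<close>

definition boundaries :: "int \<Rightarrow> 'a set" where
  "boundaries n = d ` Fil 0 (n - 1)"

lemma cycles_subspace: "f2_subspace (cycles n)"
  using f2_subspaceD[OF Fil_subspace[of 0 n]] d_add d_zero
  by (auto simp: f2_subspace_def cycles_def)

lemma boundaries_subspace: "f2_subspace (boundaries n)"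
proof -
  have "0 \<in> boundaries n" unfolding boundaries_def
    using f2_subspaceD(1)[OF Fil_subspace] d_zero by (metis image_eqI)
  moreover have "\<forall>x\<in>boundaries n. \<forall>y\<in>boundaries n. x + y \<in> boundaries n"
    using f2_subspaceD(2)[OF Fil_subspace[of 0 "n - 1"]] d_add
    by (auto simp: boundaries_def simp flip: d_add)
  moreover have "x + x = 0" if x: "x \<in> boundaries n" for x
  proof -
    obtain y where y: "x = d y" "y \<in> Fil 0 (n - 1)" using x by (auto simp: boundaries_def)
    then show ?thesis using d_add[OF y(2) y(2)] f2_subspaceD(3)[OF Fil_subspace y(2)] d_zero by simp
  qed
  ultimately show ?thesis by (simp add: f2_subspace_def)
qed

lemma boundaries_subset_cycles: "boundaries n \<subseteq> cycles n"
  using d_Fil[of _ 0 "n - 1"] d_d by (auto simp: boundaries_def cycles_def)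

lemma homology_eq:
  "homology d d (add_group (Fil 0 (n - 1))) (add_group (Fil 0 n)) (add_group (Fil 0 (n + 1)))
    = quotient_space (cycles n) (boundaries n)"
  by (simp add: homology_def quotient_space_def kernel_def cycles_def boundaries_def add_group_def)

lemma page_large:
  assumes "Fil P (n + 1) = {0}" "p + int r \<ge> P" "int r > p" "r \<ge> 1" and n: "n = p + q"
  shows "Z (int r) p n = cycles n \<inter> Fil p n"
    and "B (int r) p n = {x + y |x y. x \<in> cycles n \<inter> Fil (p + 1) n \<and> y \<in> boundaries n \<inter> Fil p n}"
proof -
  have zero: "Fil p' (n + 1) = {0}" if "p' \<ge> P" for p'
    using Fil_antimono[OF that, of "n + 1"] f2_subspaceD(1)[OF Fil_subspace] assms(1) by auto
  show "Z (int r) p n = cycles n \<inter> Fil p n"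
    using zero[of "p + int r"] assms Fil_0 by (auto simp: Z_def cycles_def)
  have "Z (int r - 1) (p + 1) n = cycles n \<inter> Fil (p + 1) n"
    using zero[of "p + int r"] assms Fil_0 by (auto simp: Z_def cycles_def)
  moreover have "d ` Z (int r - 1) (p - int r + 1) (n - 1) = boundaries n \<inter> Fil p n"
    using Fil_nonpos[of "p - int r + 1" "n - 1"] assms by (auto simp: Z_def boundaries_def)
  moreover have "B (int r) p n = {x + y |x y. x \<in> Z (int r - 1) (p + 1) n \<and>
      y \<in> d ` Z (int r - 1) (p - int r + 1) (n - 1)}"
    unfolding B_def by blast
  ultimately show "B (int r) p n = {x + y |x y. x \<in> cycles n \<inter> Fil (p + 1) n \<and> y \<in> boundaries n \<inter> Fil p n}"
    by simp
qed

definition homology_fil :: "int \<Rightarrow> int \<Rightarrow> 'a set set" where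
  "homology_fil p n = coset (boundaries n) ` (cycles n \<inter> Fil p n)"

lemma subgroup_image:
  assumes "group G" "group H" "h \<in> hom G H" "subgroup K G"
  shows "subgroup (h ` K) H"
  using assms by (metis group_hom.subgroup_img_is_subgroup group_hom_axioms_def group_hom_def)

lemma cycles_Fil_subspace: "f2_subspace (cycles n \<inter> Fil p n)"
  using f2_subspaceD[OF Fil_subspace[of p n]] f2_subspaceD[OF cycles_subspace[of n]]
  by (auto simp: f2_subspace_def)

lemma homology_f2: "f2_space (quotient_space (cycles n) (boundaries n))"
  by (intro f2_space_quotient_space cycles_subspace boundaries_subspace boundaries_subset_cycles)

lemma coset_boundaries_hom:
  "coset (boundaries n) \<in> hom (add_group (cycles n)) (quotient_space (cycles n) (boundaries n))"
  by (intro coset_hom cycles_subspace boundaries_subspace boundaries_subset_cycles)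

lemma homology_fil_subgroup:
  "subgroup (homology_fil p n) (quotient_space (cycles n) (boundaries n))"
  unfolding homology_fil_def
proof (rule subgroup_image[OF _ _ coset_boundaries_hom])
  show "group (add_group (cycles n))" "group (quotient_space (cycles n) (boundaries n))"
    using homology_f2 comm_group_add_group[OF cycles_subspace]
    by (auto simp: f2_space_def comm_group_def)
qed (intro subgroup_add_group cycles_subspace cycles_Fil_subspace, simp)

text \<open>Cycles in \<open>Fil p n\<close> map onto the graded piece of homology. A cycle dies
  there if and only if a boundary moves it into \<open>Fil (p + 1) n\<close>; that boundary then
  lies in \<open>Fil p n\<close> itself, which gives \<open>B\<close> in its form for large
  \<open>r\<close>.\<close>

lemma page_infinity:
  assumes "Fil P (n + 1) = {0}" "p + int r \<ge> P" "int r > p" "r \<ge> 1" and n: "n = p + q"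
  shows "page r p q \<cong> ((quotient_space (cycles n) (boundaries n))\<lparr>carrier := homology_fil p n\<rparr>)
    Mod (homology_fil (p + 1) n)"
proof -
  define H where "H = (quotient_space (cycles n) (boundaries n))\<lparr>carrier := homology_fil p n\<rparr>"
  define S where "S = cycles n \<inter> Fil p n"
  note [simp] = page_large[OF assms, folded S_def]
  have H: "f2_space H" unfolding H_def by (rule f2_space_restrict[OF homology_f2 homology_fil_subgroup])
  have H': "comm_group H" "group H" using H by (auto simp: f2_space_def comm_group_def)
  have SC: "S \<subseteq> cycles n" by (auto simp: S_def)
  have S: "f2_subspace S" unfolding S_def by (rule cycles_Fil_subspace)
  have sub: "subgroup (homology_fil (p + 1) n) H"
    unfolding H_def using homology_f2[of n] homology_fil_subgroup Fil_antimono[of p "p + 1" n]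
    by (intro group.subgroup_incl) (auto simp: f2_space_def comm_group_def homology_fil_def)
  then interpret N: normal "homology_fil (p + 1) n" H by (rule comm_group.subgroup_imp_normal[OF H'(1)])
  define h where "h = (\<lambda>x. homology_fil (p + 1) n #>\<^bsub>H\<^esub> coset (boundaries n) x)"
  have cH: "coset (boundaries n) x \<in> carrier H" if "x \<in> S" for x
    using that by (auto simp: H_def homology_fil_def S_def)
  have hhom: "h \<in> hom (add_group S) (H Mod homology_fil (p + 1) n)"
  proof (rule homI)
    show "h x \<in> carrier (H Mod homology_fil (p + 1) n)" if "x \<in> carrier (add_group S)" for x
      using cH[of x] that by (auto simp: h_def FactGroup_def RCOSETS_def)
    show "h (x \<otimes>\<^bsub>add_group S\<^esub> y) = h x \<otimes>\<^bsub>H Mod homology_fil (p + 1) n\<^esub> h y"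
      if "x \<in> carrier (add_group S)" "y \<in> carrier (add_group S)" for x y
    proof -
      have xy: "x \<in> S" "y \<in> S" using that by auto
      have "coset (boundaries n) (x + y) = coset (boundaries n) x \<otimes>\<^bsub>H\<^esub> coset (boundaries n) y"
        using hom_mult[OF coset_boundaries_hom, of x n y] xy SC by (auto simp: H_def)
      then show ?thesis using xy by (simp add: h_def FactGroup_def N.rcos_sum cH)
    qed
  qed
  have him: "h ` carrier (add_group S) = carrier (H Mod homology_fil (p + 1) n)"
    by (auto simp: h_def FactGroup_def RCOSETS_def H_def homology_fil_def S_def)
  have hone: "h x = \<one>\<^bsub>H Mod homology_fil (p + 1) n\<^esub> \<longleftrightarrow> x \<in> B (int r) p n" if x: "x \<in> S" for x
  proof -
    have "h x = \<one>\<^bsub>H Mod homology_fil (p + 1) n\<^esub> \<longleftrightarrow> coset (boundaries n) x \<in> homology_fil (p + 1) n"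
      using N.coset_join1[OF _ _ sub] N.coset_join2[OF _ sub] cH[OF x] N.subset
      by (auto simp: h_def FactGroup_def)
    also have "\<dots> \<longleftrightarrow> (\<exists>y \<in> cycles n \<inter> Fil (p + 1) n. x + y \<in> boundaries n)"
      using coset_eq_iff[OF cycles_subspace boundaries_subspace boundaries_subset_cycles, of x n] x SC
      by (auto simp: homology_fil_def)
    also have "\<dots> \<longleftrightarrow> x \<in> B (int r) p n"
    proof
      assume "\<exists>y \<in> cycles n \<inter> Fil (p + 1) n. x + y \<in> boundaries n"
      then obtain y where y: "y \<in> cycles n \<inter> Fil (p + 1) n" "x + y \<in> boundaries n" by blast
      have "y \<in> Fil p n" using y Fil_antimono[of p "p + 1" n] by auto
      then have "y + x \<in> boundaries n \<inter> Fil p n"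
        using y x f2_subspaceD(2)[OF Fil_subspace] by (auto simp: S_def add.commute)
      moreover have "x = y + (y + x)" using y f2_add_cancel[OF Fil_subspace] by auto
      ultimately have "\<exists>v w. x = v + w \<and> v \<in> cycles n \<inter> Fil (p + 1) n \<and> w \<in> boundaries n \<inter> Fil p n"
        using y(1) by blast
      then show "x \<in> B (int r) p n" by simp
    next
      assume "x \<in> B (int r) p n"
      then obtain y z where yz: "x = y + z" "y \<in> cycles n \<inter> Fil (p + 1) n" "z \<in> boundaries n \<inter> Fil p n"
        by auto
      have "y + x = z" using yz f2_add_cancel[OF Fil_subspace[of "p + 1" n], of y z] by simp
      then have "x + y \<in> boundaries n" using yz(3) by (simp add: add.commute)
      then show "\<exists>y \<in> cycles n \<inter> Fil (p + 1) n. x + y \<in> boundaries n" using yz(2) by blast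
    qed
    finally show ?thesis .
  qed
  have BS: "B (int r) p n \<subseteq> S" using B_subset_Z[of "int r" p n] by simp
  have "(\<lambda>Q. the_elem (h ` Q)) \<in> iso (add_group S Mod B (int r) p n) (H Mod homology_fil (p + 1) n)"
  proof (rule Mod_iso(1)[OF _ _ hhom him])
    show "B (int r) p n = {x \<in> carrier (add_group S). h x = \<one>\<^bsub>H Mod homology_fil (p + 1) n\<^esub>}"
      unfolding add_group_simps using hone BS by blast
    show "group (add_group S)" using comm_group_add_group[OF S] by (simp add: comm_group_def)
    show "group (H Mod homology_fil (p + 1) n)" by (rule N.factorgroup_is_group)
  qed
  moreover have "page r p q = add_group S Mod B (int r) p n"
    by (simp add: page_def quotient_space_def flip: n del: page_large(2))
  ultimately show ?thesis unfolding H_def is_iso_def by auto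
qed

lemma page_d_trivial:
  assumes "trivial_group (page r p q) \<or> trivial_group (page r (p + int r) (q - int r + 1))"
    and x: "x \<in> carrier (page r p q)"
  shows "page_d r p q x = \<one>\<^bsub>page r (p + int r) (q - int r + 1)\<^esub>"
  using assms(1)
proof
  assume "trivial_group (page r p q)"
  then have "x = \<one>\<^bsub>page r p q\<^esub>" using x by (simp add: trivial_group_def)
  then show ?thesis using hom_one[OF page_d_hom page_group(2) page_group(2)] by simp
next
  assume "trivial_group (page r (p + int r) (q - int r + 1))"
  then show ?thesis using hom_in_carrier[OF page_d_hom x] by (simp add: trivial_group_def)
qed

theorem page_converges: "converges_to page page_d (\<lambda>n. quotient_space (cycles n) (boundaries n))"
  unfolding converges_to_def
proof (intro exI[of _ homology_fil] conjI allI)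
  show "f2_space (quotient_space (cycles n) (boundaries n))" for n by (rule homology_f2)
  show "subgroup (homology_fil p n) (quotient_space (cycles n) (boundaries n))" for p n
    by (rule homology_fil_subgroup)
  show "homology_fil (p + 1) n \<subseteq> homology_fil p n" for p n
    using Fil_antimono[of p "p + 1" n] by (auto simp: homology_fil_def)
  show "\<exists>p. homology_fil p n = carrier (quotient_space (cycles n) (boundaries n))" for n
    by (rule exI[of _ 0]) (auto simp: homology_fil_def carrier_quotient_space cycles_def)
  show "\<exists>p. homology_fil p n = {\<one>\<^bsub>quotient_space (cycles n) (boundaries n)\<^esub>}" for n
  proof -
    obtain p where "Fil p n = {0}" using Fil_bounded by blast
    then have "homology_fil p n = {coset (boundaries n) 0}"
      using f2_subspaceD(1)[OF cycles_subspace] by (auto simp: homology_fil_def)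
    then show ?thesis by auto
  qed
  show "\<exists>R\<ge>1. \<forall>r\<ge>R.
        (\<forall>x\<in>carrier (page r p q). page_d r p q x = \<one>\<^bsub>page r (p + int r) (q - int r + 1)\<^esub>) \<and>
        (\<forall>x\<in>carrier (page r (p - int r) (q + int r - 1)).
            page_d r (p - int r) (q + int r - 1) x = \<one>\<^bsub>page r p q\<^esub>) \<and>
        page r p q \<cong> quotient_space (cycles (p + q)) (boundaries (p + q))
          \<lparr>carrier := homology_fil p (p + q)\<rparr> Mod homology_fil (p + 1) (p + q)" for p q
  proof -
    obtain P where P: "Fil P (p + q + 1) = {0}" using Fil_bounded by blast
    \<comment> \<open>\<open>p + r \<ge> P\<close> makes the target of the outgoing differential
      zero, and \<open>r > p\<close> puts the source of the incoming one into the vanishing columns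
      \<open>p - r < 0\<close>.\<close>
    define R where "R = nat (max (P - p) (p + 1)) + 1"
    have "(\<forall>x\<in>carrier (page r p q). page_d r p q x = \<one>\<^bsub>page r (p + int r) (q - int r + 1)\<^esub>) \<and>
        (\<forall>x\<in>carrier (page r (p - int r) (q + int r - 1)).
            page_d r (p - int r) (q + int r - 1) x = \<one>\<^bsub>page r p q\<^esub>) \<and>
        page r p q \<cong> quotient_space (cycles (p + q)) (boundaries (p + q))
          \<lparr>carrier := homology_fil p (p + q)\<rparr> Mod homology_fil (p + 1) (p + q)" if "r \<ge> R" for r
    proof (intro conjI ballI)
      have r: "p + int r \<ge> P" "int r > p" "r \<ge> 1" using that by (auto simp: R_def)
      have "Fil (p + int r) (p + q + 1) = {0}"
        using Fil_antimono[OF r(1), of "p + q + 1"] P f2_subspaceD(1)[OF Fil_subspace] by auto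
      moreover have "p + int r + (q - int r + 1) = p + q + 1" by simp
      ultimately have "trivial_group (page r (p + int r) (q - int r + 1))"
        unfolding page_def using B_zero_subset trivial_quotient_space[OF Z_subspace] by metis
      then show "page_d r p q x = \<one>\<^bsub>page r (p + int r) (q - int r + 1)\<^esub>"
        if "x \<in> carrier (page r p q)" for x using page_d_trivial that by blast
      have "trivial_group (page r (p - int r) (q + int r - 1))" using r by (intro page_neg) auto
      then show "page_d r (p - int r) (q + int r - 1) x = \<one>\<^bsub>page r p q\<^esub>"
        if "x \<in> carrier (page r (p - int r) (q + int r - 1))" for x
        using page_d_trivial[of r "p - int r" "q + int r - 1" x] that by simp
      show "page r p q \<cong> quotient_space (cycles (p + q)) (boundaries (p + q))
          \<lparr>carrier := homology_fil p (p + q)\<rparr> Mod homology_fil (p + 1) (p + q)"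
        by (rule page_infinity[OF P r refl])
    qed
    moreover have "R \<ge> 1" by (simp add: R_def)
    ultimately show ?thesis by blast
  qed
qed

end

section \<open>Counting vectors over the field with two elements\<close>

text \<open>Keeps sums and products of bits as ring operations, so that the laws for finite sums and
  for groups apply to them.\<close>

declare add_bit_eq_xor [simp del] mult_bit_eq_and [simp del]

lemma bit_add_self [simp]: "(a :: bit) + a = 0"
  by (cases a) simp_all

definition vectors :: "'a set \<Rightarrow> ('a \<Rightarrow> bit) set" where
  "vectors E = {v. \<forall>e. e \<notin> E \<longrightarrow> v e = 0}"

definition pairing :: "'a set \<Rightarrow> ('a \<Rightarrow> bit) \<Rightarrow> ('a \<Rightarrow> bit) \<Rightarrow> bit" where
  "pairing E v w = (\<Sum>e\<in>E. v e * w e)"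

lemma card_vectors:
  assumes "finite E"
  shows "finite (vectors E)" "card (vectors E) = 2 ^ card E"
proof -
  have "bij_betw (\<lambda>S e. of_bool (e \<in> S) :: bit) (Pow E) (vectors E)"
  proof (rule bij_betwI[where g = "\<lambda>v. {e. v e = 1}"])
    show "(\<lambda>e. of_bool (e \<in> {e. v e = 1})) = v" if "v \<in> vectors E" for v :: "'a \<Rightarrow> bit"
    proof (rule ext)
      show "of_bool (e \<in> {e. v e = 1}) = v e" for e by (cases "v e") simp_all
    qed
    show "(\<lambda>v. {e. v e = 1}) \<in> vectors E \<rightarrow> Pow E" by (force simp: vectors_def)
    show "(\<lambda>S e. of_bool (e \<in> S)) \<in> Pow E \<rightarrow> vectors E" by (force simp: vectors_def)
    show "{e. of_bool (e \<in> S) = (1 :: bit)} = S" if "S \<in> Pow E" for S by simp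
  qed
  then show "finite (vectors E)" "card (vectors E) = 2 ^ card E"
    using assms bij_betw_finite[of _ "Pow E" "vectors E"] bij_betw_same_card[of _ "Pow E" "vectors E"]
    by (simp_all add: card_Pow)
qed

lemma f2_subspace_vectors: "f2_subspace (vectors E)"
  by (auto simp: f2_subspace_def vectors_def fun_eq_iff)

lemma pairing_add:
  "pairing E (v + v') w = pairing E v w + pairing E v' w"
  "pairing E v (w + w') = pairing E v w + pairing E v w'"
  by (simp_all add: pairing_def algebra_simps sum.distrib)

lemma f2_subspace_image:
  assumes "f2_subspace A" "\<And>x y. x \<in> A \<Longrightarrow> y \<in> A \<Longrightarrow> f (x + y) = f x + f y"
  shows "f2_subspace (f ` A)"
proof -
  have z: "f 0 = 0" using assms(2)[of 0 0] f2_subspaceD(1)[OF assms(1)] by simp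
  then have "0 \<in> f ` A" using f2_subspaceD(1)[OF assms(1)] by force
  moreover have "f x + f y \<in> f ` A" if "x \<in> A" "y \<in> A" for x y
    using f2_subspaceD(2)[OF assms(1) that] assms(2)[OF that] by force
  moreover have "f x + f x = 0" if "x \<in> A" for x
    using assms(2)[OF that that] f2_subspaceD(3)[OF assms(1) that] z by simp
  ultimately show ?thesis by (auto simp: f2_subspace_def)
qed

text \<open>Translation by one element of a nonempty fibre embeds the fibre in the kernel.\<close>

lemma card_le_image_kernel:
  fixes f :: "'a::ab_group_add \<Rightarrow> 'b::ab_group_add"
  assumes A: "f2_subspace A" "finite A"
    and f: "\<And>x y. x \<in> A \<Longrightarrow> y \<in> A \<Longrightarrow> f (x + y) = f x + f y"
  shows "card A \<le> card (f ` A) * card {x \<in> A. f x = 0}"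
proof -
  have fib: "card {x \<in> A. f x = y} \<le> card {x \<in> A. f x = 0}" if y: "y \<in> f ` A" for y
  proof -
    obtain z where z: "z \<in> A" "y = f z" using y by auto
    have "(\<lambda>x. z + x) ` {x \<in> A. f x = y} \<subseteq> {x \<in> A. f x = 0}"
      using z f f2_subspaceD[OF A(1)] f2_subspaceD(3)[OF f2_subspace_image[OF A(1) f]] by auto
    moreover have "inj_on (\<lambda>x. z + x) {x \<in> A. f x = y}" by (auto simp: inj_on_def)
    ultimately show ?thesis using A(2) by (intro card_inj_on_le) auto
  qed
  have "A = (\<Union>y\<in>f ` A. {x \<in> A. f x = y})" by auto
  then have "card A \<le> (\<Sum>y\<in>f ` A. card {x \<in> A. f x = y})"
    using card_UN_le[of "f ` A" "\<lambda>y. {x \<in> A. f x = y}"] A(2) by simp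
  also have "\<dots> \<le> (\<Sum>y\<in>f ` A. card {x \<in> A. f x = 0})" by (intro sum_mono fib)
  finally show ?thesis by simp
qed

text \<open>The summand is the character \<open>(-1)^(c x)\<close>. Translation by some
  \<open>z\<close> with \<open>c z = 1\<close> permutes \<open>A\<close> and changes every
  sign.\<close>

lemma sum_character:
  fixes c :: "'a::ab_group_add \<Rightarrow> bit"
  assumes A: "f2_subspace A" "finite A"
    and c: "\<And>x y. x \<in> A \<Longrightarrow> y \<in> A \<Longrightarrow> c (x + y) = c x + c y"
  shows "(\<Sum>x\<in>A. if c x = 0 then 1 else - 1 :: int) = (if \<forall>x\<in>A. c x = 0 then int (card A) else 0)"
proof (cases "\<forall>x\<in>A. c x = 0")
  case False
  then obtain z where z: "z \<in> A" "c z = 1" by (metis bit_not_one_iff)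
  let ?s = "\<lambda>x. if c x = 0 then 1 else - 1 :: int"
  have "sum ?s A = (\<Sum>x\<in>A. ?s (z + x))"
    by (rule sum.reindex_bij_witness[where i = "\<lambda>x. z + x" and j = "\<lambda>x. z + x"])
      (use z f2_subspaceD(2)[OF A(1)] in \<open>auto simp: f2_add_cancel[OF A(1) z(1)]\<close>)
  also have "\<dots> = (\<Sum>x\<in>A. - ?s x)"
  proof (rule sum.cong[OF refl])
    fix x assume "x \<in> A"
    then show "?s (z + x) = - ?s x" using c[OF z(1)] z by (cases "c x") simp_all
  qed
  finally have "sum ?s A = 0" by (simp add: sum_negf)
  then show ?thesis by (simp only: False if_False)
qed simp

text \<open>The dimension formula for orthogonal complements in terms of cardinalities: the sum of
  the signs of \<open>pairing E v w\<close> over all \<open>v\<close> and \<open>w\<close> is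
  evaluated in both orders.\<close>

lemma card_orthogonal:
  assumes "finite E" and W: "f2_subspace W" "W \<subseteq> vectors E"
  shows "card W * card {v \<in> vectors E. \<forall>w\<in>W. pairing E v w = 0} = 2 ^ card E"
proof -
  let ?s = "\<lambda>b :: bit. if b = 0 then 1 else - 1 :: int"
  note V = card_vectors[OF assms(1)]
  have fW: "finite W" using V W finite_subset by blast
  have "(\<Sum>v\<in>vectors E. \<Sum>w\<in>W. ?s (pairing E v w))
      = (\<Sum>v\<in>vectors E. if \<forall>w\<in>W. pairing E v w = 0 then int (card W) else 0)"
    by (intro sum.cong refl sum_character W fW pairing_add)
  also have "\<dots> = int (card W * card {v \<in> vectors E. \<forall>w\<in>W. pairing E v w = 0})"
    using V(1) by (simp flip: sum.inter_filter)
  finally have 1: "(\<Sum>v\<in>vectors E. \<Sum>w\<in>W. ?s (pairing E v w))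
      = int (card W * card {v \<in> vectors E. \<forall>w\<in>W. pairing E v w = 0})" .
  \<comment> \<open>Unit vectors show that the pairing is nondegenerate, so when the sum over
    \<open>v\<close> is taken first, only \<open>w = 0\<close> contributes.\<close>
  have nondeg: "(\<forall>v\<in>vectors E. pairing E v w = 0) \<longleftrightarrow> w = 0" if w: "w \<in> W" for w
  proof
    assume a: "\<forall>v\<in>vectors E. pairing E v w = 0"
    have "w e = 0" for e
    proof (cases "e \<in> E")
      case True
      have "pairing E (\<lambda>x. of_bool (x = e)) w = w e"
        using True assms(1) by (simp add: pairing_def of_bool_def if_distrib[of "\<lambda>x. x * _"] cong: if_cong)
      moreover have "(\<lambda>x. of_bool (x = e)) \<in> vectors E" using True by (auto simp: vectors_def)
      ultimately show ?thesis using a by metis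
    qed (use w W in \<open>auto simp: vectors_def\<close>)
    then show "w = 0" by (simp add: fun_eq_iff)
  qed (simp add: pairing_def)
  have "(\<Sum>v\<in>vectors E. \<Sum>w\<in>W. ?s (pairing E v w)) = (\<Sum>w\<in>W. \<Sum>v\<in>vectors E. ?s (pairing E v w))"
    by (rule sum.swap)
  also have "\<dots> = (\<Sum>w\<in>W. if \<forall>v\<in>vectors E. pairing E v w = 0 then int (card (vectors E)) else 0)"
    by (intro sum.cong refl sum_character f2_subspace_vectors V pairing_add)
  also have "\<dots> = (\<Sum>w\<in>W. if w = 0 then int (2 ^ card E) else 0)"
    by (intro sum.cong refl) (simp add: nondeg V)
  also have "\<dots> = int (2 ^ card E)" using fW f2_subspaceD(1)[OF W(1)] by simp
  finally show ?thesis using 1 by linarith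
qed

section \<open>Functions constant on the classes of an equivalence relation\<close>

lemma equivclp_invariant:
  assumes "equivclp R a b" "\<And>x y. R x y \<Longrightarrow> g x = g y"
  shows "g a = g b"
  using assms(1)
proof (induction rule: equivclp_induct)
  case (step y z)
  then show ?case using assms(2)[of y z] assms(2)[of z y] by auto
qed simp

lemma equivclp_closed:
  assumes "equivclp R a b" "a \<in> K" "\<And>x y. R x y \<Longrightarrow> x \<in> K \<longleftrightarrow> y \<in> K"
  shows "b \<in> K"
  using equivclp_invariant[OF assms(1), of "\<lambda>x. x \<in> K"] assms(2,3) by auto

lemma eq_class_eq_iff: "eq_class R a = eq_class R b \<longleftrightarrow> equivclp R a b"
  by (auto simp: eq_class_def set_eq_iff intro: equivclp_trans equivclp_sym)

text \<open>Each \<open>x\<close> in \<open>K\<close> is determined by the function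
  \<open>G x\<close> on \<open>E\<close>, which is constant on the classes of \<open>R\<close>; so
  \<open>K\<close> embeds in the vectors indexed by these classes. Both kernels in the count of
  colourings are bounded by the number of components in this way.\<close>

lemma card_kernel_le:
  fixes K :: "'k set" and G :: "'k \<Rightarrow> 'e \<Rightarrow> bit"
  assumes E: "finite E"
    and G: "\<And>x a b. x \<in> K \<Longrightarrow> R a b \<Longrightarrow> G x a = G x b"
    and inj: "\<And>x y. x \<in> K \<Longrightarrow> y \<in> K \<Longrightarrow> (\<And>e. e \<in> E \<Longrightarrow> G x e = G y e) \<Longrightarrow> x = y"
  shows "card K \<le> 2 ^ card (eq_class R ` E)"
proof -
  let ?C = "eq_class R ` E"
  define \<rho> where "\<rho> = (\<lambda>x C. if C \<in> ?C then G x (SOME e. e \<in> C) else 0)"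
  have \<rho>: "\<rho> x (eq_class R e) = G x e" if "x \<in> K" "e \<in> E" for x e
  proof -
    have "e \<in> eq_class R e" by (simp add: eq_class_def)
    then have "(SOME e'. e' \<in> eq_class R e) \<in> eq_class R e" by (rule someI)
    then have "G x e = G x (SOME e'. e' \<in> eq_class R e)"
      using equivclp_invariant[OF _ G[OF that(1)]] by (auto simp: eq_class_def)
    then show ?thesis using that by (simp add: \<rho>_def)
  qed
  have "inj_on \<rho> K" using inj \<rho> by (metis inj_onI)
  moreover have "\<rho> ` K \<subseteq> vectors ?C" by (auto simp: \<rho>_def vectors_def)
  ultimately have "card K \<le> card (vectors ?C)"
    using card_vectors(1)[of ?C] E by (intro card_inj_on_le) auto
  then show ?thesis using card_vectors(2)[of ?C] E by simp
qed

section \<open>Incidence of arcs and crossings modulo 2\<close>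

lemma distinct_pairs_nth:
  assumes "distinct (concat (map (\<lambda>c. [p c, q c]) xs))" "i < length xs" "j < length xs"
  shows "p (xs ! i) \<noteq> q (xs ! j)" "p (xs ! i) = p (xs ! j) \<longleftrightarrow> i = j" "q (xs ! i) = q (xs ! j) \<longleftrightarrow> i = j"
proof -
  have "p (xs ! i) \<noteq> q (xs ! j) \<and> (p (xs ! i) = p (xs ! j) \<longleftrightarrow> i = j) \<and> (q (xs ! i) = q (xs ! j) \<longleftrightarrow> i = j)"
    using assms
  proof (induction xs arbitrary: i j)
    case (Cons x xs)
    have *: "p x \<noteq> p (xs ! k) \<and> p x \<noteq> q (xs ! k) \<and> q x \<noteq> p (xs ! k) \<and> q x \<noteq> q (xs ! k)"
      if "k < length xs" for k
    proof -
      have "p (xs ! k) \<in> p ` set xs" "q (xs ! k) \<in> q ` set xs" using that by auto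
      moreover have "p x \<notin> p ` set xs" "p x \<notin> q ` set xs" "q x \<notin> p ` set xs" "q x \<notin> q ` set xs"
        using Cons.prems(1) by auto
      ultimately show ?thesis by metis
    qed
    have d: "p x \<noteq> q x" "distinct (concat (map (\<lambda>c. [p c, q c]) xs))" using Cons.prems(1) by auto
    show ?case
    proof (cases i)
      case 0
      then show ?thesis using d(1) *[of "j - 1"] Cons.prems(3) by (cases j) auto
    next
      case (Suc i')
      show ?thesis
      proof (cases j)
        case 0
        then show ?thesis using Suc *[of i'] Cons.prems(2) by (simp, metis)
      next
        case (Suc j')
        then show ?thesis using \<open>i = Suc i'\<close> Cons.IH[OF d(2), of i' j'] Cons.prems(2,3) by simp
      qed
    qed
  qed simp
  then show "p (xs ! i) \<noteq> q (xs ! j)" "p (xs ! i) = p (xs ! j) \<longleftrightarrow> i = j"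
    "q (xs ! i) = q (xs ! j) \<longleftrightarrow> i = j" by auto
qed

text \<open>By distinctness \<open>a\<close> occurs once among all the ends \<open>p\<close> and
  \<open>q\<close>, so only \<open>r = i\<close> contributes and only one of its two indicators is
  1.\<close>

lemma sum_incidence:
  fixes h :: "nat \<Rightarrow> bit"
  assumes d: "distinct (concat (map (\<lambda>c. [p c, q c]) xs))" and i: "i < length xs"
    and a: "a \<in> {p (xs ! i), q (xs ! i)}"
  shows "(\<Sum>r<length xs. h r * (of_bool (p (xs ! r) = a) + of_bool (q (xs ! r) = a))) = h i"
proof -
  have "(\<Sum>r<length xs. h r * (of_bool (p (xs ! r) = a) + of_bool (q (xs ! r) = a)))
      = (\<Sum>r<length xs. if r = i then h i else 0)"
  proof (rule sum.cong[OF refl])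
    fix r assume "r \<in> {..<length xs}"
    then have r: "r < length xs" by simp
    show "h r * (of_bool (p (xs ! r) = a) + of_bool (q (xs ! r) = a)) = (if r = i then h i else 0)"
    proof (cases "r = i")
      case True
      then show ?thesis using a distinct_pairs_nth(1)[OF d i i] by (elim insertE) auto
    next
      case False
      then have "p (xs ! r) \<noteq> a" "q (xs ! r) \<noteq> a"
        using a distinct_pairs_nth[OF d r i] distinct_pairs_nth(1)[OF d i r] by auto
      then show ?thesis using False by simp
    qed
  qed
  then show ?thesis using i by simp
qed

section \<open>Checkerboard colourings\<close>

lemma corners_in_incoming:
  assumes "well_formed D" "c \<in> set (crossings D)"
  shows "{sw c, se c, nw c, ne c} \<subseteq> set (incoming D)"
proof -
  have "{sw c, se c} \<subseteq> set (incoming D)" "{nw c, ne c} \<subseteq> set (outgoing D)"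
    using assms(2) by (auto simp: incoming_def outgoing_def)
  then show ?thesis using assms(1) by (auto simp: well_formed_def)
qed

text \<open>The hypothesis says that the values of \<open>h\<close> at the two ends of every arc
  agree. The sum is this common value, and for the four arcs at crossing \<open>r\<close> one of the
  two ends is that crossing.\<close>

lemma incidence_sum_corner:
  assumes wf: "well_formed D"
    and h: "\<And>e. e \<in> set (incoming D) \<Longrightarrow>
      (\<Sum>r<length (crossings D). h r * (of_bool (sw (crossings D ! r) = e) + of_bool (se (crossings D ! r) = e)))
      = (\<Sum>r<length (crossings D). h r * (of_bool (nw (crossings D ! r) = e) + of_bool (ne (crossings D ! r) = e) :: bit))"
    and r: "r < length (crossings D)" "c = crossings D ! r" "e \<in> {sw c, se c, nw c, ne c}"
  shows "(\<Sum>r<length (crossings D). h r * (of_bool (sw (crossings D ! r) = e) + of_bool (se (crossings D ! r) = e))) = h r"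
proof -
  have d: "distinct (concat (map (\<lambda>c. [sw c, se c]) (crossings D)))"
    "distinct (concat (map (\<lambda>c. [nw c, ne c]) (crossings D)))"
    using wf by (auto simp: well_formed_def incoming_def outgoing_def)
  have "e \<in> set (incoming D)" using corners_in_incoming[OF wf] r by (meson nth_mem subsetD)
  note eq = h[OF this]
  consider "e \<in> {sw c, se c}" | "e \<in> {nw c, ne c}" using r(3) by blast
  then show ?thesis
  proof cases
    case 1
    then show ?thesis by (intro sum_incidence[OF d(1) r(1)]) (simp add: r(2))
  next
    case 2
    then show ?thesis unfolding eq by (intro sum_incidence[OF d(2) r(1)]) (simp add: r(2))
  qed
qed

text \<open>
  With coefficients in the field with two elements, the cellular cochain complex of the surface
  carrying the diagram has its cochain groups at regions, arcs and crossings.  Euler's formula says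
  that it is exact at the arcs.  The cochain which is 1 on every arc is a cocycle because every
  crossing has four ends of arcs, so it is the coboundary of a checkerboard colouring.
\<close>

lemma checkerboard_colouring:
  assumes "oriented_link_diagram D"
  obtains \<chi> :: "nat \<times> side \<Rightarrow> bit" where
    "\<And>s t. same_corner D s t \<Longrightarrow> \<chi> s = \<chi> t"
    "\<And>e. e \<in> set (incoming D) \<Longrightarrow> \<chi> (e, Left) + \<chi> (e, Right) = 1"
proof -
  have wf: "well_formed D" and pl: "planar D" using assms by (auto simp: oriented_link_diagram_def)
  define E where "E = set (incoming D)"
  define n where "n = length (crossings D)"
  define reg where "reg = eq_class (same_corner D)"
  define Rs where "Rs = reg ` (E \<times> (UNIV :: side set))"
  define k where "k = card (eq_class (share_crossing D) ` E)"
  have euler: "n + card Rs = card E + 2 * k"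
    using pl by (simp add: planar_def Let_def E_def n_def Rs_def reg_def k_def)
  have "(UNIV :: side set) = {Left, Right}" using side.exhaust by auto
  then have "finite (UNIV :: side set)" by (metis finite.emptyI finite.insertI)
  then have fin: "finite E" "finite Rs" by (auto simp: E_def Rs_def)
  have corner: "{sw c, se c, nw c, ne c} \<subseteq> E" if "c \<in> set (crossings D)" for c
    using corners_in_incoming[OF wf that] by (simp add: E_def)

  define \<delta>0 :: "((nat \<times> side) set \<Rightarrow> bit) \<Rightarrow> nat \<Rightarrow> bit" where
    "\<delta>0 = (\<lambda>\<chi> e. if e \<in> E then \<chi> (reg (e, Left)) + \<chi> (reg (e, Right)) else 0)"
  define inc where "inc = (\<lambda>r e. (of_bool (sw (crossings D ! r) = e) + of_bool (se (crossings D ! r) = e)) +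
     (of_bool (nw (crossings D ! r) = e) + of_bool (ne (crossings D ! r) = e)) :: bit)"
  \<comment> \<open>\<open>M\<close> is the transpose of the coboundary from arcs to crossings, so
    the complement \<open>?O\<close> of its image, formed below, is the space of cocycles. An arc
    with both ends at one crossing has incidence \<open>1 + 1 = 0\<close>.\<close>
  define M :: "(nat \<Rightarrow> bit) \<Rightarrow> nat \<Rightarrow> bit" where "M = (\<lambda>h e. \<Sum>r<n. h r * inc r e)"
  have inc_sum: "(\<Sum>e\<in>E. v e * inc r e)
      = (v (sw (crossings D ! r)) + v (se (crossings D ! r))) + (v (nw (crossings D ! r)) + v (ne (crossings D ! r)))"
    if r: "r < n" for v r
  proof -
    have *: "(\<Sum>e\<in>E. v e * of_bool (a = e)) = v a" if "a \<in> E" for a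
      using that fin by (simp add: of_bool_def if_distrib[of "\<lambda>x. _ * x"] cong: if_cong)
    have "{sw (crossings D ! r), se (crossings D ! r), nw (crossings D ! r), ne (crossings D ! r)} \<subseteq> E"
      using corner r by (simp add: n_def)
    then show ?thesis using * by (simp add: inc_def distrib_left sum.distrib)
  qed
  have pairing_M: "pairing E v (M h) = (\<Sum>r<n. h r * ((v (sw (crossings D ! r)) + v (se (crossings D ! r)))
      + (v (nw (crossings D ! r)) + v (ne (crossings D ! r)))))" for v h
  proof -
    have "pairing E v (M h) = (\<Sum>r<n. h r * (\<Sum>e\<in>E. v e * inc r e))"
      unfolding pairing_def M_def sum_distrib_left
      by (subst sum.swap) (intro sum.cong refl mult.left_commute)
    then show ?thesis using inc_sum by simp
  qed

  have M_add: "M (h + h') = M h + M h'" for h h'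
    by (simp add: M_def fun_eq_iff distrib_right sum.distrib)
  have \<delta>0_add: "\<delta>0 (\<chi> + \<chi>') = \<delta>0 \<chi> + \<delta>0 \<chi>'" for \<chi> \<chi>'
    by (simp add: \<delta>0_def fun_eq_iff algebra_simps)

  have M_sub: "M ` vectors {..<n} \<subseteq> vectors E"
  proof clarify
    fix h
    have "inc r e = 0" if "e \<notin> E" "r < n" for r e
      using corner[of "crossings D ! r"] that by (auto simp: inc_def n_def)
    then show "M h \<in> vectors E" by (simp add: vectors_def M_def)
  qed
  have \<delta>0_sub: "\<delta>0 ` vectors Rs \<subseteq> vectors E"
    by (auto simp: vectors_def \<delta>0_def)

  \<comment> \<open>For \<open>h\<close> in the kernel of \<open>M\<close>, \<open>G h e\<close> is
    the value of \<open>h\<close> at both ends of \<open>e\<close>. It is therefore constant on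
    components, which bounds the kernel by \<open>2 ^ k\<close>.\<close>
  define G where "G = (\<lambda>h e. \<Sum>r<n. h r * (of_bool (sw (crossings D ! r) = e) + of_bool (se (crossings D ! r) = e)) :: bit)"
  have G: "G h e = h r"
    if "M h = 0" and r: "r < n" "c = crossings D ! r" "e \<in> {sw c, se c, nw c, ne c}" for h r e c
    unfolding n_def G_def
  proof (rule incidence_sum_corner[OF wf _ r[unfolded n_def]])
    fix e'
    let ?a = "\<Sum>r<n. h r * (of_bool (sw (crossings D ! r) = e') + of_bool (se (crossings D ! r) = e'))"
    let ?b = "\<Sum>r<n. h r * (of_bool (nw (crossings D ! r) = e') + of_bool (ne (crossings D ! r) = e'))"
    have "?a + ?b = M h e'" unfolding M_def inc_def distrib_left sum.distrib ..
    also have "\<dots> = 0" using that(1) by (simp only: zero_fun_def)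
    finally have "?a + ?b = ?b + ?b" by (simp only: bit_add_self)
    then show "(\<Sum>r<length (crossings D). h r * (of_bool (sw (crossings D ! r) = e') + of_bool (se (crossings D ! r) = e')))
        = (\<Sum>r<length (crossings D). h r * (of_bool (nw (crossings D ! r) = e') + of_bool (ne (crossings D ! r) = e')))"
      unfolding n_def add_right_cancel .
  qed
  have kerM: "card {h \<in> vectors {..<n}. M h = 0} \<le> 2 ^ k"
    unfolding k_def
  proof (rule card_kernel_le[OF fin(1), where G = G])
    show "G h a = G h b" if h: "h \<in> {h \<in> vectors {..<n}. M h = 0}" and sh: "share_crossing D a b" for h a b
    proof -
      obtain c where c: "c \<in> set (crossings D)" "a \<in> {sw c, se c, nw c, ne c}" "b \<in> {sw c, se c, nw c, ne c}"
        using sh unfolding share_crossing_def by blast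
      then obtain r where r: "r < n" "c = crossings D ! r" unfolding in_set_conv_nth n_def by blast
      show ?thesis using G[OF _ r c(2), of h] G[OF _ r c(3), of h] h by simp
    qed
    show "h = h'" if h: "h \<in> {h \<in> vectors {..<n}. M h = 0}" and h': "h' \<in> {h \<in> vectors {..<n}. M h = 0}"
      and eq: "\<And>e. e \<in> E \<Longrightarrow> G h e = G h' e" for h h'
    proof
      fix r
      show "h r = h' r"
      proof (cases "r < n")
        case True
        then have "sw (crossings D ! r) \<in> E" using corner by (simp add: n_def)
        from eq[OF this] show ?thesis
          using G[OF _ True refl, of h "sw (crossings D ! r)"] G[OF _ True refl, of h' "sw (crossings D ! r)"] h h' by simp
      next
        case False
        then show ?thesis using h h' by (simp add: vectors_def)
      qed
    qed
  qed

  have same: "reg s = reg t" if "same_corner D s t" for s t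
    using that by (auto simp: reg_def eq_class_eq_iff)
  have corners: "reg (sw c, Left) = reg (nw c, Left)" "reg (nw c, Right) = reg (ne c, Left)"
    "reg (ne c, Right) = reg (se c, Right)" "reg (se c, Left) = reg (sw c, Right)" if "c \<in> set (crossings D)" for c
    by (rule same, use that in \<open>force simp: same_corner_def\<close>)+

  \<comment> \<open>A colouring in the kernel has equal values on the two sides of each arc; going
    round a crossing then shows that it is constant on components as well.\<close>
  have ker\<delta>: "card {\<chi> \<in> vectors Rs. \<delta>0 \<chi> = 0} \<le> 2 ^ k"
    unfolding k_def
  proof (rule card_kernel_le[OF fin(1), where G = "\<lambda>\<chi> e. \<chi> (reg (e, Left))"])
    have LR: "\<chi> (reg (e, Right)) = \<chi> (reg (e, Left))" if "\<chi> \<in> {\<chi> \<in> vectors Rs. \<delta>0 \<chi> = 0}" "e \<in> E" for \<chi> e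
    proof -
      have "\<delta>0 \<chi> e = 0" using that by simp
      then have "\<chi> (reg (e, Left)) + \<chi> (reg (e, Right)) = 0" using that(2) by (simp add: \<delta>0_def)
      then show ?thesis by (metis add_left_cancel bit_add_self)
    qed
    show "\<chi> (reg (a, Left)) = \<chi> (reg (b, Left))"
      if \<chi>: "\<chi> \<in> {\<chi> \<in> vectors Rs. \<delta>0 \<chi> = 0}" and sh: "share_crossing D a b" for \<chi> a b
    proof -
      obtain c where c: "c \<in> set (crossings D)" "a \<in> {sw c, se c, nw c, ne c}" "b \<in> {sw c, se c, nw c, ne c}"
        using sh unfolding share_crossing_def by blast
      have "sw c \<in> E" "nw c \<in> E" using corner[OF c(1)] by auto
      then have "\<chi> (reg (nw c, Left)) = \<chi> (reg (sw c, Left))" "\<chi> (reg (ne c, Left)) = \<chi> (reg (sw c, Left))"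
        "\<chi> (reg (se c, Left)) = \<chi> (reg (sw c, Left))"
        using LR[OF \<chi>] corners[OF c(1)] by metis+
      then have "\<chi> (reg (e, Left)) = \<chi> (reg (sw c, Left))" if "e \<in> {sw c, se c, nw c, ne c}" for e
        using that by auto
      then show ?thesis using c by metis
    qed
    show "\<chi> = \<chi>'" if \<chi>: "\<chi> \<in> {\<chi> \<in> vectors Rs. \<delta>0 \<chi> = 0}" and \<chi>': "\<chi>' \<in> {\<chi> \<in> vectors Rs. \<delta>0 \<chi> = 0}"
      and eq: "\<And>e. e \<in> E \<Longrightarrow> \<chi> (reg (e, Left)) = \<chi>' (reg (e, Left))" for \<chi> \<chi>'
    proof
      fix \<rho>
      show "\<chi> \<rho> = \<chi>' \<rho>"
      proof (cases "\<rho> \<in> Rs")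
        case True
        then obtain e s where "e \<in> E" "\<rho> = reg (e, s)" by (auto simp: Rs_def)
        then show ?thesis using eq LR[OF \<chi>] LR[OF \<chi>'] by (cases s) auto
      qed (use \<chi> \<chi>' in \<open>auto simp: vectors_def\<close>)
    qed
  qed

  let ?W = "M ` vectors {..<n}" and ?O = "{v \<in> vectors E. \<forall>w\<in>M ` vectors {..<n}. pairing E v w = 0}"
  have W: "f2_subspace ?W" by (rule f2_subspace_image[OF f2_subspace_vectors]) (rule M_add)
  have "2 ^ n \<le> card ?W * card {h \<in> vectors {..<n}. M h = 0}"
    using card_le_image_kernel[OF f2_subspace_vectors card_vectors(1), of "{..<n}" M] M_add
      card_vectors(2)[of "{..<n}"] by simp
  also have "\<dots> \<le> card ?W * 2 ^ k" using kerM by simp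
  finally have W_card: "2 ^ n \<le> card ?W * 2 ^ k" .
  have "2 ^ card Rs \<le> card (\<delta>0 ` vectors Rs) * card {\<chi> \<in> vectors Rs. \<delta>0 \<chi> = 0}"
    using card_le_image_kernel[OF f2_subspace_vectors card_vectors(1), of Rs \<delta>0] \<delta>0_add
      card_vectors(2)[of Rs] fin by simp
  also have "\<dots> \<le> card (\<delta>0 ` vectors Rs) * 2 ^ k" using ker\<delta> by simp
  finally have \<delta>_card: "2 ^ card Rs \<le> card (\<delta>0 ` vectors Rs) * 2 ^ k" .
  \<comment> \<open>By \<open>n + card Rs = card E + 2 * k\<close> the two rank estimates leave no
    room: the cocycles \<open>?O\<close> cannot outnumber the coboundaries.\<close>
  have "card ?W * card ?O * (2 ^ k * 2 ^ k) = 2 ^ card E * (2 ^ k * 2 ^ k)"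
    using card_orthogonal[OF fin(1) W M_sub] by simp
  also have "\<dots> = 2 ^ n * 2 ^ card Rs"
    using euler by (simp flip: power_add add: mult_2)
  also have "\<dots> \<le> (card ?W * 2 ^ k) * (card (\<delta>0 ` vectors Rs) * 2 ^ k)"
    by (rule mult_mono[OF W_card \<delta>_card]) auto
  finally have "(card ?W * (2 ^ k * 2 ^ k)) * card ?O \<le> (card ?W * (2 ^ k * 2 ^ k)) * card (\<delta>0 ` vectors Rs)"
    by (simp only: ac_simps)
  moreover have "card ?W > 0" using W_card by (auto intro: gr0I)
  ultimately have card_le: "card ?O \<le> card (\<delta>0 ` vectors Rs)" by simp
  have orth: "\<delta>0 ` vectors Rs \<subseteq> ?O"
  proof (intro subsetI CollectI conjI ballI)
    fix v assume v: "v \<in> \<delta>0 ` vectors Rs"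
    then show "v \<in> vectors E" using \<delta>0_sub by blast
    obtain \<chi> where \<chi>: "v = \<delta>0 \<chi>" using v by blast
    fix w assume "w \<in> ?W"
    then obtain h where h: "w = M h" by blast
    \<comment> \<open>Each of the four corners at a crossing lies between two of the four arcs, so
      its colour occurs twice in the sum.\<close>
    have "(v (sw c) + v (se c)) + (v (nw c) + v (ne c)) = 0" if c: "c \<in> set (crossings D)" for c
    proof -
      let ?x = "\<chi> (reg (nw c, Left))" and ?y = "\<chi> (reg (ne c, Left))" and ?z = "\<chi> (reg (se c, Right))"
        and ?w = "\<chi> (reg (sw c, Right))"
      have "v (sw c) = ?x + ?w" "v (se c) = ?w + ?z" "v (nw c) = ?x + ?y" "v (ne c) = ?y + ?z"
        using corner[OF c] corners[OF c] by (auto simp: \<chi> \<delta>0_def)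
      then show ?thesis by (cases ?x; cases ?y; cases ?z; cases ?w) simp_all
    qed
    then show "pairing E v w = 0" by (simp add: h pairing_M n_def)
  qed
  have "finite ?O" using card_vectors(1)[OF fin(1)] by simp
  then have eq: "\<delta>0 ` vectors Rs = ?O" using card_subset_eq[OF _ orth] card_le card_mono[OF _ orth] by force
  have "(\<lambda>e. of_bool (e \<in> E)) \<in> ?O"
  proof (intro CollectI conjI ballI)
    fix w assume "w \<in> ?W"
    then obtain h where h: "w = M h" by blast
    show "pairing E (\<lambda>e. of_bool (e \<in> E)) w = 0"
      unfolding h pairing_M
    proof (intro sum.neutral ballI)
      fix r assume "r \<in> {..<n}"
      then have "{sw (crossings D ! r), se (crossings D ! r), nw (crossings D ! r), ne (crossings D ! r)} \<subseteq> E"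
        using corner by (simp add: n_def)
      then show "h r * (of_bool (sw (crossings D ! r) \<in> E) + of_bool (se (crossings D ! r) \<in> E) +
         (of_bool (nw (crossings D ! r) \<in> E) + of_bool (ne (crossings D ! r) \<in> E))) = 0" by simp
    qed
  qed (auto simp: vectors_def)
  then obtain \<chi> where \<chi>: "(\<lambda>e. of_bool (e \<in> E)) = \<delta>0 \<chi>" unfolding eq[symmetric] by blast
  show ?thesis
  proof (rule that[of "\<lambda>s. \<chi> (reg s)"])
    show "\<chi> (reg s) = \<chi> (reg t)" if "same_corner D s t" for s t using same[OF that] by simp
    show "\<chi> (reg (e, Left)) + \<chi> (reg (e, Right)) = 1" if "e \<in> set (incoming D)" for e
      using fun_cong[OF \<chi>, of e] that by (simp add: \<delta>0_def E_def)
  qed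
qed

section \<open>Merging and splitting circles\<close>

text \<open>An injective map of a finite set into itself is onto, so a set closed under
  \<open>n\<close> is closed under going backwards too. This makes it closed under the generated
  equivalence.\<close>

lemma closed_under_preimage:
  assumes "finite K" "inj_on n E" "K \<subseteq> E" "n ` K \<subseteq> K" "y \<in> E"
  shows "n y \<in> K \<longleftrightarrow> y \<in> K"
proof -
  have "n ` K = K"
    using assms by (meson card_image card_subset_eq inj_on_subset)
  then show ?thesis using assms(2,3,5) by (metis image_eqI inj_on_image_mem_iff)
qed

text \<open>Exchanging the successors of \<open>p\<close> and \<open>q\<close> cuts the cycle
  through both of them or joins their two cycles.\<close>

lemma transposition_splits_or_joins:
  fixes n :: "'a \<Rightarrow> 'a"
  assumes E: "finite E" and n: "inj_on n E" "n ` E \<subseteq> E" and pq: "p \<in> E" "q \<in> E" "p \<noteq> q"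
  defines "n' \<equiv> n(p := n q, q := n p)"
  defines "R \<equiv> (\<lambda>a b. a \<in> E \<and> b = n a)" and "R' \<equiv> (\<lambda>a b. a \<in> E \<and> b = n' a)"
  shows "equivclp R p q \<longleftrightarrow> \<not> equivclp R' p q"
proof -
  have n'E: "n' ` E \<subseteq> E" using n pq by (auto simp: n'_def)
  have n'inj: "inj_on n' E" using n(1) pq by (auto simp: n'_def inj_on_def)
  have itE: "(n ^^ i) p \<in> E" for i using n(2) pq by (induction i) auto
  define Orb where "Orb = range (\<lambda>i. (n ^^ i) p)"
  have OE: "Orb \<subseteq> E" using itE by (auto simp: Orb_def)
  have fO: "finite Orb" using OE E finite_subset by blast
  have nOrb: "n ` Orb \<subseteq> Orb"
  proof clarify
    fix y assume "y \<in> Orb"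
    then obtain i where "y = (n ^^ i) p" by (auto simp: Orb_def)
    then have "n y = (n ^^ Suc i) p" by simp
    then show "n y \<in> Orb" unfolding Orb_def by blast
  qed
  have Orb_iff: "n y \<in> Orb \<longleftrightarrow> y \<in> Orb" if "y \<in> E" for y
    by (rule closed_under_preimage[OF fO n(1) OE nOrb that])
  have pO: "p \<in> Orb" unfolding Orb_def by (rule image_eqI[of _ _ 0]) auto
  show ?thesis
  proof
    assume "equivclp R p q"
    then have "q \<in> Orb" using pO by (rule equivclp_closed) (auto simp: R_def Orb_iff)
    then obtain k0 where "(n ^^ k0) p = q" by (auto simp: Orb_def)
    define k where "k = (LEAST k. (n ^^ k) p = q)"
    have k: "(n ^^ k) p = q" unfolding k_def by (rule LeastI) fact
    have k_min: "(n ^^ i) p \<noteq> q" if "i < k" for i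
      using not_less_Least that unfolding k_def by blast
    have k0: "k > 0" using k pq(3) by (cases k) auto
    have ne_p: "(n ^^ i) p \<noteq> p" if "0 < i" "i \<le> k" for i
    proof
      assume i: "(n ^^ i) p = p"
      have "(n ^^ (k - i)) p = (n ^^ (k - i)) ((n ^^ i) p)" by (simp add: i)
      also have "\<dots> = (n ^^ (k - i + i)) p" by (simp only: funpow_add comp_apply)
      also have "\<dots> = q" using that k by simp
      finally show False using k_min[of "k - i"] that by simp
    qed
    \<comment> \<open>The stretch of the cycle after \<open>p\<close> up to and including
      \<open>q\<close>. Since \<open>n'\<close> sends \<open>q\<close> to \<open>n p\<close>, this
      stretch closes up without \<open>p\<close>.\<close>
    define K where "K = (\<lambda>i. (n ^^ i) p) ` {1..k}"
    have KE: "K \<subseteq> E" using itE by (auto simp: K_def)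
    have nK: "n' ` K \<subseteq> K"
    proof clarify
      fix y assume "y \<in> K"
      then obtain i where i: "1 \<le> i" "i \<le> k" "y = (n ^^ i) p" by (auto simp: K_def)
      show "n' y \<in> K"
      proof (cases "i = k")
        case True
        then have "n' y = (n ^^ 1) p" using i k by (simp add: n'_def)
        then show ?thesis using k0 unfolding K_def by (intro image_eqI[of _ _ 1]) auto
      next
        case False
        then have "n' y = (n ^^ Suc i) p" using i ne_p[of i] k_min[of i] by (simp add: n'_def)
        then show ?thesis using i False unfolding K_def by (intro image_eqI[of _ _ "Suc i"]) auto
      qed
    qed
    have K_iff: "n' y \<in> K \<longleftrightarrow> y \<in> K" if "y \<in> E" for y
      by (rule closed_under_preimage[OF _ n'inj KE nK that]) (simp add: K_def)
    have "p \<notin> K"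
    proof
      assume "p \<in> K"
      then obtain i where "i \<in> {1..k}" "p = (n ^^ i) p" unfolding K_def by (rule imageE)
      then show False using ne_p[of i] by (metis atLeastAtMost_iff less_eq_Suc_le One_nat_def)
    qed
    moreover have "q \<in> K" using k k0 unfolding K_def by (intro image_eqI[of _ _ k]) auto
    ultimately have "\<not> equivclp R' q p"
      using equivclp_closed[of R' q p K] K_iff by (metis R'_def)
    then show "\<not> equivclp R' p q" using equivclp_sym[of R' p q] by blast
  next
    assume *: "\<not> equivclp R' p q"
    show "equivclp R p q"
    proof (rule ccontr)
      assume npq: "\<not> equivclp R p q"
      have it: "equivclp R p ((n ^^ i) p)" for i
      proof (induction i)
        case (Suc i)
        then show ?case using itE[of i] by (auto simp: R_def intro: equivclp_into_equivclp)
      qed simp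
      have ne_q: "(n ^^ i) p \<noteq> q" for i using it[of i] npq by auto
      have "n ` Orb = Orb" using nOrb fO OE n(1) by (meson card_image card_subset_eq inj_on_subset)
      then have "p \<in> n ` Orb" using pO by (rule ssubst)
      then obtain y where y: "p = n y" "y \<in> Orb" by (rule imageE)
      from y(2) obtain i0 where i0: "y = (n ^^ i0) p" unfolding Orb_def by (rule rangeE)
      have "n ((n ^^ i0) p) = p" unfolding i0[symmetric] y(1)[symmetric] ..
      then have ex: "(n ^^ Suc i0) p = p" by simp
      \<comment> \<open>The orbit of \<open>p\<close> returns to \<open>p\<close> after
        \<open>Suc m\<close> steps and avoids \<open>q\<close>. Starting with
        \<open>n' q = n p\<close>, the map \<open>n'\<close> follows it all the way from
        \<open>q\<close> to \<open>p\<close>.\<close>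
      define m where "m = (LEAST m. (n ^^ Suc m) p = p)"
      have m: "(n ^^ Suc m) p = p" unfolding m_def by (rule LeastI) (rule ex)
      have m_min: "(n ^^ Suc i) p \<noteq> p" if "i < m" for i
        using not_less_Least[OF that[unfolded m_def]] .
      have "i \<le> m \<Longrightarrow> equivclp R' q ((n ^^ Suc i) p)" for i
      proof (induction i)
        case 0
        have "R' q (n p)" using pq by (simp add: R'_def n'_def)
        then show ?case by auto
      next
        case (Suc i)
        have "(n ^^ Suc i) p \<noteq> p" using m_min Suc.prems Suc_le_lessD by blast
        moreover have "(n ^^ Suc i) p \<noteq> q" by (rule ne_q)
        ultimately have "n' ((n ^^ Suc i) p) = (n ^^ Suc (Suc i)) p" by (simp add: n'_def)
        then have "R' ((n ^^ Suc i) p) ((n ^^ Suc (Suc i)) p)" using itE[of "Suc i"] by (simp add: R'_def)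
        moreover have "equivclp R' q ((n ^^ Suc i) p)" using Suc by (meson Suc_leD)
        ultimately show ?case by (meson equivclp_into_equivclp)
      qed
      from this[of m] have "equivclp R' q p" unfolding m by simp
      then show False using * equivclp_sym[of R' q p] by blast
    qed
  qed
qed

lemma equivclp_mono_sym:
  assumes "equivclp R a b" "\<And>x y. R x y \<Longrightarrow> S x y \<or> S y x"
  shows "equivclp S a b"
  using assms(1)
proof (induction rule: equivclp_induct)
  case (step y z)
  then show ?case using assms(2)[of y z] assms(2)[of z y] by (meson equivclp_into_equivclp)
qed simp

lemma joined_iff:
  "joined D \<alpha> a b \<longleftrightarrow> (\<exists>r < length (crossings D). let c = crossings D ! r in
     if positive c \<longleftrightarrow> r \<notin> \<alpha> then a = sw c \<and> b = nw c \<or> a = se c \<and> b = ne c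
     else a = sw c \<and> b = se c \<or> a = nw c \<and> b = ne c)"
  by (simp add: joined_def Let_def)

text \<open>
  A checkerboard colouring lets us reverse arcs so that the orientations alternate around every
  crossing.  Both smoothings respect these orientations, so their circles are the cycles of two
  permutations of the arcs which differ by a transposition.
\<close>

lemma circles_merge_or_split:
  assumes D: "oriented_link_diagram D" and r: "r < length (crossings D)" "c = crossings D ! r"
    and \<alpha>: "r \<in> \<alpha> \<longleftrightarrow> r \<notin> \<alpha>'" "\<And>r'. r' \<noteq> r \<Longrightarrow> r' \<in> \<alpha> \<longleftrightarrow> r' \<in> \<alpha>'"
  shows "circle D \<alpha> (sw c) = circle D \<alpha> (ne c) \<longleftrightarrow> circle D \<alpha>' (sw c) \<noteq> circle D \<alpha>' (ne c)"
proof -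
  have wf: "well_formed D" using D by (simp add: oriented_link_diagram_def)
  define E where "E = set (incoming D)"
  define N where "N = length (crossings D)"
  let ?c = "\<lambda>i. crossings D ! i"
  obtain \<chi> :: "nat \<times> side \<Rightarrow> bit" where
    \<chi>: "\<And>s t. same_corner D s t \<Longrightarrow> \<chi> s = \<chi> t"
    "\<And>e. e \<in> set (incoming D) \<Longrightarrow> \<chi> (e, Left) + \<chi> (e, Right) = 1"
    by (rule checkerboard_colouring[OF D]) blast
  have corner: "{sw (?c i), se (?c i), nw (?c i), ne (?c i)} \<subseteq> E" if "i < N" for i
    using corners_in_incoming[OF wf] that by (simp add: E_def N_def)
  \<comment> \<open>\<open>f e\<close> says that \<open>e\<close> keeps its orientation; all other
    arcs are reversed. Colours alternate around a crossing, hence so do the new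
    orientations.\<close>
  define f where "f = (\<lambda>e. \<chi> (e, Left) = 1)"
  have LR: "\<chi> (e, Right) = 1 \<longleftrightarrow> \<not> f e" if "e \<in> E" for e
    using \<chi>(2)[of e] that by (cases "\<chi> (e, Left)"; cases "\<chi> (e, Right)") (auto simp: E_def f_def)
  have f: "f (nw (?c i)) \<longleftrightarrow> f (sw (?c i))" "f (ne (?c i)) \<longleftrightarrow> \<not> f (sw (?c i))"
    "f (se (?c i)) \<longleftrightarrow> \<not> f (sw (?c i))" if "i < N" for i
  proof -
    have mem: "?c i \<in> set (crossings D)" using that by (simp add: N_def)
    have sc: "\<chi> (sw (?c i), Left) = \<chi> (nw (?c i), Left)" "\<chi> (nw (?c i), Right) = \<chi> (ne (?c i), Left)"
      "\<chi> (ne (?c i), Right) = \<chi> (se (?c i), Right)"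
      by (rule \<chi>(1), use mem in \<open>force simp: same_corner_def\<close>)+
    show "f (nw (?c i)) \<longleftrightarrow> f (sw (?c i))" using sc(1) by (simp add: f_def)
    have "f (ne (?c i)) \<longleftrightarrow> \<not> f (nw (?c i))" using sc(2) LR[of "nw (?c i)"] corner[OF that] by (simp add: f_def)
    then show ne: "f (ne (?c i)) \<longleftrightarrow> \<not> f (sw (?c i))" using sc(1) by (simp add: f_def)
    have "f (se (?c i)) \<longleftrightarrow> f (ne (?c i))"
      using sc(3) LR[of "ne (?c i)"] LR[of "se (?c i)"] corner[OF that] by simp
    then show "f (se (?c i)) \<longleftrightarrow> \<not> f (sw (?c i))" using ne by simp
  qed

  \<comment> \<open>After the reversal \<open>p i\<close> and \<open>q i\<close> enter crossing
    \<open>i\<close>, while \<open>s i\<close> and \<open>t i\<close> leave it. The pair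
    \<open>p i\<close>, \<open>s i\<close> is made of \<open>sw\<close> and \<open>nw\<close>, the
    pair \<open>q i\<close>, \<open>t i\<close> of \<open>se\<close> and \<open>ne\<close>.\<close>
  define p where "p = (\<lambda>i. if f (sw (?c i)) then sw (?c i) else nw (?c i))"
  define q where "q = (\<lambda>i. if f (sw (?c i)) then ne (?c i) else se (?c i))"
  define s where "s = (\<lambda>i. if f (sw (?c i)) then nw (?c i) else sw (?c i))"
  define t where "t = (\<lambda>i. if f (sw (?c i)) then se (?c i) else ne (?c i))"
  have ins_E: "p i \<in> E" "q i \<in> E" "s i \<in> E" "t i \<in> E" if "i < N" for i
    using corner[OF that] by (auto simp: p_def q_def s_def t_def)
  have fs: "p i = sw (?c i) \<and> f (p i) \<or> p i = nw (?c i) \<and> \<not> f (p i)"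
    "q i = ne (?c i) \<and> \<not> f (q i) \<or> q i = se (?c i) \<and> f (q i)"
    "s i = nw (?c i) \<and> f (s i) \<or> s i = sw (?c i) \<and> \<not> f (s i)"
    "t i = se (?c i) \<and> \<not> f (t i) \<or> t i = ne (?c i) \<and> f (t i)" if "i < N" for i
    using f[OF that] by (auto simp: p_def q_def s_def t_def)
  have di: "sw (?c i) \<noteq> se (?c k)" "sw (?c i) = sw (?c k) \<Longrightarrow> i = k" "se (?c i) = se (?c k) \<Longrightarrow> i = k"
    and do: "nw (?c i) \<noteq> ne (?c k)" "nw (?c i) = nw (?c k) \<Longrightarrow> i = k" "ne (?c i) = ne (?c k) \<Longrightarrow> i = k"
    if "i < N" "k < N" for i k
    using distinct_pairs_nth[of sw se "crossings D" i k] distinct_pairs_nth[of nw ne "crossings D" i k] wf that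
    by (auto simp: well_formed_def incoming_def outgoing_def N_def)
  have inj: "p i \<noteq> q k" "p i = p k \<Longrightarrow> i = k" "q i = q k \<Longrightarrow> i = k"
    "s i \<noteq> t k" "s i = s k \<Longrightarrow> i = k" "t i = t k \<Longrightarrow> i = k" if "i < N" "k < N" for i k
  proof -
    show "p i \<noteq> q k" using fs(1)[OF that(1)] fs(2)[OF that(2)] di(1)[OF that] do(1)[OF that] by metis
    show "i = k" if "p i = p k"
      using fs(1)[OF \<open>i < N\<close>] fs(1)[OF \<open>k < N\<close>] di(2)[OF \<open>i < N\<close> \<open>k < N\<close>] do(2)[OF \<open>i < N\<close> \<open>k < N\<close>] that by metis
    show "i = k" if "q i = q k"
      using fs(2)[OF \<open>i < N\<close>] fs(2)[OF \<open>k < N\<close>] di(3)[OF \<open>i < N\<close> \<open>k < N\<close>] do(3)[OF \<open>i < N\<close> \<open>k < N\<close>] that by metis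
    show "s i \<noteq> t k" using fs(3)[OF that(1)] fs(4)[OF that(2)] di(1)[OF that] do(1)[OF that] by metis
    show "i = k" if "s i = s k"
      using fs(3)[OF \<open>i < N\<close>] fs(3)[OF \<open>k < N\<close>] di(2)[OF \<open>i < N\<close> \<open>k < N\<close>] do(2)[OF \<open>i < N\<close> \<open>k < N\<close>] that by metis
    show "i = k" if "t i = t k"
      using fs(4)[OF \<open>i < N\<close>] fs(4)[OF \<open>k < N\<close>] di(3)[OF \<open>i < N\<close> \<open>k < N\<close>] do(3)[OF \<open>i < N\<close> \<open>k < N\<close>] that by metis
  qed
  \<comment> \<open>A kept arc enters the crossing where it comes in, a reversed arc the crossing
    where it originally goes out.\<close>
  have cover: "\<exists>i<N. e = p i \<or> e = q i" if e: "e \<in> E" for e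
  proof -
    have "e \<in> set (outgoing D)" using e wf by (simp add: E_def well_formed_def)
    then obtain i where i: "i < N" "e = nw (?c i) \<or> e = ne (?c i)"
      by (auto simp: outgoing_def N_def in_set_conv_nth)
    obtain k where k: "k < N" "e = sw (?c k) \<or> e = se (?c k)"
      using e by (auto simp: E_def incoming_def N_def in_set_conv_nth)
    show ?thesis using i k f[OF i(1)] f[OF k(1)] unfolding p_def q_def by metis
  qed

  define orient where "orient = (\<lambda>\<gamma> i. positive (?c i) \<longleftrightarrow> i \<notin> (\<gamma> :: nat set))"
  \<comment> \<open>The oriented smoothing leads \<open>p\<close> to \<open>s\<close> and
    \<open>q\<close> to \<open>t\<close>; the other one exchanges the two targets. This exchange is
    the transposition.\<close>
  define nxt where "nxt = (\<lambda>\<gamma> e. if \<exists>i<N. e = p i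
      then (let i = THE i. i < N \<and> e = p i in if orient \<gamma> i then s i else t i)
      else (let i = THE i. i < N \<and> e = q i in if orient \<gamma> i then t i else s i))"
  have nxt_p: "nxt \<gamma> (p i) = (if orient \<gamma> i then s i else t i)" if "i < N" for \<gamma> i
  proof -
    have "(THE k. k < N \<and> p i = p k) = i" using that inj(2) by (intro the_equality) auto
    then show ?thesis using that by (auto simp: nxt_def Let_def)
  qed
  have nxt_q: "nxt \<gamma> (q i) = (if orient \<gamma> i then t i else s i)" if "i < N" for \<gamma> i
  proof -
    have "(THE k. k < N \<and> q i = q k) = i" using that inj(3) by (intro the_equality) auto
    moreover have "\<not> (\<exists>k<N. q i = p k)" using inj(1) that by metis
    ultimately show ?thesis by (auto simp: nxt_def Let_def)
  qed
  have nxt_E: "nxt \<gamma> ` E \<subseteq> E" for \<gamma>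
    using cover nxt_p nxt_q ins_E by (metis image_subsetI)
  have nxt_inj: "inj_on (nxt \<gamma>) E" for \<gamma>
  proof (rule inj_onI)
    fix x y assume xy: "x \<in> E" "y \<in> E" "nxt \<gamma> x = nxt \<gamma> y"
    obtain i k where i: "i < N" "x = p i \<or> x = q i" and k: "k < N" "y = p k \<or> y = q k"
      using cover xy by metis
    have "i = k"
      using i(2) k(2) xy(3) nxt_p[OF i(1)] nxt_q[OF i(1)] nxt_p[OF k(1)] nxt_q[OF k(1)]
        inj(4)[OF i(1) k(1)] inj(4)[OF k(1) i(1)] inj(5,6)[OF i(1) k(1)] by (metis (full_types))
    then show "x = y"
      using i k xy(3) nxt_p[OF i(1)] nxt_q[OF i(1)] inj(4)[OF i(1) i(1)] by (metis (full_types))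
  qed
  have joined_nxt: "joined D \<gamma> a b \<Longrightarrow> (a \<in> E \<and> b = nxt \<gamma> a) \<or> (b \<in> E \<and> a = nxt \<gamma> b)" for \<gamma> a b
  proof -
    assume "joined D \<gamma> a b"
    then obtain i where i: "i < N" "if orient \<gamma> i then a = sw (?c i) \<and> b = nw (?c i) \<or> a = se (?c i) \<and> b = ne (?c i)
       else a = sw (?c i) \<and> b = se (?c i) \<or> a = nw (?c i) \<and> b = ne (?c i)"
      by (auto simp: joined_iff N_def orient_def Let_def)
    then have "(a \<in> {p i, q i} \<and> b = nxt \<gamma> a) \<or> (b \<in> {p i, q i} \<and> a = nxt \<gamma> b)"
      using nxt_p[OF i(1), of \<gamma>] nxt_q[OF i(1), of \<gamma>]
      by (cases "f (sw (?c i))"; cases "orient \<gamma> i") (auto simp: p_def q_def s_def t_def)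
    then show ?thesis using ins_E[OF i(1)] by auto
  qed
  have nxt_joined: "a \<in> E \<and> b = nxt \<gamma> a \<Longrightarrow> joined D \<gamma> a b \<or> joined D \<gamma> b a" for \<gamma> a b
  proof -
    assume ab: "a \<in> E \<and> b = nxt \<gamma> a"
    then obtain i where i: "i < N" "a = p i \<or> a = q i" using cover by blast
    have "(if orient \<gamma> i then a = sw (?c i) \<and> b = nw (?c i) \<or> a = se (?c i) \<and> b = ne (?c i)
       else a = sw (?c i) \<and> b = se (?c i) \<or> a = nw (?c i) \<and> b = ne (?c i)) \<or>
      (if orient \<gamma> i then b = sw (?c i) \<and> a = nw (?c i) \<or> b = se (?c i) \<and> a = ne (?c i)
       else b = sw (?c i) \<and> a = se (?c i) \<or> b = nw (?c i) \<and> a = ne (?c i))"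
      using i(2) ab nxt_p[OF i(1), of \<gamma>] nxt_q[OF i(1), of \<gamma>]
      by (cases "f (sw (?c i))"; cases "orient \<gamma> i") (auto simp: p_def q_def s_def t_def)
    then show ?thesis using i(1) unfolding joined_iff N_def orient_def Let_def by blast
  qed
  define R where "R = (\<lambda>\<gamma> a b. a \<in> E \<and> b = nxt \<gamma> a)"
  have circ: "circle D \<gamma> a = circle D \<gamma> b \<longleftrightarrow> equivclp (R \<gamma>) a b" for \<gamma> a b
    unfolding circle_def eq_class_eq_iff
    using equivclp_mono_sym[of "joined D \<gamma>" a b "R \<gamma>"] equivclp_mono_sym[of "R \<gamma>" a b "joined D \<gamma>"]
      joined_nxt nxt_joined by (auto simp: R_def)
  have rN: "r < N" using r by (simp add: N_def)
  \<comment> \<open>If \<open>sw\<close> is reversed, then \<open>sw\<close> and \<open>ne\<close>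
    are the successors of \<open>p r\<close> and \<open>q r\<close> in some order, so they lie on
    the same cycles as these.\<close>
  have pq: "circle D \<gamma> (sw c) = circle D \<gamma> (ne c) \<longleftrightarrow> equivclp (R \<gamma>) (p r) (q r)" for \<gamma>
  proof (cases "f (sw c)")
    case True
    then show ?thesis by (simp add: circ p_def q_def flip: r(2))
  next
    case False
    have "R \<gamma> (p r) (nxt \<gamma> (p r))" "R \<gamma> (q r) (nxt \<gamma> (q r))" using ins_E[OF rN] by (auto simp: R_def)
    then have "equivclp (R \<gamma>) (p r) (nxt \<gamma> (p r))" "equivclp (R \<gamma>) (q r) (nxt \<gamma> (q r))" by auto
    moreover have "{nxt \<gamma> (p r), nxt \<gamma> (q r)} = {sw c, ne c}"
      using False nxt_p[OF rN] nxt_q[OF rN] by (auto simp: s_def t_def simp flip: r(2))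
    ultimately show ?thesis unfolding circ
      by (metis doubleton_eq_iff equivclp_sym equivclp_trans)
  qed
  have "nxt \<alpha>' e = ((nxt \<alpha>)(p r := nxt \<alpha> (q r), q r := nxt \<alpha> (p r))) e" if e: "e \<in> E" for e
  proof -
    obtain i where i: "i < N" "e = p i \<or> e = q i" using cover e by blast
    show ?thesis
    proof (cases "i = r")
      case True
      then show ?thesis using i \<alpha>(1) inj(1)[OF rN rN] nxt_p[OF rN] nxt_q[OF rN]
        by (auto simp: orient_def)
    next
      case False
      then have "e \<noteq> p r" "e \<noteq> q r" using i inj[OF i(1) rN] inj[OF rN i(1)] by metis+
      moreover have "orient \<alpha>' i = orient \<alpha> i" using \<alpha>(2)[OF False] by (simp add: orient_def)
      ultimately show ?thesis using i nxt_p[OF i(1)] nxt_q[OF i(1)] by auto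
    qed
  qed
  then have "R \<alpha>' = (\<lambda>a b. a \<in> E \<and> b = ((nxt \<alpha>)(p r := nxt \<alpha> (q r), q r := nxt \<alpha> (p r))) a)"
    by (auto simp: R_def fun_eq_iff)
  moreover have "finite E" by (simp add: E_def)
  ultimately show ?thesis
    unfolding pq using transposition_splits_or_joins[OF _ nxt_inj nxt_E ins_E(1,2)[OF rN] inj(1)[OF rN rN], of \<alpha>]
    by (simp add: R_def)
qed

section \<open>Evaluation of labellings\<close>

lemma finite_UNIV_label: "finite (UNIV :: label set)" and UNIV_label: "(UNIV :: label set) = {One, X}"
proof -
  show *: "(UNIV :: label set) = {One, X}" using label.exhaust by auto
  show "finite (UNIV :: label set)" unfolding * by simp
qed

lemma sum_UNIV_label: "(\<Sum>l\<in>UNIV. f l) = f One + f X"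
  by (simp add: UNIV_label)

section \<open>Circles as a partition of the arcs\<close>

lemma joined_arcs:
  assumes "well_formed D" "joined D \<alpha> a b"
  shows "a \<in> arcs D \<and> b \<in> arcs D"
proof -
  obtain r where r: "r < length (crossings D)" "let c = crossings D ! r in {a, b} \<subseteq> {sw c, se c, nw c, ne c}"
    using assms(2) by (auto simp: joined_iff Let_def split: if_splits)
  have "{sw (crossings D ! r), se (crossings D ! r), nw (crossings D ! r), ne (crossings D ! r)} \<subseteq> arcs D"
    using corners_in_incoming[OF assms(1)] assms(1) nth_mem[OF r(1)] unfolding well_formed_def by blast
  then show ?thesis using r(2) unfolding Let_def by blast
qed

lemma joinedI:
  assumes "r < length (crossings D)"
    and "if positive (crossings D ! r) \<longleftrightarrow> r \<notin> \<alpha>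
      then a = sw (crossings D ! r) \<and> b = nw (crossings D ! r) \<or> a = se (crossings D ! r) \<and> b = ne (crossings D ! r)
      else a = sw (crossings D ! r) \<and> b = se (crossings D ! r) \<or> a = nw (crossings D ! r) \<and> b = ne (crossings D ! r)"
  shows "joined D \<alpha> a b"
  unfolding joined_iff Let_def using assms by (intro exI[of _ r] conjI)

lemma joinedE:
  assumes "joined D \<alpha> a b"
  obtains r where "r < length (crossings D)"
    "if positive (crossings D ! r) \<longleftrightarrow> r \<notin> \<alpha>
      then a = sw (crossings D ! r) \<and> b = nw (crossings D ! r) \<or> a = se (crossings D ! r) \<and> b = ne (crossings D ! r)
      else a = sw (crossings D ! r) \<and> b = se (crossings D ! r) \<or> a = nw (crossings D ! r) \<and> b = ne (crossings D ! r)"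
  using assms unfolding joined_iff Let_def by (elim exE conjE) (rule that)

lemma circle_self: "a \<in> circle D \<alpha> a"
  by (simp add: circle_def eq_class_def)

lemma circle_eq_iff: "circle D \<alpha> a = circle D \<alpha> b \<longleftrightarrow> b \<in> circle D \<alpha> a"
  by (simp add: circle_def eq_class_eq_iff) (simp add: eq_class_def)

lemma joined_circle: "joined D \<alpha> a b \<Longrightarrow> circle D \<alpha> a = circle D \<alpha> b"
  by (auto simp: circle_def eq_class_eq_iff)

lemma circle_least:
  assumes "a \<in> K" "\<And>x y. joined D \<alpha> x y \<Longrightarrow> x \<in> K \<longleftrightarrow> y \<in> K"
  shows "circle D \<alpha> a \<subseteq> K"
  using equivclp_closed[of "joined D \<alpha>" a _ K] assms unfolding circle_def eq_class_def by blast

lemma circle_closed: "joined D \<alpha> x y \<Longrightarrow> x \<in> circle D \<alpha> a \<longleftrightarrow> y \<in> circle D \<alpha> a"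
  using joined_circle circle_eq_iff by metis

lemma circle_subset_arcs: "well_formed D \<Longrightarrow> a \<in> arcs D \<Longrightarrow> circle D \<alpha> a \<subseteq> arcs D"
  using joined_arcs by (intro circle_least) blast+

lemma Union_circles: "well_formed D \<Longrightarrow> \<Union> (circles D \<alpha>) = arcs D"
  using circle_subset_arcs circle_self unfolding circles_def by fast

lemma finite_circles: "well_formed D \<Longrightarrow> finite (circles D \<alpha>)"
  by (simp add: well_formed_def circles_def)

lemma circles_disjoint:
  assumes "k \<in> circles D \<alpha>" "l \<in> circles D \<alpha>" "k \<noteq> l"
  shows "k \<inter> l = {}"
proof -
  have "circle D \<alpha> a \<inter> circle D \<alpha> b = {}" if "circle D \<alpha> a \<noteq> circle D \<alpha> b" for a b
    using that circle_eq_iff by blast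
  then show ?thesis using assms unfolding circles_def by blast
qed

lemma circles_nonempty: "k \<in> circles D \<alpha> \<Longrightarrow> k \<noteq> {}"
  using circle_self unfolding circles_def by fast

text \<open>The assumptions are symmetric in the two vertices, so each fact about
  \<open>\<alpha>\<close> has its mirror image at \<open>\<alpha>'\<close> through
  \<open>swap\<close>.\<close>

locale cube_edge =
  fixes D :: diagram and r :: nat and \<alpha> \<alpha>' :: "nat set"
  assumes wf: "well_formed D" and r: "r < length (crossings D)"
    and other: "\<And>r'. r' \<noteq> r \<Longrightarrow> r' \<in> \<alpha> \<longleftrightarrow> r' \<in> \<alpha>'"
begin

definition "a = circle D \<alpha> (sw (crossings D ! r))"
definition "b = circle D \<alpha> (ne (crossings D ! r))"
definition "a' = circle D \<alpha>' (sw (crossings D ! r))"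
definition "b' = circle D \<alpha>' (ne (crossings D ! r))"
definition "corner = {sw (crossings D ! r), se (crossings D ! r), nw (crossings D ! r), ne (crossings D ! r)}"

lemma corner_arcs: "corner \<subseteq> arcs D"
  using corners_in_incoming[OF wf] nth_mem[OF r] wf unfolding well_formed_def corner_def by blast

lemma ab_circles: "a \<in> circles D \<alpha>" "b \<in> circles D \<alpha>"
  using corner_arcs by (auto simp: a_def b_def circles_def corner_def)

text \<open>Each smoothing joins \<open>sw\<close> to one of \<open>nw\<close> and
  \<open>se\<close>, and \<open>ne\<close> to the other one, so the circles of \<open>sw\<close> and
  \<open>ne\<close> contain all four arcs.\<close>

lemma corner_subset: "corner \<subseteq> a \<union> b"
proof -
  let ?c = "crossings D ! r"
  have "joined D \<alpha> (sw ?c) (nw ?c) \<and> joined D \<alpha> (se ?c) (ne ?c) \<or>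
      joined D \<alpha> (sw ?c) (se ?c) \<and> joined D \<alpha> (nw ?c) (ne ?c)"
  proof (cases "positive ?c \<longleftrightarrow> r \<notin> \<alpha>")
    case True
    have "joined D \<alpha> (sw ?c) (nw ?c)" "joined D \<alpha> (se ?c) (ne ?c)"
      by (rule joinedI[OF r]; simp only: True; simp)+
    then show ?thesis by blast
  next
    case False
    have "joined D \<alpha> (sw ?c) (se ?c)" "joined D \<alpha> (nw ?c) (ne ?c)"
      by (rule joinedI[OF r]; simp only: False; simp)+
    then show ?thesis by blast
  qed
  then have "nw ?c \<in> a \<and> se ?c \<in> b \<or> se ?c \<in> a \<and> nw ?c \<in> b"
  proof (elim disjE conjE)
    assume "joined D \<alpha> (sw ?c) (nw ?c)" "joined D \<alpha> (se ?c) (ne ?c)"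
    then show ?thesis
      using circle_closed[of D \<alpha> "sw ?c" "nw ?c" "sw ?c"] circle_closed[of D \<alpha> "se ?c" "ne ?c" "ne ?c"]
        circle_self unfolding a_def b_def by simp
  next
    assume "joined D \<alpha> (sw ?c) (se ?c)" "joined D \<alpha> (nw ?c) (ne ?c)"
    then show ?thesis
      using circle_closed[of D \<alpha> "sw ?c" "se ?c" "sw ?c"] circle_closed[of D \<alpha> "nw ?c" "ne ?c" "ne ?c"]
        circle_self unfolding a_def b_def by simp
  qed
  moreover have "sw ?c \<in> a" "ne ?c \<in> b" unfolding a_def b_def by (rule circle_self)+
  ultimately show ?thesis unfolding corner_def by blast
qed

lemma joined_other:
  assumes "joined D \<alpha> x y" "x \<notin> corner \<or> y \<notin> corner"
  shows "joined D \<alpha>' x y"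
proof -
  from assms(1) show ?thesis
  proof (rule joinedE)
    fix r' assume r': "r' < length (crossings D)"
      "if positive (crossings D ! r') \<longleftrightarrow> r' \<notin> \<alpha>
        then x = sw (crossings D ! r') \<and> y = nw (crossings D ! r') \<or> x = se (crossings D ! r') \<and> y = ne (crossings D ! r')
        else x = sw (crossings D ! r') \<and> y = se (crossings D ! r') \<or> x = nw (crossings D ! r') \<and> y = ne (crossings D ! r')"
    have "r' \<noteq> r"
    proof
      assume "r' = r"
      note * = r'(2)[unfolded \<open>r' = r\<close>]
      have "x \<in> corner \<and> y \<in> corner"
      proof (cases "positive (crossings D ! r) \<longleftrightarrow> r \<notin> \<alpha>")
        case True
        show ?thesis using *[unfolded if_P[OF True]] unfolding corner_def by fast
      next
        case False
        show ?thesis using *[unfolded if_not_P[OF False]] unfolding corner_def by fast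
      qed
      then show False using assms(2) by blast
    qed
    then have eq: "r' \<in> \<alpha> \<longleftrightarrow> r' \<in> \<alpha>'" by (rule other)
    show ?thesis by (rule joinedI[OF r'(1)]) (use r'(2) in \<open>simp only: eq\<close>)
  qed
qed

lemma swap: "cube_edge D r \<alpha>' \<alpha>"
  using wf r other by unfold_locales simp_all

lemma swap_simps: "cube_edge.a D r \<alpha>' = a'" "cube_edge.b D r \<alpha>' = b'"
    "cube_edge.a' D r \<alpha> = a" "cube_edge.b' D r \<alpha> = b"
  by (simp_all only: cube_edge.a_def[OF swap] cube_edge.b_def[OF swap] cube_edge.a'_def[OF swap]
      cube_edge.b'_def[OF swap] a_def b_def a'_def b'_def)

lemmas joined_other' = cube_edge.joined_other[OF swap]
lemmas ab_circles' = cube_edge.ab_circles[OF swap, unfolded swap_simps]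

text \<open>A circle that avoids the four arcs at \<open>r\<close> uses only joins at other
  crossings, and these are the same at both vertices.\<close>

lemma untouched_subset: "circles D \<alpha> - {a, b} \<subseteq> circles D \<alpha>' - {a', b'}"
proof
  fix k assume k: "k \<in> circles D \<alpha> - {a, b}"
  then obtain x where x: "x \<in> arcs D" "k = circle D \<alpha> x" by (auto simp: circles_def)
  have "k \<inter> (a \<union> b) = {}" using k circles_disjoint ab_circles by blast
  then have kc: "k \<inter> corner = {}" using corner_subset by blast
  have sub: "circle D \<alpha>' x \<subseteq> k"
  proof (rule circle_least)
    show "x \<in> k" using x circle_self by simp
    show "y \<in> k \<longleftrightarrow> z \<in> k" if "joined D \<alpha>' y z" for y z
    proof (cases "y \<in> corner \<and> z \<in> corner")
      case True
      then show ?thesis using kc by blast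
    next
      case False
      then have "joined D \<alpha> y z" using joined_other' that by blast
      then show ?thesis unfolding x(2) by (rule circle_closed)
    qed
  qed
  have "k \<subseteq> circle D \<alpha>' x"
    unfolding x(2)
  proof (rule circle_least)
    show "x \<in> circle D \<alpha>' x" by (rule circle_self)
    show "y \<in> circle D \<alpha>' x \<longleftrightarrow> z \<in> circle D \<alpha>' x" if "joined D \<alpha> y z" for y z
    proof (cases "y \<in> corner \<and> z \<in> corner")
      case True
      then show ?thesis using kc sub by blast
    next
      case False
      then have "joined D \<alpha>' y z" using joined_other that by blast
      then show ?thesis by (rule circle_closed)
    qed
  qed
  then have keq: "k = circle D \<alpha>' x" using sub by blast
  have "sw (crossings D ! r) \<in> a' \<inter> corner" "ne (crossings D ! r) \<in> b' \<inter> corner"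
    using circle_self by (auto simp: a'_def b'_def corner_def)
  then have "k \<noteq> a'" "k \<noteq> b'" using kc by blast+
  then show "k \<in> circles D \<alpha>' - {a', b'}" using keq x(1) by (auto simp: circles_def)
qed

definition "U = circles D \<alpha> - {a, b}"

lemma U_eq: "U = circles D \<alpha>' - {a', b'}"
  unfolding U_def using untouched_subset cube_edge.untouched_subset[OF swap, unfolded swap_simps] by blast

lemma circles_eq: "circles D \<alpha> = insert a (insert b U)" "circles D \<alpha>' = insert a' (insert b' U)"
proof -
  show "circles D \<alpha> = insert a (insert b U)" unfolding U_def using ab_circles by blast
  show "circles D \<alpha>' = insert a' (insert b' U)" unfolding U_eq using ab_circles' by blast
qed

lemma not_in_U: "a \<notin> U" "b \<notin> U" "a' \<notin> U" "b' \<notin> U"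
proof -
  show "a \<notin> U" "b \<notin> U" unfolding U_def by blast+
  show "a' \<notin> U" "b' \<notin> U" unfolding U_eq by blast+
qed

lemma finite_U: "finite U"
  using finite_circles[OF wf] U_def by simp

text \<open>Both unions are what the circles in \<open>U\<close> leave over of
  \<open>arcs D\<close>.\<close>

lemma ab_Un: "a \<union> b = a' \<union> b'"
proof -
  have *: "\<Union> K = \<Union> (circles D \<gamma>) - \<Union> (circles D \<gamma> - K)" if "K \<subseteq> circles D \<gamma>" for K \<gamma>
  proof (intro subset_antisym subsetI)
    fix x assume "x \<in> \<Union> K"
    then obtain k where k: "x \<in> k" "k \<in> K" by blast
    have "x \<notin> l" if "l \<in> circles D \<gamma> - K" for l
    proof -
      have "k \<inter> l = {}" using that k(2) \<open>K \<subseteq> circles D \<gamma>\<close> by (intro circles_disjoint[of k D \<gamma> l]) blast+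
      then show ?thesis using k(1) by blast
    qed
    then show "x \<in> \<Union> (circles D \<gamma>) - \<Union> (circles D \<gamma> - K)" using k that by blast
  qed blast
  have "\<Union> {a, b} = arcs D - \<Union> U"
    unfolding U_def Union_circles[OF wf, of \<alpha>, symmetric] by (rule *) (simp add: ab_circles)
  moreover have "\<Union> {a', b'} = arcs D - \<Union> U"
    unfolding U_eq Union_circles[OF wf, of \<alpha>', symmetric] by (rule *) (simp add: ab_circles')
  ultimately show ?thesis by simp
qed

lemma edge_coeff_eq:
  "edge_coeff D m \<Delta> r (\<alpha>, l) (\<alpha>', l') = (if \<exists>k\<in>U. l' k \<noteq> l k then 0
     else if a \<noteq> b \<and> a' = b' then m (l a) (l b) (l' a')
     else if a = b \<and> a' \<noteq> b' then \<Delta> (l a) (l' a') (l' b')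
     else 0)"
  by (simp add: edge_coeff_def Let_def U_def a_def b_def a'_def b'_def)

end

lemma cube_edge_insert:
  assumes "well_formed D" "r < length (crossings D)"
  shows "cube_edge D r \<alpha> (insert r \<alpha>)" "cube_edge D r (\<alpha> - {r}) \<alpha>"
  using assms by unfold_locales auto

text \<open>On the arcs such a set is a union of circles. The local form, by joins at crossings,
  allows compatibility at different vertices of the cube to be compared crossing by
  crossing.\<close>

definition compatible :: "diagram \<Rightarrow> nat set \<Rightarrow> nat set \<Rightarrow> bool" where
  "compatible D \<alpha> S \<longleftrightarrow> (\<forall>x y. joined D \<alpha> x y \<longrightarrow> (x \<in> S \<longleftrightarrow> y \<in> S))"

lemma compatible_circle:
  assumes "compatible D \<alpha> S" "k \<in> circles D \<alpha>"
  shows "k \<subseteq> S \<or> k \<inter> S = {}"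
proof -
  obtain x where x: "k = circle D \<alpha> x" using assms(2) by (auto simp: circles_def)
  show ?thesis
    using circle_least[of x S D \<alpha>] circle_least[of x "- S" D \<alpha>] assms(1)
    unfolding compatible_def x by blast
qed

lemma compatibleI:
  assumes wf: "well_formed D" and "\<And>k. k \<in> circles D \<alpha> \<Longrightarrow> k \<subseteq> S \<or> k \<inter> S = {}"
  shows "compatible D \<alpha> S"
  unfolding compatible_def
proof (intro allI impI)
  fix x y assume xy: "joined D \<alpha> x y"
  have "circle D \<alpha> x \<in> circles D \<alpha>" using joined_arcs[OF wf xy] by (simp add: circles_def)
  moreover have "x \<in> circle D \<alpha> x" "y \<in> circle D \<alpha> x"
    using circle_self circle_closed[OF xy] by blast+
  ultimately show "x \<in> S \<longleftrightarrow> y \<in> S" using assms(2) by blast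
qed

text \<open>
  The two ring homomorphisms from the Frobenius algebra with \<open>x\<^sup>2 = u x\<close> to the polynomial
  ring send \<open>x\<close> to \<open>u\<close> and to \<open>0\<close>.  Applying one of them on every circle, the first one to the
  circles inside \<open>S\<close>, gives functionals which separate points and on which the differential has
  a simple form: a merge becomes multiplication by 1 and a split multiplication by \<open>u\<close>, as long as
  \<open>S\<close> is a union of circles before and after.
\<close>

definition label_value :: "bool \<Rightarrow> label \<Rightarrow> bit poly" where
  "label_value t l = (if l = One then 1 else if t then u else 0)"

definition evaluate :: "diagram \<Rightarrow> (gen \<Rightarrow> bit poly) \<Rightarrow> nat set \<Rightarrow> nat set \<Rightarrow> bit poly" where
  "evaluate D v \<alpha> S = (\<Sum>l \<in> circles D \<alpha> \<rightarrow>\<^sub>E UNIV. v (\<alpha>, l) * (\<Prod>k\<in>circles D \<alpha>. label_value (k \<subseteq> S) (l k)))"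

text \<open>Expressed by numbers of circles, so that the product along a path of edges can be
  computed from these numbers.\<close>

definition weight :: "diagram \<Rightarrow> nat set \<Rightarrow> nat set \<Rightarrow> bit poly" where
  "weight D \<alpha> \<alpha>' = (if card (circles D \<alpha>') < card (circles D \<alpha>) then 1 else u)"

lemma poly_add_self [simp]: "(p :: bit poly) + p = 0"
  by (rule poly_eqI) (simp only: coeff_add bit_add_self coeff_0)

lemma poly_two [simp]: "(2 :: bit poly) = 0"
  using poly_add_self[of 1] by (simp only: one_add_one)

lemma poly_add_self_left [simp]: "(p :: bit poly) + (p + q) = q"
  by (simp flip: add.assoc)

text \<open>\<open>label_value t\<close> is multiplicative because its value \<open>u\<close> or
  \<open>0\<close> at \<open>X\<close> solves the equation \<open>x^2 = u x\<close>.\<close>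

lemma merge_value:
  "(\<Sum>x\<in>UNIV. bn_m l l' x * label_value t x) = label_value t l * label_value t l'"
  by (cases l; cases l') (auto simp: sum_UNIV_label label_value_def)

text \<open>On \<open>\<Delta>(1)\<close> two equal evaluations give \<open>u + u + u\<close> or
  \<open>u\<close>, and two different ones give \<open>u + u = 0\<close>. On
  \<open>\<Delta>(x)\<close> the result is \<open>u * u\<close> or \<open>0\<close>.\<close>

lemma split_value:
  "(\<Sum>x\<in>UNIV. \<Sum>y\<in>UNIV. bn_\<Delta> l x y * (label_value t x * label_value t' y))
    = (if t = t' then u * label_value t l else 0)"
  by (cases l; cases t; cases t') (auto simp: sum_UNIV_label label_value_def algebra_simps)

lemma sum_PiE_fixed1:
  fixes G :: "label \<Rightarrow> 'r::comm_monoid_add"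
  assumes "finite U" "c \<notin> U"
  shows "(\<Sum>g \<in> insert c U \<rightarrow>\<^sub>E UNIV. if \<exists>k\<in>U. g k \<noteq> l k then 0 else G (g c)) = (\<Sum>x\<in>UNIV. G x)"
proof -
  let ?A = "{g \<in> insert c U \<rightarrow>\<^sub>E (UNIV :: label set). \<forall>k\<in>U. g k = l k}"
  have fin: "finite (insert c U \<rightarrow>\<^sub>E (UNIV :: label set))"
    using assms(1) finite_UNIV_label by (intro finite_PiE) auto
  have "(\<Sum>g \<in> insert c U \<rightarrow>\<^sub>E UNIV. if \<exists>k\<in>U. g k \<noteq> l k then 0 else G (g c)) = (\<Sum>g \<in> ?A. G (g c))"
    by (rule sum.mono_neutral_cong_right[OF fin]) auto
  also have "\<dots> = (\<Sum>x\<in>UNIV. G x)"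
  proof (rule sum.reindex_bij_witness[where j = "\<lambda>g. g c" and i = "\<lambda>x. (restrict l U)(c := x)"])
    show "(restrict l U)(c := g c) = g" if "g \<in> ?A" for g
      using that assms(2) by (auto simp: fun_eq_iff PiE_iff extensional_def restrict_def)
    show "(restrict l U)(c := x) \<in> ?A" for x
      using assms(2) by (auto simp: PiE_iff extensional_def)
  qed auto
  finally show ?thesis .
qed

lemma sum_PiE_fixed2:
  fixes G :: "label \<Rightarrow> label \<Rightarrow> 'r::comm_monoid_add"
  assumes "finite U" "c \<notin> U" "e \<notin> U" "c \<noteq> e"
  shows "(\<Sum>g \<in> insert c (insert e U) \<rightarrow>\<^sub>E UNIV. if \<exists>k\<in>U. g k \<noteq> l k then 0 else G (g c) (g e))
    = (\<Sum>x\<in>UNIV. \<Sum>y\<in>UNIV. G x y)"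
proof -
  let ?A = "{g \<in> insert c (insert e U) \<rightarrow>\<^sub>E (UNIV :: label set). \<forall>k\<in>U. g k = l k}"
  have fin: "finite (insert c (insert e U) \<rightarrow>\<^sub>E (UNIV :: label set))"
    using assms(1) finite_UNIV_label by (intro finite_PiE) auto
  have "(\<Sum>g \<in> insert c (insert e U) \<rightarrow>\<^sub>E UNIV. if \<exists>k\<in>U. g k \<noteq> l k then 0 else G (g c) (g e))
      = (\<Sum>g \<in> ?A. G (g c) (g e))"
    by (rule sum.mono_neutral_cong_right[OF fin]) auto
  also have "\<dots> = (\<Sum>(x, y) \<in> UNIV \<times> UNIV. G x y)"
  proof (rule sum.reindex_bij_witness[where j = "\<lambda>g. (g c, g e)" and i = "\<lambda>(x, y). (restrict l U)(c := x, e := y)"])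
    show "(case (g c, g e) of (x, y) \<Rightarrow> (restrict l U)(c := x, e := y)) = g" if "g \<in> ?A" for g
      using that assms by (auto simp: fun_eq_iff PiE_iff extensional_def restrict_def)
    show "(case xy of (x, y) \<Rightarrow> (restrict l U)(c := x, e := y)) \<in> ?A" for xy
      using assms by (auto simp: PiE_iff extensional_def split: prod.splits)
    show "(\<lambda>g. (g c, g e)) (case xy of (x, y) \<Rightarrow> (restrict l U)(c := x, e := y)) = xy" for xy
      using assms by (auto split: prod.splits)
  qed auto
  also have "\<dots> = (\<Sum>x\<in>UNIV. \<Sum>y\<in>UNIV. G x y)" by (rule sum.cartesian_product[symmetric])
  finally show ?thesis .
qed

context cube_edge
begin

text \<open>For a merge this is multiplicativity, and a set compatible after the merge is compatible
  before it. For a split the evaluation vanishes unless both new circles lie on the same side of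
  \<open>S\<close>, which is precisely compatibility at \<open>\<alpha>\<close>.\<close>

lemma evaluate_edge:
  assumes ms: "a = b \<longleftrightarrow> a' \<noteq> b'" and S: "compatible D \<alpha>' S"
  shows "(\<Sum>l' \<in> circles D \<alpha>' \<rightarrow>\<^sub>E UNIV. edge_coeff D bn_m bn_\<Delta> r (\<alpha>, l) (\<alpha>', l') *
      (\<Prod>k\<in>circles D \<alpha>'. label_value (k \<subseteq> S) (l' k)))
    = (if compatible D \<alpha> S then weight D \<alpha> \<alpha>' else 0) * (\<Prod>k\<in>circles D \<alpha>. label_value (k \<subseteq> S) (l k))"
proof -
  let ?P = "\<Prod>k\<in>U. label_value (k \<subseteq> S) (l k)"
  have comp': "a' \<subseteq> S \<or> a' \<inter> S = {}" "b' \<subseteq> S \<or> b' \<inter> S = {}" "\<And>k. k \<in> U \<Longrightarrow> k \<subseteq> S \<or> k \<inter> S = {}"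
    using compatible_circle[OF S] circles_eq(2) by auto
  have ne: "a \<noteq> {}" "b \<noteq> {}" "a' \<noteq> {}" "b' \<noteq> {}"
    using circles_nonempty ab_circles ab_circles' by blast+
  show ?thesis
  proof (cases "a = b")
    case False
    then have m: "a \<noteq> b" "a' = b'" using ms by auto
    have sub: "a \<subseteq> S \<longleftrightarrow> a' \<subseteq> S" "b \<subseteq> S \<longleftrightarrow> a' \<subseteq> S"
      using ab_Un m(2) comp'(1) ne by auto
    have "compatible D \<alpha> S"
    proof (rule compatibleI[OF wf])
      fix k assume "k \<in> circles D \<alpha>"
      then consider "k = a" | "k = b" | "k \<in> U" using circles_eq(1) by blast
      then show "k \<subseteq> S \<or> k \<inter> S = {}" using comp' ab_Un m(2) by cases auto
    qed
    moreover have "weight D \<alpha> \<alpha>' = 1"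
      using m not_in_U finite_U by (simp add: weight_def circles_eq)
    moreover have "(\<Sum>l' \<in> circles D \<alpha>' \<rightarrow>\<^sub>E UNIV. edge_coeff D bn_m bn_\<Delta> r (\<alpha>, l) (\<alpha>', l') *
        (\<Prod>k\<in>circles D \<alpha>'. label_value (k \<subseteq> S) (l' k)))
      = (\<Sum>l' \<in> insert a' U \<rightarrow>\<^sub>E UNIV. if \<exists>k\<in>U. l' k \<noteq> l k then 0
          else bn_m (l a) (l b) (l' a') * label_value (a' \<subseteq> S) (l' a') * ?P)"
      using m not_in_U finite_U by (intro sum.cong) (auto simp: circles_eq edge_coeff_eq mult.assoc)
    moreover have "\<dots> = (\<Sum>x\<in>UNIV. bn_m (l a) (l b) x * label_value (a' \<subseteq> S) x * ?P)"
      by (rule sum_PiE_fixed1[OF finite_U not_in_U(3)])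
    moreover have "\<dots> = label_value (a' \<subseteq> S) (l a) * label_value (a' \<subseteq> S) (l b) * ?P"
      by (simp only: merge_value flip: sum_distrib_right)
    moreover have "(\<Prod>k\<in>circles D \<alpha>. label_value (k \<subseteq> S) (l k))
        = label_value (a' \<subseteq> S) (l a) * label_value (a' \<subseteq> S) (l b) * ?P"
      using m(1) not_in_U finite_U by (simp add: circles_eq sub mult.assoc)
    ultimately show ?thesis by simp
  next
    case True
    then have m: "a = b" "a' \<noteq> b'" using ms by auto
    have comp: "compatible D \<alpha> S \<longleftrightarrow> (a' \<subseteq> S \<longleftrightarrow> b' \<subseteq> S)"
    proof
      assume "compatible D \<alpha> S"
      then have "a \<subseteq> S \<or> a \<inter> S = {}" using compatible_circle ab_circles by blast
      then show "a' \<subseteq> S \<longleftrightarrow> b' \<subseteq> S" using ab_Un m(1) ne by auto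
    next
      assume *: "a' \<subseteq> S \<longleftrightarrow> b' \<subseteq> S"
      show "compatible D \<alpha> S"
      proof (rule compatibleI[OF wf])
        fix k assume "k \<in> circles D \<alpha>"
        then consider "k = a" | "k \<in> U" using circles_eq(1) m(1) by blast
        then show "k \<subseteq> S \<or> k \<inter> S = {}" using comp' ab_Un m(1) * ne by cases auto
      qed
    qed
    have sub: "a \<subseteq> S \<longleftrightarrow> a' \<subseteq> S" if "a' \<subseteq> S \<longleftrightarrow> b' \<subseteq> S"
      using ab_Un m(1) that by auto
    have "weight D \<alpha> \<alpha>' = u"
      using m not_in_U finite_U by (simp add: weight_def circles_eq)
    moreover have "(\<Sum>l' \<in> circles D \<alpha>' \<rightarrow>\<^sub>E UNIV. edge_coeff D bn_m bn_\<Delta> r (\<alpha>, l) (\<alpha>', l') *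
        (\<Prod>k\<in>circles D \<alpha>'. label_value (k \<subseteq> S) (l' k)))
      = (\<Sum>l' \<in> insert a' (insert b' U) \<rightarrow>\<^sub>E UNIV. if \<exists>k\<in>U. l' k \<noteq> l k then 0
          else bn_\<Delta> (l a) (l' a') (l' b') * (label_value (a' \<subseteq> S) (l' a') * label_value (b' \<subseteq> S) (l' b')) * ?P)"
      using m not_in_U finite_U by (intro sum.cong) (auto simp: circles_eq edge_coeff_eq mult.assoc)
    moreover have "\<dots> = (\<Sum>x\<in>UNIV. \<Sum>y\<in>UNIV. bn_\<Delta> (l a) x y * (label_value (a' \<subseteq> S) x * label_value (b' \<subseteq> S) y) * ?P)"
      by (rule sum_PiE_fixed2[OF finite_U not_in_U(3,4) m(2)])
    moreover have "\<dots> = (if (a' \<subseteq> S) = (b' \<subseteq> S) then u * label_value (a' \<subseteq> S) (l a) else 0) * ?P"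
      by (simp only: split_value flip: sum_distrib_right)
    moreover have "(\<Prod>k\<in>circles D \<alpha>. label_value (k \<subseteq> S) (l k)) = label_value (a \<subseteq> S) (l a) * ?P"
      using m(1) not_in_U finite_U by (simp add: circles_eq)
    ultimately show ?thesis using sub by (simp add: comp mult.assoc)
  qed
qed

end

text \<open>An edge into \<open>\<alpha>'\<close> is determined by the entry that changes, so the
  sum over all generators reduces to the vertices \<open>\<alpha>' - {r}\<close>.\<close>

lemma cube_map_eq:
  assumes wf: "well_formed D" and "(\<alpha>', l') \<in> gens D"
  shows "cube_map D m \<Delta> v (\<alpha>', l') = (\<Sum>r\<in>\<alpha>'. \<Sum>l \<in> circles D (\<alpha>' - {r}) \<rightarrow>\<^sub>E UNIV.
    v (\<alpha>' - {r}, l) * edge_coeff D m \<Delta> r (\<alpha>' - {r}, l) (\<alpha>', l'))"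
proof -
  let ?n = "length (crossings D)"
  let ?R = "\<lambda>\<alpha>. {r. r < ?n \<and> r \<notin> \<alpha> \<and> \<alpha>' = insert r \<alpha>}"
  let ?L = "\<lambda>\<alpha>. circles D \<alpha> \<rightarrow>\<^sub>E (UNIV :: label set)"
  let ?f = "\<lambda>\<alpha> l r. v (\<alpha>, l) * edge_coeff D m \<Delta> r (\<alpha>, l) (\<alpha>', l')"
  have fin: "finite (?L \<alpha>)" for \<alpha> using finite_circles[OF wf] finite_UNIV_label by (intro finite_PiE) auto
  have \<alpha>': "\<alpha>' \<subseteq> {..<?n}" using assms by (auto simp: gens_def)
  have "cube_map D m \<Delta> v (\<alpha>', l') = (\<Sum>g \<in> gens D. \<Sum>r \<in> ?R (fst g). v g * edge_coeff D m \<Delta> r g (\<alpha>', l'))"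
    using assms by (simp add: cube_map_def)
  also have "\<dots> = (\<Sum>\<alpha>\<in>Pow {..<?n}. \<Sum>l\<in>?L \<alpha>. \<Sum>r\<in>?R \<alpha>. ?f \<alpha> l r)"
    unfolding gens_def by (subst sum.Sigma) (use fin in \<open>auto intro!: sum.cong\<close>)
  also have "\<dots> = (\<Sum>\<alpha>\<in>Pow {..<?n}. \<Sum>r\<in>?R \<alpha>. \<Sum>l\<in>?L \<alpha>. ?f \<alpha> l r)"
    by (intro sum.cong refl sum.swap)
  also have "\<dots> = (\<Sum>(\<alpha>, r) \<in> (SIGMA \<alpha> : Pow {..<?n}. ?R \<alpha>). \<Sum>l\<in>?L \<alpha>. ?f \<alpha> l r)"
    by (rule sum.Sigma) auto
  also have "\<dots> = (\<Sum>r\<in>\<alpha>'. \<Sum>l\<in>?L (\<alpha>' - {r}). ?f (\<alpha>' - {r}) l r)"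
    by (rule sum.reindex_bij_witness[where i = "\<lambda>r. (\<alpha>' - {r}, r)" and j = snd]) (use \<alpha>' in auto)
  finally show ?thesis .
qed

section \<open>The square of the Bar-Natan differential\<close>

text \<open>At each crossing \<open>\<alpha>'\<close> agrees with \<open>\<alpha>\<close> or with
  \<open>\<alpha>''\<close>. Hence on a face whose two ends are compatible with \<open>S\<close>,
  both paths pass through compatible vertices.\<close>

lemma compatible_intermediate:
  assumes "compatible D \<alpha> S" "compatible D \<alpha>'' S" "\<alpha> \<subseteq> \<alpha>'" "\<alpha>' \<subseteq> \<alpha>''"
  shows "compatible D \<alpha>' S"
  unfolding compatible_def
proof (intro allI impI)
  fix x y assume "joined D \<alpha>' x y"
  then show "x \<in> S \<longleftrightarrow> y \<in> S"
  proof (rule joinedE)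
    fix r assume r: "r < length (crossings D)"
      "if positive (crossings D ! r) \<longleftrightarrow> r \<notin> \<alpha>'
        then x = sw (crossings D ! r) \<and> y = nw (crossings D ! r) \<or> x = se (crossings D ! r) \<and> y = ne (crossings D ! r)
        else x = sw (crossings D ! r) \<and> y = se (crossings D ! r) \<or> x = nw (crossings D ! r) \<and> y = ne (crossings D ! r)"
    have "(r \<in> \<alpha>' \<longleftrightarrow> r \<in> \<alpha>) \<or> (r \<in> \<alpha>' \<longleftrightarrow> r \<in> \<alpha>'')" using assms(3,4) by blast
    then have "joined D \<alpha> x y \<or> joined D \<alpha>'' x y"
    proof
      assume "r \<in> \<alpha>' \<longleftrightarrow> r \<in> \<alpha>"
      then have "joined D \<alpha> x y" by (intro joinedI[OF r(1)]) (use r(2) in simp)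
      then show ?thesis ..
    next
      assume "r \<in> \<alpha>' \<longleftrightarrow> r \<in> \<alpha>''"
      then have "joined D \<alpha>'' x y" by (intro joinedI[OF r(1)]) (use r(2) in simp)
      then show ?thesis ..
    qed
    then show ?thesis using assms(1,2) unfolding compatible_def by blast
  qed
qed

lemma merge_or_split_edge:
  assumes "oriented_link_diagram D" "r < length (crossings D)" "r \<in> \<alpha>'"
  shows "cube_edge.a D r (\<alpha>' - {r}) = cube_edge.b D r (\<alpha>' - {r})
    \<longleftrightarrow> cube_edge.a' D r \<alpha>' \<noteq> cube_edge.b' D r \<alpha>'"
proof -
  have wf: "well_formed D" using assms(1) by (simp add: oriented_link_diagram_def)
  interpret cube_edge D r "\<alpha>' - {r}" \<alpha>' by (rule cube_edge_insert[OF wf assms(2)])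
  show ?thesis
    unfolding a_def b_def a'_def b'_def
    by (rule circles_merge_or_split[OF assms(1,2) refl]) (use assms(3) in auto)
qed

lemma evaluate_bn_diff:
  assumes D: "oriented_link_diagram D" and \<alpha>': "\<alpha>' \<subseteq> {..<length (crossings D)}"
    and S: "compatible D \<alpha>' S"
  shows "evaluate D (bn_diff D v) \<alpha>' S = (\<Sum>r\<in>\<alpha>'.
    (if compatible D (\<alpha>' - {r}) S then weight D (\<alpha>' - {r}) \<alpha>' else 0) * evaluate D v (\<alpha>' - {r}) S)"
proof -
  have wf: "well_formed D" using D by (simp add: oriented_link_diagram_def)
  let ?L = "\<lambda>\<alpha>. circles D \<alpha> \<rightarrow>\<^sub>E (UNIV :: label set)"
  let ?w = "\<lambda>r. if compatible D (\<alpha>' - {r}) S then weight D (\<alpha>' - {r}) \<alpha>' else 0"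
  let ?P = "\<lambda>\<alpha> l. \<Prod>k\<in>circles D \<alpha>. label_value (k \<subseteq> S) (l k)"
  let ?e = "\<lambda>r l l'. edge_coeff D bn_m bn_\<Delta> r (\<alpha>' - {r}, l) (\<alpha>', l')"
  have "evaluate D (bn_diff D v) \<alpha>' S
      = (\<Sum>l'\<in>?L \<alpha>'. (\<Sum>r\<in>\<alpha>'. \<Sum>l\<in>?L (\<alpha>' - {r}). v (\<alpha>' - {r}, l) * ?e r l l') * ?P \<alpha>' l')"
    unfolding evaluate_def bn_diff_def
    using \<alpha>' by (intro sum.cong refl arg_cong2[of _ _ _ _ "(*)"] cube_map_eq[OF wf]) (auto simp: gens_def)
  also have "\<dots> = (\<Sum>l'\<in>?L \<alpha>'. \<Sum>r\<in>\<alpha>'. \<Sum>l\<in>?L (\<alpha>' - {r}). v (\<alpha>' - {r}, l) * (?e r l l' * ?P \<alpha>' l'))"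
    by (simp add: sum_distrib_right mult.assoc)
  also have "\<dots> = (\<Sum>r\<in>\<alpha>'. \<Sum>l\<in>?L (\<alpha>' - {r}). \<Sum>l'\<in>?L \<alpha>'. v (\<alpha>' - {r}, l) * (?e r l l' * ?P \<alpha>' l'))"
    by (subst sum.swap) (intro sum.cong refl sum.swap)
  also have "\<dots> = (\<Sum>r\<in>\<alpha>'. \<Sum>l\<in>?L (\<alpha>' - {r}). v (\<alpha>' - {r}, l) * (?w r * ?P (\<alpha>' - {r}) l))"
  proof (intro sum.cong refl)
    fix r l assume r: "r \<in> \<alpha>'"
    then have "r < length (crossings D)" using \<alpha>' by auto
    then have *: "(\<Sum>l'\<in>?L \<alpha>'. ?e r l l' * ?P \<alpha>' l') = ?w r * ?P (\<alpha>' - {r}) l"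
      using r by (intro cube_edge.evaluate_edge cube_edge_insert wf merge_or_split_edge D S)
    show "(\<Sum>l'\<in>?L \<alpha>'. v (\<alpha>' - {r}, l) * (?e r l l' * ?P \<alpha>' l')) = v (\<alpha>' - {r}, l) * (?w r * ?P (\<alpha>' - {r}) l)"
      unfolding * [symmetric] by (rule sum_distrib_left[symmetric])
  qed
  also have "\<dots> = (\<Sum>r\<in>\<alpha>'. ?w r * evaluate D v (\<alpha>' - {r}) S)"
    unfolding evaluate_def sum_distrib_left by (intro sum.cong refl) (simp only: ac_simps)
  finally show ?thesis .
qed

text \<open>The matrix \<open>label_value\<close> has determinant \<open>u\<close>; this is its adjugate.\<close>

definition adjugate :: "label \<Rightarrow> bool \<Rightarrow> bit poly" where
  "adjugate l t = (if l = X then 1 else if t then 0 else u)"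

lemma adjugate: "(\<Sum>t\<in>UNIV. adjugate l t * label_value t l') = (if l = l' then u else 0)"
  by (cases l; cases l') (auto simp: adjugate_def label_value_def UNIV_bool)

text \<open>Compatible sets realise every choice of a homomorphism on each circle. The tensor power
  of the adjugate then recovers \<open>v (\<alpha>, l)\<close> up to a power of \<open>u\<close>,
  which can be cancelled.\<close>

lemma evaluate_separates:
  assumes wf: "well_formed D" and ev: "\<And>S. compatible D \<alpha> S \<Longrightarrow> evaluate D v \<alpha> S = 0"
    and l: "l \<in> circles D \<alpha> \<rightarrow>\<^sub>E UNIV"
  shows "v (\<alpha>, l) = 0"
proof -
  let ?C = "circles D \<alpha>"
  let ?L = "?C \<rightarrow>\<^sub>E (UNIV :: label set)" and ?T = "?C \<rightarrow>\<^sub>E (UNIV :: bool set)"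
  have fC: "finite ?C" by (rule finite_circles[OF wf])
  then have fL: "finite ?L" using finite_UNIV_label by (intro finite_PiE) auto
  have ev0: "(\<Sum>l'\<in>?L. v (\<alpha>, l') * (\<Prod>k\<in>?C. label_value (t k) (l' k))) = 0" for t
  proof -
    define S where "S = \<Union> {k \<in> ?C. t k}"
    have disj: "k \<inter> S = {}" if k: "k \<in> ?C" "\<not> t k" for k
    proof -
      have "k \<inter> k' = {}" if "k' \<in> {k \<in> ?C. t k}" for k'
        by (rule circles_disjoint[OF k(1)]) (use that k(2) in auto)
      then show ?thesis unfolding S_def by blast
    qed
    have in_S: "k \<subseteq> S \<longleftrightarrow> t k" if k: "k \<in> ?C" for k
      using disj[OF k] circles_nonempty[OF k] k unfolding S_def by blast
    have "compatible D \<alpha> S"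
      using in_S disj by (intro compatibleI[OF wf]) blast
    from ev[OF this] show ?thesis
      unfolding evaluate_def using in_S by (simp cong: prod.cong)
  qed
  have "0 = (\<Sum>t\<in>?T. (\<Prod>k\<in>?C. adjugate (l k) (t k)) * (\<Sum>l'\<in>?L. v (\<alpha>, l') * (\<Prod>k\<in>?C. label_value (t k) (l' k))))"
    by (simp add: ev0)
  also have "\<dots> = (\<Sum>l'\<in>?L. v (\<alpha>, l') * (\<Sum>t\<in>?T. \<Prod>k\<in>?C. adjugate (l k) (t k) * label_value (t k) (l' k)))"
    unfolding sum_distrib_left by (subst sum.swap) (simp add: prod.distrib ac_simps)
  also have "\<dots> = (\<Sum>l'\<in>?L. v (\<alpha>, l') * (\<Prod>k\<in>?C. if l k = l' k then u else 0))"
    by (subst prod_sum_PiE[symmetric]) (use fC in \<open>auto simp: adjugate\<close>)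
  also have "\<dots> = (\<Sum>l'\<in>?L. if l' = l then v (\<alpha>, l) * u ^ card ?C else 0)"
  proof (rule sum.cong[OF refl])
    fix l' assume l': "l' \<in> ?L"
    show "v (\<alpha>, l') * (\<Prod>k\<in>?C. if l k = l' k then u else 0) = (if l' = l then v (\<alpha>, l) * u ^ card ?C else 0)"
    proof (cases "l' = l")
      case False
      then obtain k where "k \<in> ?C" "l k \<noteq> l' k" using PiE_ext[OF l' l] by metis
      then have "(\<Prod>k\<in>?C. if l k = l' k then u else 0) = 0" using fC by (intro prod_zero) auto
      then show ?thesis using False by simp
    qed simp
  qed
  also have "\<dots> = v (\<alpha>, l) * u ^ card ?C" using fL l by simp
  finally show ?thesis by (simp add: u_def)
qed

text \<open>In characteristic 2 the terms for \<open>(x, y)\<close> and \<open>(y, x)\<close>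
  cancel.\<close>

lemma sum_symmetric_pairs:
  fixes f :: "'a \<Rightarrow> 'a \<Rightarrow> bit poly"
  assumes "finite A" and sym: "\<And>x y. x \<in> A \<Longrightarrow> y \<in> A \<Longrightarrow> x \<noteq> y \<Longrightarrow> f x y = f y x"
  shows "(\<Sum>x\<in>A. \<Sum>y\<in>A - {x}. f x y) = 0"
  using assms
proof (induction A rule: finite_induct)
  case (insert a A)
  have "(\<Sum>x\<in>insert a A. \<Sum>y\<in>insert a A - {x}. f x y)
      = (\<Sum>y\<in>A. f a y) + (\<Sum>x\<in>A. f x a + (\<Sum>y\<in>A - {x}. f x y))"
  proof -
    have "(\<Sum>y\<in>insert a A - {x}. f x y) = f x a + (\<Sum>y\<in>A - {x}. f x y)" if "x \<in> A" for x
    proof -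
      have "insert a A - {x} = insert a (A - {x})" using insert(2) that by auto
      then show ?thesis using insert(1,2) by simp
    qed
    moreover have "insert a A - {a} = A" using insert(2) by auto
    ultimately show ?thesis using insert(1,2) by simp
  qed
  also have "(\<Sum>y\<in>A. f a y) = (\<Sum>x\<in>A. f x a)"
    using insert(2,4) by (intro sum.cong refl) auto
  also have "(\<Sum>x\<in>A. f x a) + (\<Sum>x\<in>A. f x a + (\<Sum>y\<in>A - {x}. f x y)) = (\<Sum>x\<in>A. \<Sum>y\<in>A - {x}. f x y)"
    by (simp only: sum.distrib poly_add_self_left)
  also have "\<dots> = 0" using insert(3,4) by simp
  finally show ?case .
qed simp

lemma card_circles_edge:
  assumes "oriented_link_diagram D" "r < length (crossings D)" "r \<in> \<alpha>'"
  shows "card (circles D \<alpha>') = Suc (card (circles D (\<alpha>' - {r}))) \<or>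
    card (circles D (\<alpha>' - {r})) = Suc (card (circles D \<alpha>'))"
proof -
  have wf: "well_formed D" using assms(1) by (simp add: oriented_link_diagram_def)
  interpret cube_edge D r "\<alpha>' - {r}" \<alpha>' by (rule cube_edge_insert[OF wf assms(2)])
  show ?thesis
  proof (cases "a = b")
    case True
    then have "a' \<noteq> b'" using merge_or_split_edge[OF assms] by blast
    then have "card (circles D \<alpha>') = Suc (card (circles D (\<alpha>' - {r})))"
      unfolding circles_eq True using not_in_U finite_U by simp
    then show ?thesis ..
  next
    case False
    then have e: "a' = b'" using merge_or_split_edge[OF assms] by blast
    have "card (circles D (\<alpha>' - {r})) = Suc (card (circles D \<alpha>'))"
      unfolding circles_eq e using not_in_U finite_U False by simp
    then show ?thesis ..
  qed
qed

text \<open>A path of two steps from \<open>k\<close> to \<open>n\<close> with \<open>s\<close>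
  splits has \<open>n + 2 = k + 2 * s\<close>, so both products are \<open>c ^ s\<close> with the
  same \<open>s\<close>.\<close>

lemma square_of_counts:
  fixes k l m n :: nat
  assumes "m = Suc k \<or> k = Suc m" "l = Suc k \<or> k = Suc l" "n = Suc m \<or> m = Suc n" "n = Suc l \<or> l = Suc n"
  shows "(if n < m then 1 else c) * (if m < k then 1 else c)
    = (if n < l then 1 else c) * (if l < k then 1 else c :: 'r::comm_semiring_1)"
  using assms by (cases "n < m"; cases "m < k"; cases "n < l"; cases "l < k"; simp; linarith)

lemma weight_paths:
  assumes D: "oriented_link_diagram D" and r: "r < length (crossings D)" "s < length (crossings D)"
    "r \<in> \<alpha>" "s \<in> \<alpha>" "r \<noteq> s"
  shows "weight D (\<alpha> - {r}) \<alpha> * weight D (\<alpha> - {r} - {s}) (\<alpha> - {r})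
    = weight D (\<alpha> - {s}) \<alpha> * weight D (\<alpha> - {s} - {r}) (\<alpha> - {s})"
proof -
  have e: "\<alpha> - {s} - {r} = \<alpha> - {r} - {s}" by auto
  show ?thesis
    using card_circles_edge[OF D r(1,3)] card_circles_edge[OF D r(2,4)]
      card_circles_edge[OF D r(2), of "\<alpha> - {r}"] card_circles_edge[OF D r(1), of "\<alpha> - {s}"] r(3-5)
    unfolding e weight_def by (intro square_of_counts) auto
qed

lemma bn_diff_bn_diff:
  assumes D: "oriented_link_diagram D"
  shows "bn_diff D (bn_diff D v) = (\<lambda>_. 0)"
proof
  fix g :: gen
  obtain \<alpha> l where g: "g = (\<alpha>, l)" by (cases g)
  have wf: "well_formed D" using D by (simp add: oriented_link_diagram_def)
  show "bn_diff D (bn_diff D v) g = 0"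
  proof (cases "g \<in> gens D")
    case True
    then have \<alpha>: "\<alpha> \<subseteq> {..<length (crossings D)}" and l: "l \<in> circles D \<alpha> \<rightarrow>\<^sub>E UNIV"
      by (auto simp: gens_def g)
    then have fin: "finite \<alpha>" using finite_subset by blast
    have lt: "r < length (crossings D)" if "r \<in> \<alpha>" for r using that \<alpha> by auto
    have "evaluate D (bn_diff D (bn_diff D v)) \<alpha> S = 0" if S: "compatible D \<alpha> S" for S
    proof -
      \<comment> \<open>The contribution of the path on which \<open>s\<close> and then
        \<open>r\<close> is switched to 1. Compatibility is asked only at its start, since together
        with \<open>S\<close> compatible at \<open>\<alpha>\<close> it implies compatibility at
        \<open>\<alpha> - {r}\<close>.\<close>
      let ?f = "\<lambda>r s. if compatible D (\<alpha> - {r} - {s}) S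
        then weight D (\<alpha> - {r}) \<alpha> * weight D (\<alpha> - {r} - {s}) (\<alpha> - {r}) * evaluate D v (\<alpha> - {r} - {s}) S else 0"
      have "evaluate D (bn_diff D (bn_diff D v)) \<alpha> S = (\<Sum>r\<in>\<alpha>. \<Sum>s\<in>\<alpha> - {r}. ?f r s)"
        unfolding evaluate_bn_diff[OF D \<alpha> S]
      proof (intro sum.cong refl)
        fix r assume "r \<in> \<alpha>"
        show "(if compatible D (\<alpha> - {r}) S then weight D (\<alpha> - {r}) \<alpha> else 0) * evaluate D (bn_diff D v) (\<alpha> - {r}) S
          = (\<Sum>s\<in>\<alpha> - {r}. ?f r s)"
        proof (cases "compatible D (\<alpha> - {r}) S")
          case True
          have "\<alpha> - {r} \<subseteq> {..<length (crossings D)}" using \<alpha> by auto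
          from evaluate_bn_diff[OF D this True] show ?thesis
            using True by (simp add: sum_distrib_left mult.assoc if_distrib[of "\<lambda>x. _ * x"] if_distrib[of "\<lambda>x. x * _"] cong: if_cong)
        next
          case False
          have "\<not> compatible D (\<alpha> - {r} - {s}) S" for s
            using compatible_intermediate[OF _ S, of "\<alpha> - {r} - {s}" "\<alpha> - {r}"] False by auto
          then show ?thesis using False by simp
        qed
      qed
      also have "\<dots> = 0"
      proof (rule sum_symmetric_pairs[OF fin])
        fix r s assume rs: "r \<in> \<alpha>" "s \<in> \<alpha>" "r \<noteq> s"
        have "\<alpha> - {s} - {r} = \<alpha> - {r} - {s}" by auto
        then show "?f r s = ?f s r"
          using weight_paths[OF D lt[OF rs(1)] lt[OF rs(2)] rs] by simp
      qed
      finally show ?thesis .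
    qed
    then show ?thesis unfolding g by (rule evaluate_separates[OF wf _ l])
  next
    case False
    then show ?thesis by (simp add: bn_diff_def cube_map_def)
  qed
qed

section \<open>Khovanov homology as the leading part\<close>

definition slice :: "(gen \<Rightarrow> bit poly) \<Rightarrow> nat \<Rightarrow> gen \<Rightarrow> bit" where
  "slice v k g = coeff (v g) k"

definition single :: "nat \<Rightarrow> (gen \<Rightarrow> bit) \<Rightarrow> gen \<Rightarrow> bit poly" where
  "single k w g = monom (w g) k"

lemma slice_add [simp]: "slice (v + w) k = slice v k + slice w k"
  by (simp add: slice_def fun_eq_iff)

lemma slice_zero [simp]: "slice 0 k = 0"
  by (simp add: slice_def fun_eq_iff)

lemma slice_single: "slice (single k w) i = (if i = k then w else 0)"
  by (simp add: slice_def single_def fun_eq_iff)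

lemma slice_eqI: "(\<And>k. slice v k = slice w k) \<Longrightarrow> v = w"
  by (simp add: slice_def fun_eq_iff poly_eq_iff)

lemma cube_map_add: "cube_map D m \<Delta> (v + w) = cube_map D m \<Delta> v + cube_map D m \<Delta> w"
  by (simp add: cube_map_def fun_eq_iff distrib_right sum.distrib)

lemma cube_map_zero: "cube_map D m \<Delta> 0 = 0"
  by (simp add: cube_map_def fun_eq_iff)

lemma kh_diff_add: "kh_diff D (v + w) = kh_diff D v + kh_diff D w"
  and beta_add: "beta D (v + w) = beta D v + beta D w"
  and bn_diff_add: "bn_diff D (x + y) = bn_diff D x + bn_diff D y"
  and kh_diff_zero: "kh_diff D 0 = 0" and beta_zero: "beta D 0 = 0"
  by (simp_all only: kh_diff_def beta_def bn_diff_def cube_map_add cube_map_zero)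

lemma bn_m_eq: "bn_m k l i = [:kh_m k l i, beta_m k l i:]"
  by (cases k; cases l) (simp_all add: u_def of_bool_def one_pCons)

lemma bn_\<Delta>_eq: "bn_\<Delta> k l i = [:kh_\<Delta> k l i, beta_\<Delta> k l i:]"
  by (cases k) (simp_all add: u_def of_bool_def one_pCons)

lemma edge_coeff_bn:
  "edge_coeff D bn_m bn_\<Delta> r g g' = [:edge_coeff D kh_m kh_\<Delta> r g g', edge_coeff D beta_m beta_\<Delta> r g g':]"
  by (cases g; cases g') (simp add: edge_coeff_def Let_def bn_m_eq bn_\<Delta>_eq)

lemma slice_bn_diff:
  "slice (bn_diff D v) k = kh_diff D (slice v k) + (if k = 0 then 0 else beta D (slice v (k - 1)))"
proof
  fix g'
  have "coeff (p * [:a, b:]) k = coeff p k * a + (if k = 0 then 0 else coeff p (k - 1) * b)" for p :: "bit poly" and a b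
    by (cases k) (simp_all add: mult_pCons_right coeff_pCons mult.commute)
  then have "coeff (p * edge_coeff D bn_m bn_\<Delta> r g g') k = coeff p k * edge_coeff D kh_m kh_\<Delta> r g g' +
      (if k = 0 then 0 else coeff p (k - 1) * edge_coeff D beta_m beta_\<Delta> r g g')" for p r g
    by (simp only: edge_coeff_bn)
  then show "slice (bn_diff D v) k g' = (kh_diff D (slice v k) + (if k = 0 then 0 else beta D (slice v (k - 1)))) g'"
    by (cases "k = 0") (simp_all add: slice_def bn_diff_def kh_diff_def beta_def cube_map_def coeff_sum sum.distrib)
qed

text \<open>These are the coefficients of \<open>1\<close> and \<open>u\<close> in the square of the
  Bar-Natan differential at a chain constant in \<open>u\<close>. In characteristic 2 the two mixed
  composites have sum zero exactly if they are equal.\<close>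

lemma kh_relations:
  assumes "oriented_link_diagram D"
  shows "kh_diff D (kh_diff D w) = 0" "kh_diff D (beta D w) = beta D (kh_diff D w)"
proof -
  have s: "slice (bn_diff D (bn_diff D (single 0 w))) k = 0" for k
    by (simp add: bn_diff_bn_diff[OF assms] slice_def fun_eq_iff)
  show "kh_diff D (kh_diff D w) = 0"
    using s[of 0] by (simp add: slice_bn_diff slice_single)
  have "kh_diff D (beta D w) + beta D (kh_diff D w) = 0"
    using s[of 1] by (simp add: slice_bn_diff slice_single kh_diff_zero)
  then have "kh_diff D (beta D w) g + beta D (kh_diff D w) g = 0" for g
    by (metis plus_fun_apply zero_fun_apply)
  then show "kh_diff D (beta D w) = beta D (kh_diff D w)"
    by (metis (no_types) add_right_cancel bit_add_self ext)
qed

section \<open>Degrees of the cube maps\<close>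

context cube_edge
begin

lemma label_deg_sum:
  assumes "\<forall>k\<in>U. l' k = l k"
  shows "(\<Sum>k\<in>circles D \<alpha>. label_deg (l k)) = (\<Sum>k\<in>{a, b}. label_deg (l k)) + (\<Sum>k\<in>U. label_deg (l' k))"
    and "(\<Sum>k\<in>circles D \<alpha>'. label_deg (l' k)) = (\<Sum>k\<in>{a', b'}. label_deg (l' k)) + (\<Sum>k\<in>U. label_deg (l' k))"
proof -
  have "circles D \<alpha> = {a, b} \<union> U" "circles D \<alpha>' = {a', b'} \<union> U" by (simp_all add: circles_eq)
  moreover have "sum f ({a, b} \<union> U) = sum f {a, b} + sum f U" "sum f ({a', b'} \<union> U) = sum f {a', b'} + sum f U"
    for f :: "nat set \<Rightarrow> int"
    by (rule sum.union_disjoint; use not_in_U finite_U in simp)+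
  moreover have "(\<Sum>k\<in>U. label_deg (l k)) = (\<Sum>k\<in>U. label_deg (l' k))" using assms by simp
  ultimately show "(\<Sum>k\<in>circles D \<alpha>. label_deg (l k)) = (\<Sum>k\<in>{a, b}. label_deg (l k)) + (\<Sum>k\<in>U. label_deg (l' k))"
    "(\<Sum>k\<in>circles D \<alpha>'. label_deg (l' k)) = (\<Sum>k\<in>{a', b'}. label_deg (l' k)) + (\<Sum>k\<in>U. label_deg (l' k))"
    by simp_all
qed

text \<open>\<open>e\<close> is -1 for \<open>kh_diff\<close> and 1 for \<open>beta\<close>, for
  merge and split maps alike. The homological grading adds 1, which gives the shifts 0 and 2 of the
  \<open>q\<close>-grading.\<close>

lemma edge_degree:
  fixes m \<Delta> :: "bit structure_constants"
  assumes nz: "edge_coeff D m \<Delta> r (\<alpha>, l) (\<alpha>', l') \<noteq> 0"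
    and m: "\<And>i j k. m i j k \<noteq> 0 \<Longrightarrow> label_deg k = label_deg i + label_deg j + e"
    and \<Delta>: "\<And>i j k. \<Delta> i j k \<noteq> 0 \<Longrightarrow> label_deg j + label_deg k = label_deg i + e"
  shows "(\<Sum>k\<in>circles D \<alpha>'. label_deg (l' k)) = (\<Sum>k\<in>circles D \<alpha>. label_deg (l k)) + e"
proof -
  have U: "\<forall>k\<in>U. l' k = l k" using nz unfolding edge_coeff_eq by meson
  have n: "(if a \<noteq> b \<and> a' = b' then m (l a) (l b) (l' a') else if a = b \<and> a' \<noteq> b' then \<Delta> (l a) (l' a') (l' b') else 0) \<noteq> 0"
    using nz U unfolding edge_coeff_eq by meson
  consider "a \<noteq> b" "a' = b'" "m (l a) (l b) (l' a') \<noteq> 0" | "a = b" "a' \<noteq> b'" "\<Delta> (l a) (l' a') (l' b') \<noteq> 0"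
    using n by meson
  then show ?thesis
  proof cases
    case 1
    then show ?thesis using m[OF 1(3)] by (simp add: label_deg_sum[OF U])
  next
    case 2
    then show ?thesis using \<Delta>[OF 2(3)] by (simp add: label_deg_sum[OF U])
  qed
qed

end

lemma cube_map_support:
  assumes "cube_map D m \<Delta> v g' \<noteq> 0"
  obtains g r where "g' \<in> gens D" "g \<in> gens D" "v g \<noteq> 0" "r < length (crossings D)" "r \<notin> fst g"
    "fst g' = insert r (fst g)" "edge_coeff D m \<Delta> r g g' \<noteq> 0"
proof -
  have g': "g' \<in> gens D" and nz: "(\<Sum>g \<in> gens D. \<Sum>r | r < length (crossings D) \<and> r \<notin> fst g \<and> fst g' = insert r (fst g).
             v g * edge_coeff D m \<Delta> r g g') \<noteq> 0"
    using assms by (auto simp: cube_map_def split: if_splits)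
  obtain g where g: "g \<in> gens D" "(\<Sum>r | r < length (crossings D) \<and> r \<notin> fst g \<and> fst g' = insert r (fst g).
             v g * edge_coeff D m \<Delta> r g g') \<noteq> 0"
    using sum.not_neutral_contains_not_neutral[OF nz] by blast
  obtain r where "r < length (crossings D) \<and> r \<notin> fst g \<and> fst g' = insert r (fst g)"
    "v g * edge_coeff D m \<Delta> r g g' \<noteq> 0"
    using sum.not_neutral_contains_not_neutral[OF g(2)] by blast
  then show ?thesis using that[OF g' g(1)] by fastforce
qed

definition kh_cochains :: "diagram \<Rightarrow> int \<Rightarrow> int \<Rightarrow> (gen \<Rightarrow> bit) set" where
  "kh_cochains D i j = {v. \<forall>g. v g \<noteq> 0 \<longrightarrow> g \<in> gens D \<and> hdeg D g = i \<and> qdeg D g = j}"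

lemma kh_chain_eq: "kh_chain D i j = add_group (kh_cochains D i j)"
  by (simp add: kh_chain_def kh_cochains_def pointwise_group_eq)

lemma cube_map_cochains:
  fixes m \<Delta> :: "bit structure_constants"
  assumes wf: "well_formed D" and v: "v \<in> kh_cochains D i j"
    and m: "\<And>i j k. m i j k \<noteq> 0 \<Longrightarrow> label_deg k = label_deg i + label_deg j + e"
    and \<Delta>: "\<And>i j k. \<Delta> i j k \<noteq> 0 \<Longrightarrow> label_deg j + label_deg k = label_deg i + e"
  shows "cube_map D m \<Delta> v \<in> kh_cochains D (i + 1) (j + e + 1)"
  unfolding kh_cochains_def
proof (intro CollectI allI impI)
  fix g' assume "cube_map D m \<Delta> v g' \<noteq> 0"
  then show "g' \<in> gens D \<and> hdeg D g' = i + 1 \<and> qdeg D g' = j + e + 1"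
  proof (rule cube_map_support)
    fix g r assume *: "g' \<in> gens D" "g \<in> gens D" "v g \<noteq> 0" "r < length (crossings D)" "r \<notin> fst g"
      "fst g' = insert r (fst g)" "edge_coeff D m \<Delta> r g g' \<noteq> 0"
    obtain \<alpha> l where g: "g = (\<alpha>, l)" by (cases g)
    obtain \<alpha>' l' where g': "g' = (\<alpha>', l')" by (cases g')
    have \<alpha>': "\<alpha>' = insert r \<alpha>" "r \<notin> \<alpha>" using * by (auto simp: g g')
    interpret cube_edge D r \<alpha> \<alpha>' unfolding \<alpha>' by (rule cube_edge_insert[OF wf *(4)])
    have "finite \<alpha>" using *(2) by (auto simp: g gens_def intro: finite_subset)
    then have h: "hdeg D g' = hdeg D g + 1" using \<alpha>' by (simp add: hdeg_def g g')
    have "(\<Sum>k\<in>circles D \<alpha>'. label_deg (l' k)) = (\<Sum>k\<in>circles D \<alpha>. label_deg (l k)) + e"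
      using *(7) unfolding g g' by (rule edge_degree) (use m \<Delta> in auto)
    then have "qdeg D g' = qdeg D g + e + 1" using h by (simp add: qdeg_def g g')
    moreover have "hdeg D g = i \<and> qdeg D g = j" using v *(3) unfolding kh_cochains_def by blast
    ultimately show ?thesis using *(1) h by simp
  qed
qed

lemma kh_diff_cochains:
  assumes "well_formed D" "v \<in> kh_cochains D i j"
  shows "kh_diff D v \<in> kh_cochains D (i + 1) j"
proof -
  have "label_deg k = label_deg i + label_deg j + - 1" if "kh_m i j k \<noteq> 0" for i j k
    using that by (cases i; cases j; cases k) auto
  moreover have "label_deg j + label_deg k = label_deg i + - 1" if "kh_\<Delta> i j k \<noteq> 0" for i j k
    using that by (cases i; cases j; cases k) auto
  ultimately show ?thesis
    using cube_map_cochains[OF assms, of kh_m "- 1" kh_\<Delta>] by (simp add: kh_diff_def)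
qed

lemma beta_cochains:
  assumes "well_formed D" "v \<in> kh_cochains D i j"
  shows "beta D v \<in> kh_cochains D (i + 1) (j + 2)"
proof -
  have "label_deg k = label_deg i + label_deg j + 1" if "beta_m i j k \<noteq> 0" for i j k
    using that by (cases i; cases j; cases k) auto
  moreover have "label_deg j + label_deg k = label_deg i + 1" if "beta_\<Delta> i j k \<noteq> 0" for i j k
    using that by (cases i; cases j; cases k) auto
  ultimately show ?thesis
    using cube_map_cochains[OF assms, of beta_m 1 beta_\<Delta>] by (simp add: beta_def add.commute)
qed

lemma kh_cochains_subspace: "f2_subspace (kh_cochains D i j)"
  unfolding f2_subspace_def
proof (intro conjI ballI)
  fix v w assume *: "v \<in> kh_cochains D i j" "w \<in> kh_cochains D i j"
  have "v g \<noteq> 0 \<or> w g \<noteq> 0" if "(v + w) g \<noteq> 0" for g using that by (metis add_0 plus_fun_apply)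
  then show "v + w \<in> kh_cochains D i j" using * unfolding kh_cochains_def by blast
qed (auto simp: kh_cochains_def fun_eq_iff)

text \<open>The multiples of \<open>u ^ p\<close> in \<open>q\<close>-grading \<open>j\<close>;
  since \<open>u\<close> has \<open>q\<close>-degree -2, the coefficient of \<open>u ^ k\<close> has
  \<open>q\<close>-grading \<open>j + 2 * k\<close>.\<close>

definition bn_filtration :: "diagram \<Rightarrow> int \<Rightarrow> int \<Rightarrow> int \<Rightarrow> (gen \<Rightarrow> bit poly) set" where
  "bn_filtration D j p n = {v. \<forall>k. slice v k \<in> kh_cochains D n (j + 2 * int k) \<and> (int k < p \<longrightarrow> slice v k = 0)}"

lemma bn_chain_eq: "bn_chain D n j = add_group (bn_filtration D j 0 n)"
proof -
  have "{v. \<forall>g k. coeff (v g) k \<noteq> 0 \<longrightarrow> g \<in> gens D \<and> hdeg D g = n \<and> qdeg D g - 2 * int k = j}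
      = bn_filtration D j 0 n"
    by (auto simp: bn_filtration_def kh_cochains_def slice_def algebra_simps)
  then show ?thesis by (simp add: bn_chain_def pointwise_group_eq)
qed

lemma finite_gens: "well_formed D \<Longrightarrow> finite (gens D)"
  unfolding gens_def using finite_circles finite_UNIV_label by (intro finite_SigmaI finite_PiE) auto

lemma bn_filtered_complex:
  assumes D: "oriented_link_diagram D"
  shows "filtered_complex (bn_filtration D j) (bn_diff D)"
proof
  have wf: "well_formed D" using D by (simp add: oriented_link_diagram_def)
  fix p p' n :: int and x y :: "gen \<Rightarrow> bit poly"
  show "f2_subspace (bn_filtration D j p n)"
    unfolding f2_subspace_def
  proof (intro conjI ballI)
    show "0 \<in> bn_filtration D j p n"
      using f2_subspaceD(1)[OF kh_cochains_subspace] by (simp add: bn_filtration_def)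
    fix v w assume v: "v \<in> bn_filtration D j p n"
    show "v + v = 0" by (simp add: fun_eq_iff)
    assume w: "w \<in> bn_filtration D j p n"
    show "v + w \<in> bn_filtration D j p n"
      using v w f2_subspaceD(2)[OF kh_cochains_subspace] by (simp add: bn_filtration_def)
  qed
  show "p \<le> p' \<Longrightarrow> bn_filtration D j p' n \<subseteq> bn_filtration D j p n"
    by (auto simp: bn_filtration_def)
  show "p \<le> 0 \<Longrightarrow> bn_filtration D j p n = bn_filtration D j 0 n"
    by (auto simp: bn_filtration_def)
  show "\<exists>p. bn_filtration D j p n = {0}"
  proof
    \<comment> \<open>A nonzero coefficient of \<open>u ^ k\<close> at \<open>g\<close> requires
      \<open>2 * k = qdeg D g - j\<close>, and the sum of the absolute values bounds this for all
      \<open>g\<close> at once.\<close>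
    let ?P = "(\<Sum>g\<in>gens D. \<bar>qdeg D g - j\<bar>) + 1"
    have "slice v k g = 0" if v: "v \<in> bn_filtration D j ?P n" for v k g
    proof (rule ccontr)
      assume nz: "slice v k g \<noteq> 0"
      then have g: "g \<in> gens D" "qdeg D g = j + 2 * int k"
        using v unfolding bn_filtration_def kh_cochains_def by blast+
      have "\<bar>qdeg D g - j\<bar> \<le> (\<Sum>g\<in>gens D. \<bar>qdeg D g - j\<bar>)"
        by (rule member_le_sum[OF g(1)]) (use finite_gens[OF wf] in auto)
      then have "int k < ?P" using g(2) by simp
      then have "slice v k = 0" using v unfolding bn_filtration_def by blast
      then show False using nz by simp
    qed
    then have "v = 0" if "v \<in> bn_filtration D j ?P n" for v
      using that by (intro slice_eqI) (simp add: fun_eq_iff)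
    moreover have "0 \<in> bn_filtration D j ?P n"
      using f2_subspaceD(1)[OF kh_cochains_subspace] by (simp add: bn_filtration_def)
    ultimately show "bn_filtration D j ?P n = {0}" by blast
  qed
  show "bn_diff D (x + y) = bn_diff D x + bn_diff D y" by (rule bn_diff_add)
  show "bn_diff D (bn_diff D x) = 0" using bn_diff_bn_diff[OF D] by (simp add: zero_fun_def)
  show "bn_diff D x \<in> bn_filtration D j p (n + 1)" if x: "x \<in> bn_filtration D j p n"
    unfolding bn_filtration_def
  proof (intro CollectI allI conjI impI)
    fix k
    have x': "slice x k \<in> kh_cochains D n (j + 2 * int k)" "int k < p \<Longrightarrow> slice x k = 0" for k
      using x unfolding bn_filtration_def by blast+
    have "beta D (slice x (k - 1)) \<in> kh_cochains D (n + 1) (j + 2 * int k)" if "k \<noteq> 0"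
    proof -
      have "j + 2 * int (k - 1) + 2 = j + 2 * int k" using that by (simp add: of_nat_diff)
      then show ?thesis using beta_cochains[OF wf x'(1)[of "k - 1"]] by simp
    qed
    moreover have "kh_diff D (slice x k) \<in> kh_cochains D (n + 1) (j + 2 * int k)"
      by (rule kh_diff_cochains[OF wf x'(1)])
    ultimately show "slice (bn_diff D x) k \<in> kh_cochains D (n + 1) (j + 2 * int k)"
      using f2_subspaceD(2)[OF kh_cochains_subspace] unfolding slice_bn_diff by (cases "k = 0") auto
    assume "int k < p"
    then show "slice (bn_diff D x) k = 0"
      using x'(2)[of k] x'(2)[of "k - 1"] by (simp add: slice_bn_diff kh_diff_zero beta_zero)
  qed
qed

section \<open>Khovanov homology as a quotient and the induced map of \<open>beta\<close>\<close>

definition kh_cocycles :: "diagram \<Rightarrow> int \<Rightarrow> int \<Rightarrow> (gen \<Rightarrow> bit) set" where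
  "kh_cocycles D i j = {v \<in> kh_cochains D i j. kh_diff D v = 0}"

definition kh_coboundaries :: "diagram \<Rightarrow> int \<Rightarrow> int \<Rightarrow> (gen \<Rightarrow> bit) set" where
  "kh_coboundaries D i j = kh_diff D ` kh_cochains D (i - 1) j"

lemma KH_eq: "KH D i j = quotient_space (kh_cocycles D i j) (kh_coboundaries D i j)"
  by (simp add: KH_def kh_chain_eq homology_def quotient_space_def kernel_def kh_cocycles_def
      kh_coboundaries_def add_group_def)

lemma kh_cocycles_subspace: "f2_subspace (kh_cocycles D i j)"
  using f2_subspaceD[OF kh_cochains_subspace[of D i j]]
  by (auto simp: f2_subspace_def kh_cocycles_def kh_diff_add kh_diff_zero)

lemma kh_coboundaries_subspace: "f2_subspace (kh_coboundaries D i j)"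
  unfolding kh_coboundaries_def by (rule f2_subspace_image[OF kh_cochains_subspace]) (rule kh_diff_add)

lemma kh_coboundaries_subset:
  assumes "oriented_link_diagram D"
  shows "kh_coboundaries D i j \<subseteq> kh_cocycles D i j"
  using kh_diff_cochains[of D _ "i - 1" j] assms kh_relations(1)[OF assms]
  by (auto simp: kh_coboundaries_def kh_cocycles_def oriented_link_diagram_def)

lemma KH_f2:
  assumes "oriented_link_diagram D"
  shows "f2_space (KH D i j)"
  unfolding KH_eq
  by (intro f2_space_quotient_space kh_cocycles_subspace kh_coboundaries_subspace kh_coboundaries_subset assms)

lemma KH_group:
  assumes "oriented_link_diagram D"
  shows "comm_group (KH D i j)" "group (KH D i j)"
  using KH_f2[OF assms, of i j] by (auto simp: f2_space_def comm_group_def)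

lemma beta_star_eq: "beta_star D i j = quotient_map (kh_coboundaries D (i + 1) (j + 2)) (beta D)"
  by (simp add: beta_star_def quotient_map_def kh_chain_eq kh_coboundaries_def fun_eq_iff)

lemma beta_cocycles:
  assumes D: "oriented_link_diagram D"
  shows "v \<in> kh_cocycles D i j \<Longrightarrow> beta D v \<in> kh_cocycles D (i + 1) (j + 2)"
    and "v \<in> kh_coboundaries D i j \<Longrightarrow> beta D v \<in> kh_coboundaries D (i + 1) (j + 2)"
proof -
  have wf: "well_formed D" using D by (simp add: oriented_link_diagram_def)
  show "v \<in> kh_cocycles D i j \<Longrightarrow> beta D v \<in> kh_cocycles D (i + 1) (j + 2)"
    using beta_cochains[OF wf] by (simp add: kh_cocycles_def kh_relations(2)[OF D] beta_zero)
  assume "v \<in> kh_coboundaries D i j"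
  then obtain w where w: "v = kh_diff D w" "w \<in> kh_cochains D (i - 1) j" by (auto simp: kh_coboundaries_def)
  have "beta D w \<in> kh_cochains D (i + 1 - 1) (j + 2)" using beta_cochains[OF wf w(2)] by simp
  then show "beta D v \<in> kh_coboundaries D (i + 1) (j + 2)"
    unfolding w(1) kh_relations(2)[OF D, symmetric] kh_coboundaries_def by (rule imageI)
qed

lemma beta_star_coset:
  assumes D: "oriented_link_diagram D" and "v \<in> kh_cocycles D i j"
  shows "beta_star D i j (coset (kh_coboundaries D i j) v) = coset (kh_coboundaries D (i + 1) (j + 2)) (beta D v)"
  unfolding beta_star_eq
  by (rule quotient_map_coset[OF kh_cocycles_subspace kh_coboundaries_subspace kh_coboundaries_subset[OF D]
        kh_cocycles_subspace kh_coboundaries_subspace kh_coboundaries_subset[OF D]])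
    (use assms beta_cocycles[OF D] in \<open>auto simp: beta_add\<close>)

lemma beta_star_hom:
  assumes D: "oriented_link_diagram D"
  shows "beta_star D i j \<in> hom (KH D i j) (KH D (i + 1) (j + 2))"
  unfolding beta_star_eq KH_eq
  by (rule quotient_map_hom[OF kh_cocycles_subspace kh_coboundaries_subspace kh_coboundaries_subset[OF D]
        kh_cocycles_subspace kh_coboundaries_subspace kh_coboundaries_subset[OF D]])
    (use assms beta_cocycles[OF D] in \<open>auto simp: beta_add\<close>)

section \<open>The spectral sequence\<close>

locale bar_natan =
  fixes D :: diagram and j :: int
  assumes D: "oriented_link_diagram D"

sublocale bar_natan \<subseteq> filtered_complex "bn_filtration D j" "bn_diff D"
  by (rule bn_filtered_complex[OF D])

context bar_natan
begin

lemma wf: "well_formed D"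
  using D by (simp add: oriented_link_diagram_def)

lemma BN_eq: "BN D n j = quotient_space (cycles n) (boundaries n)"
  unfolding BN_def bn_chain_eq by (rule homology_eq)

lemma single_filtration:
  assumes "p \<ge> 0" "w \<in> kh_cochains D n (j + 2 * p)"
  shows "single (nat p) w \<in> bn_filtration D j p n"
  using assms f2_subspaceD(1)[OF kh_cochains_subspace] by (auto simp: bn_filtration_def slice_single)

text \<open>There is nothing below \<open>u ^ p\<close> in \<open>x\<close>, so \<open>beta\<close>
  cannot contribute to the leading coefficient of the differential and enters only in the next one.
  This is how it becomes the differential of the first page.\<close>

lemma slice_d:
  assumes "p \<ge> 0" "x \<in> bn_filtration D j p n"
  shows "slice (bn_diff D x) (nat p) = kh_diff D (slice x (nat p))"
    and "slice (bn_diff D x) (nat (p + 1)) = kh_diff D (slice x (nat (p + 1))) + beta D (slice x (nat p))"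
proof -
  have "slice x (nat p - 1) = 0" if "nat p \<noteq> 0"
    using assms that by (auto simp: bn_filtration_def)
  then show "slice (bn_diff D x) (nat p) = kh_diff D (slice x (nat p))"
    by (simp add: slice_bn_diff beta_zero)
  have "nat (p + 1) = Suc (nat p)" using assms(1) by simp
  then show "slice (bn_diff D x) (nat (p + 1)) = kh_diff D (slice x (nat (p + 1))) + beta D (slice x (nat p))"
    by (simp add: slice_bn_diff)
qed

lemma filtration_step:
  assumes "p \<ge> 0"
  shows "x \<in> bn_filtration D j (p + 1) n \<longleftrightarrow> x \<in> bn_filtration D j p n \<and> slice x (nat p) = 0"
proof
  assume x: "x \<in> bn_filtration D j p n \<and> slice x (nat p) = 0"
  have "slice x k = 0" if "int k < p + 1" for k
  proof (cases "int k = p")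
    case True
    then have "k = nat p" by simp
    then show ?thesis using x by simp
  next
    case False
    then have "int k < p" using that by simp
    then show ?thesis using x by (simp add: bn_filtration_def)
  qed
  then show "x \<in> bn_filtration D j (p + 1) n" using x by (simp add: bn_filtration_def)
qed (use assms in \<open>auto simp: bn_filtration_def\<close>)

text \<open>The differential of \<open>x\<close> moves up one filtration step exactly if its
  coefficient at \<open>u ^ p\<close>, which is \<open>kh_diff\<close> of that of \<open>x\<close>,
  vanishes.\<close>

lemma Z_1:
  assumes "p \<ge> 0"
  shows "x \<in> Z 1 p n \<longleftrightarrow> x \<in> bn_filtration D j p n \<and> slice x (nat p) \<in> kh_cocycles D n (j + 2 * p)"
proof -
  have "slice x (nat p) \<in> kh_cochains D n (j + 2 * p)" if "x \<in> bn_filtration D j p n"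
  proof -
    have "slice x (nat p) \<in> kh_cochains D n (j + 2 * int (nat p))" using that unfolding bn_filtration_def by blast
    then show ?thesis using assms by simp
  qed
  then show ?thesis
    using filtration_step[OF assms, of "bn_diff D x" "n + 1"] slice_d(1)[OF assms, of x n] d_Fil[of x p n]
    by (auto simp: Z_def kh_cocycles_def)
qed

lemma Z_0: "Z 0 p n = bn_filtration D j p n"
  using d_Fil by (auto simp: Z_def)

definition leading_class :: "int \<Rightarrow> int \<Rightarrow> (gen \<Rightarrow> bit poly) \<Rightarrow> (gen \<Rightarrow> bit) set" where
  "leading_class p q x = coset (kh_coboundaries D (p + q) (j + 2 * p)) (slice x (nat p))"

definition page_1_KH :: "int \<Rightarrow> int \<Rightarrow> (gen \<Rightarrow> bit poly) set \<Rightarrow> (gen \<Rightarrow> bit) set" where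
  "page_1_KH p q Q = the_elem (leading_class p q ` Q)"

text \<open>At level 1 the summands of \<open>B\<close> are the elements of filtration
  \<open>p + 1\<close> and the boundaries of elements of filtration \<open>p\<close>; modulo the
  former only coefficients at \<open>u ^ p\<close> remain.\<close>

lemma leading_class_B:
  assumes p: "p \<ge> 0" and x: "x \<in> Z 1 p (p + q)"
  shows "leading_class p q x = \<one>\<^bsub>KH D (p + q) (j + 2 * p)\<^esub> \<longleftrightarrow> x \<in> B 1 p (p + q)"
proof -
  let ?n = "p + q"
  have xZ: "x \<in> bn_filtration D j p ?n" "slice x (nat p) \<in> kh_cocycles D ?n (j + 2 * p)"
    using x Z_1[OF p] by auto
  have "leading_class p q x = \<one>\<^bsub>KH D (p + q) (j + 2 * p)\<^esub> \<longleftrightarrow> slice x (nat p) \<in> kh_coboundaries D ?n (j + 2 * p)"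
    unfolding leading_class_def KH_eq one_quotient_space
    by (rule coset_eq_one_iff[OF kh_cocycles_subspace kh_coboundaries_subspace kh_coboundaries_subset[OF D] xZ(2)])
  also have "\<dots> \<longleftrightarrow> x \<in> B 1 p ?n"
  proof
    assume "slice x (nat p) \<in> kh_coboundaries D ?n (j + 2 * p)"
    then obtain w where w: "slice x (nat p) = kh_diff D w" "w \<in> kh_cochains D (?n - 1) (j + 2 * p)"
      by (auto simp: kh_coboundaries_def)
    \<comment> \<open>The monomial lift of \<open>w\<close> has a boundary with the same coefficient
      at \<open>u ^ p\<close> as \<open>x\<close>, so adding this boundary moves \<open>x\<close> up
      one filtration step.\<close>
    define z where "z = single (nat p) w"
    have z: "z \<in> bn_filtration D j p (?n - 1)" using single_filtration[OF p w(2)] by (simp add: z_def)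
    then have dz: "bn_diff D z \<in> bn_filtration D j p ?n" using d_Fil[OF z] by simp
    have "slice (x + bn_diff D z) (nat p) = kh_diff D w + kh_diff D w"
      using slice_d(1)[OF p z] by (simp add: w(1) z_def slice_single)
    also have "\<dots> = 0" by (simp add: fun_eq_iff)
    finally have "x + bn_diff D z \<in> bn_filtration D j (p + 1) ?n"
      using filtration_step[OF p] f2_subspaceD(2)[OF Fil_subspace xZ(1) dz] by blast
    moreover have "x = (x + bn_diff D z) + bn_diff D z"
      using f2_subspaceD(3)[OF Fil_subspace dz] by (simp add: add.assoc)
    moreover have "z \<in> Z (1 - 1) (p - 1 + 1) (?n - 1)" using z by (simp add: Z_0)
    moreover have "Z (1 - 1) (p + 1) ?n = bn_filtration D j (p + 1) ?n" by (simp add: Z_0)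
    ultimately show "x \<in> B 1 p ?n" unfolding B_def by blast
  next
    assume "x \<in> B 1 p ?n"
    then obtain y z where yz: "x = y + bn_diff D z" "y \<in> bn_filtration D j (p + 1) ?n"
      "z \<in> bn_filtration D j p (?n - 1)" by (auto simp: B_def Z_0)
    have "slice x (nat p) = kh_diff D (slice z (nat p))"
      using yz(2) filtration_step[OF p] slice_d(1)[OF p yz(3)] by (simp add: yz(1))
    moreover have "slice z (nat p) \<in> kh_cochains D (?n - 1) (j + 2 * int (nat p))"
      using yz(3) unfolding bn_filtration_def by blast
    ultimately show "slice x (nat p) \<in> kh_coboundaries D ?n (j + 2 * p)"
      using p by (auto simp: kh_coboundaries_def)
  qed
  finally show ?thesis .
qed

lemma leading_class_hom:
  assumes p: "p \<ge> 0"
  shows "leading_class p q \<in> hom (add_group (Z 1 p (p + q))) (KH D (p + q) (j + 2 * p))"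
    and "leading_class p q ` Z 1 p (p + q) = carrier (KH D (p + q) (j + 2 * p))"
proof -
  let ?n = "p + q"
  have sl: "slice x (nat p) \<in> kh_cocycles D ?n (j + 2 * p)" if "x \<in> Z 1 p ?n" for x
    using that Z_1[OF p] by blast
  show "leading_class p q \<in> hom (add_group (Z 1 p ?n)) (KH D ?n (j + 2 * p))"
    using sl mult_quotient_space[OF kh_cocycles_subspace kh_coboundaries_subspace kh_coboundaries_subset[OF D]]
    by (auto simp: hom_def leading_class_def KH_eq carrier_quotient_space)
  show "leading_class p q ` Z 1 p ?n = carrier (KH D ?n (j + 2 * p))"
  proof (intro subset_antisym subsetI)
    fix Q assume "Q \<in> carrier (KH D ?n (j + 2 * p))"
    then obtain w where w: "w \<in> kh_cocycles D ?n (j + 2 * p)" "Q = coset (kh_coboundaries D ?n (j + 2 * p)) w"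
      by (auto simp: KH_eq carrier_quotient_space)
    have "single (nat p) w \<in> Z 1 p ?n"
      using w(1) single_filtration[OF p] by (simp add: Z_1[OF p] slice_single kh_cocycles_def)
    moreover have "leading_class p q (single (nat p) w) = Q"
      by (simp add: leading_class_def slice_single w(2))
    ultimately show "Q \<in> leading_class p q ` Z 1 p ?n" by blast
  qed (use sl in \<open>auto simp: leading_class_def KH_eq carrier_quotient_space\<close>)
qed

lemma page_1_KH:
  assumes p: "p \<ge> 0"
  shows "page_1_KH p q \<in> iso (page 1 p q) (KH D (p + q) (j + 2 * p))"
    and "x \<in> Z 1 p (p + q) \<Longrightarrow> page_1_KH p q (coset (B 1 p (p + q)) x) = leading_class p q x"
proof -
  have G: "group (add_group (Z 1 p (p + q)))"
    using comm_group_add_group[OF Z_subspace] by (simp add: comm_group_def)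
  have L: "B 1 p (p + q) = {x \<in> carrier (add_group (Z 1 p (p + q))). leading_class p q x = \<one>\<^bsub>KH D (p + q) (j + 2 * p)\<^esub>}"
    using leading_class_B[OF p] B_subset_Z[of 1 p "p + q"] by auto
  note * = Mod_iso[OF G KH_group(2)[OF D] leading_class_hom(1)[OF p] _ L, unfolded add_group_simps, OF leading_class_hom(2)[OF p]]
  show "page_1_KH p q \<in> iso (page 1 p q) (KH D (p + q) (j + 2 * p))"
    using *(1) by (simp add: page_def quotient_space_def page_1_KH_def[abs_def])
  show "x \<in> Z 1 p (p + q) \<Longrightarrow> page_1_KH p q (coset (B 1 p (p + q)) x) = leading_class p q x"
    using *(2) by (simp add: page_1_KH_def)
qed

lemma page_1_KH_d:
  assumes p: "p \<ge> 0" and Q: "Q \<in> carrier (page 1 p q)"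
  shows "page_1_KH (p + 1) q (page_d 1 p q Q) = beta_star D (p + q) (j + 2 * p) (page_1_KH p q Q)"
proof -
  obtain x where x: "x \<in> Z 1 p (p + q)" "Q = coset (B 1 p (p + q)) x"
    using page_cases[OF Q] by auto
  have e: "p + q + 1 = p + 1 + q" "j + 2 * (p + 1) = j + 2 * p + 2" by simp_all
  have dx: "bn_diff D x \<in> Z 1 (p + 1) (p + 1 + q)"
    using d_ZB(1)[OF _ _ x(1), of "p + q + 1" "p + 1"] by (simp add: e(1))
  have xF: "x \<in> bn_filtration D j p (p + q)" and sx: "slice x (nat p) \<in> kh_cocycles D (p + q) (j + 2 * p)"
    using x(1) Z_1[OF p] by auto
  let ?B = "kh_coboundaries D (p + q + 1) (j + 2 * p + 2)"
  have sx1: "slice x (nat (p + 1)) \<in> kh_cochains D (p + q) (j + 2 * p + 2)"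
  proof -
    have "slice x (nat (p + 1)) \<in> kh_cochains D (p + q) (j + 2 * int (nat (p + 1)))"
      using xF unfolding bn_filtration_def by blast
    then show ?thesis using p by (simp add: algebra_simps)
  qed
  have "page_1_KH (p + 1) q (page_d 1 p q Q) = leading_class (p + 1) q (bn_diff D x)"
    using page_d_coset[of x 1 p q] x page_1_KH(2)[OF _ dx] p by (simp add: e(1))
  also have "\<dots> = coset ?B (kh_diff D (slice x (nat (p + 1))) + beta D (slice x (nat p)))"
    unfolding leading_class_def slice_d(2)[OF p xF] by (simp only: e)
  \<comment> \<open>The first term is a Khovanov coboundary, so only \<open>beta\<close> of the
    leading coefficient survives in homology.\<close>
  also have "\<dots> = coset ?B (beta D (slice x (nat p)))"
  proof -
    let ?k = "kh_diff D (slice x (nat (p + 1)))" and ?b = "beta D (slice x (nat p))"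
    have k: "?k \<in> ?B" unfolding kh_coboundaries_def using sx1 by simp
    have b: "?b \<in> kh_cocycles D (p + q + 1) (j + 2 * p + 2)" by (rule beta_cocycles(1)[OF D sx])
    have kb: "?k + ?b \<in> kh_cocycles D (p + q + 1) (j + 2 * p + 2)"
      using k kh_coboundaries_subset[OF D] f2_subspaceD(2)[OF kh_cocycles_subspace] b by blast
    have "?k + ?b + ?b \<in> ?B" using k f2_subspaceD(3)[OF kh_cocycles_subspace b] by (simp add: add.assoc)
    then show ?thesis
      using coset_eq_iff[OF kh_cocycles_subspace kh_coboundaries_subspace kh_coboundaries_subset[OF D] kb b] by blast
  qed
  also have "\<dots> = beta_star D (p + q) (j + 2 * p) (page_1_KH p q Q)"
    unfolding x(2) page_1_KH(2)[OF p x(1)] leading_class_def by (rule beta_star_coset[OF D sx, symmetric])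
  finally show ?thesis .
qed

section \<open>The second page\<close>

lemma page_2:
  "page 2 p q \<cong> homology (page_d 1 (p - 1) q) (page_d 1 p q) (page 1 (p - 1) q) (page 1 p q) (page 1 (p + 1) q)"
  using page_Suc[of 1 p q] by (simp add: numeral_2_eq_2)

lemma page_1_d_hom: "page_d 1 p q \<in> hom (page 1 p q) (page 1 (p + 1) q)"
  using page_d_hom[of 1 p q] by simp

lemma page_1_d_d: "Q \<in> carrier (page 1 (p - 1) q) \<Longrightarrow> page_d 1 p q (page_d 1 (p - 1) q Q) = \<one>\<^bsub>page 1 (p + 1) q\<^esub>"
  using page_d_page_d[of Q 1 "p - 1" q] by (simp add: add.commute)

text \<open>For \<open>p > 0\<close> the column \<open>p - 1\<close> is still Khovanov homology, so
  three neighbouring columns can be identified compatibly with the differentials.\<close>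

lemma page_2_pos:
  assumes p: "p > 0"
  shows "page 2 p q \<cong> homology (beta_star D (p + q - 1) (j + 2 * p - 2)) (beta_star D (p + q) (j + 2 * p))
         (KH D (p + q - 1) (j + 2 * p - 2)) (KH D (p + q) (j + 2 * p)) (KH D (p + q + 1) (j + 2 * p + 2))"
proof (rule iso_trans[OF page_2 homology_iso_homology[where a = "page_1_KH (p - 1) q" and b = "page_1_KH p q"
        and c = "page_1_KH (p + 1) q"]])
  have e: "p - 1 + q = p + q - 1" "j + 2 * (p - 1) = j + 2 * p - 2" "p + 1 + q = p + q + 1" "j + 2 * (p + 1) = j + 2 * p + 2"
    by simp_all
  show "page_1_KH (p - 1) q \<in> iso (page 1 (p - 1) q) (KH D (p + q - 1) (j + 2 * p - 2))"
    using page_1_KH(1)[of "p - 1" q] p unfolding e by simp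
  show "page_1_KH p q \<in> iso (page 1 p q) (KH D (p + q) (j + 2 * p))"
    using page_1_KH(1)[of p q] p by simp
  show "page_1_KH (p + 1) q \<in> iso (page 1 (p + 1) q) (KH D (p + q + 1) (j + 2 * p + 2))"
    using page_1_KH(1)[of "p + 1" q] p unfolding e by simp
  show "page_1_KH p q (page_d 1 (p - 1) q x) = beta_star D (p + q - 1) (j + 2 * p - 2) (page_1_KH (p - 1) q x)"
    if "x \<in> carrier (page 1 (p - 1) q)" for x
    using page_1_KH_d[OF _ that] p unfolding e by simp
  show "page_1_KH (p + 1) q (page_d 1 p q x) = beta_star D (p + q) (j + 2 * p) (page_1_KH p q x)"
    if "x \<in> carrier (page 1 p q)" for x
    using page_1_KH_d[OF _ that] p by simp
  show "beta_star D (p + q - 1) (j + 2 * p - 2) \<in> hom (KH D (p + q - 1) (j + 2 * p - 2)) (KH D (p + q) (j + 2 * p))"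
    using beta_star_hom[OF D, of "p + q - 1" "j + 2 * p - 2"] by simp
  show "beta_star D (p + q) (j + 2 * p) \<in> hom (KH D (p + q) (j + 2 * p)) (KH D (p + q + 1) (j + 2 * p + 2))"
    by (rule beta_star_hom[OF D])
  show "page_d 1 (p - 1) q \<in> hom (page 1 (p - 1) q) (page 1 p q)" using page_1_d_hom[of "p - 1" q] by simp
qed (intro page_group KH_group[OF D] page_1_d_hom page_1_d_d; assumption)+

text \<open>Column -1 vanishes, so nothing is divided out. The result is a subgroup and not a
  quotient, whence \<open>Mod_iso\<close> is used in place of
  \<open>homology_iso_homology\<close>.\<close>

lemma page_2_zero:
  "page 2 0 q \<cong> (KH D q j)\<lparr>carrier := kernel (KH D q j) (KH D (q + 1) (j + 2)) (beta_star D q j)\<rparr>"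
proof -
  let ?E = "page 1 0 q" and ?E' = "page 1 1 q" and ?H = "KH D q j" and ?H' = "KH D (q + 1) (j + 2)"
  let ?d = "page_d 1 0 q" and ?b = "page_1_KH 0 q"
  define K where "K = ?E\<lparr>carrier := kernel ?E ?E' ?d\<rparr>"
  define K' where "K' = ?H\<lparr>carrier := kernel ?H ?H' (beta_star D q j)\<rparr>"
  have b: "?b \<in> iso ?E ?H" and c: "page_1_KH 1 q \<in> iso ?E' ?H'"
    using page_1_KH(1)[of 0 q] page_1_KH(1)[of 1 q] by (simp_all add: add.commute)
  have comm: "page_1_KH 1 q (?d x) = beta_star D q j (?b x)" if "x \<in> carrier ?E" for x
    using page_1_KH_d[OF _ that] by simp
  have dh: "?d \<in> hom ?E ?E'" using page_1_d_hom[of 0 q] by simp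
  have bh: "?b \<in> hom ?E ?H" and ch: "page_1_KH 1 q \<in> hom ?E' ?H'" using b c by (simp_all only: iso_def mem_Collect_eq)
  have one_c: "page_1_KH 1 q \<one>\<^bsub>?E'\<^esub> = \<one>\<^bsub>?H'\<^esub>" and one_b: "?b \<one>\<^bsub>?E\<^esub> = \<one>\<^bsub>?H\<^esub>"
    by (rule hom_one[OF ch page_group(2) KH_group(2)[OF D]], rule hom_one[OF bh page_group(2) KH_group(2)[OF D]])
  have oneE: "\<one>\<^bsub>?E\<^esub> \<in> carrier ?E" "\<one>\<^bsub>?E'\<^esub> \<in> carrier ?E'"
    using page_group(2) by (simp_all add: group.is_monoid monoid.one_closed)
  have ker: "?d x = \<one>\<^bsub>?E'\<^esub> \<longleftrightarrow> beta_star D q j (?b x) = \<one>\<^bsub>?H'\<^esub>" if x: "x \<in> carrier ?E" for x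
  proof -
    have "inj_on (page_1_KH 1 q) (carrier ?E')" using c by (simp add: iso_def bij_betw_def)
    then have "?d x = \<one>\<^bsub>?E'\<^esub> \<longleftrightarrow> page_1_KH 1 q (?d x) = page_1_KH 1 q \<one>\<^bsub>?E'\<^esub>"
      using hom_in_carrier[OF dh x] oneE(2) by (metis inj_onD)
    then show ?thesis unfolding comm[OF x] one_c .
  qed
  have "group_hom ?E ?E' ?d" "group_hom ?H ?H' (beta_star D q j)"
    using page_group KH_group[OF D] dh beta_star_hom[OF D] by (simp_all add: group_hom_def group_hom_axioms_def)
  then have K: "group K" "group K'"
    using comm_group_restrict[OF page_group(1)] comm_group_restrict[OF KH_group(1)[OF D]]
    unfolding K_def K'_def by (meson comm_group_def group_hom.subgroup_kernel)+
  have bij: "bij_betw ?b (carrier ?E) (carrier ?H)" using b by (simp add: iso_def)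
  have "?b \<in> hom K K'"
    using b ker by (auto simp: iso_def hom_def K_def K'_def kernel_def)
  moreover have "?b ` carrier K = carrier K'"
  proof (intro subset_antisym subsetI)
    fix y assume y: "y \<in> carrier K'"
    then have "y \<in> ?b ` carrier ?E"
      using bij by (simp add: K'_def kernel_def bij_betw_def)
    then obtain x where x: "y = ?b x" "x \<in> carrier ?E" by (rule imageE)
    then have "x \<in> carrier K" using y ker[OF x(2)] by (simp add: K_def K'_def kernel_def)
    then show "y \<in> ?b ` carrier K" unfolding x(1) by (rule imageI)
  qed (use \<open>?b \<in> hom K K'\<close> in \<open>auto simp: hom_def\<close>)
  moreover have "page_d 1 (- 1) q ` carrier (page 1 (- 1) q) = {x \<in> carrier K. ?b x = \<one>\<^bsub>K'\<^esub>}"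
  proof -
    have "trivial_group (page 1 (- 1) q)" by (rule page_neg) simp
    then have "page_d 1 (- 1) q ` carrier (page 1 (- 1) q) = {\<one>\<^bsub>?E\<^esub>}"
      using hom_one[OF page_1_d_hom[of "- 1" q] page_group(2) page_group(2)] by (simp add: trivial_group_def)
    moreover have "{x \<in> carrier K. ?b x = \<one>\<^bsub>K'\<^esub>} = {\<one>\<^bsub>?E\<^esub>}"
    proof (intro subset_antisym subsetI)
      fix x assume "x \<in> {x \<in> carrier K. ?b x = \<one>\<^bsub>K'\<^esub>}"
      then have "x \<in> carrier ?E" "?b x = ?b \<one>\<^bsub>?E\<^esub>"
        unfolding one_b by (simp_all add: K_def K'_def kernel_def)
      moreover have "inj_on ?b (carrier ?E)" using bij by (simp add: bij_betw_def)
      ultimately show "x \<in> {\<one>\<^bsub>?E\<^esub>}" using oneE(1) by (simp add: inj_on_eq_iff)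
    next
      fix x assume "x \<in> {\<one>\<^bsub>?E\<^esub>}"
      then have x: "x = \<one>\<^bsub>?E\<^esub>" by simp
      have "?d \<one>\<^bsub>?E\<^esub> = \<one>\<^bsub>?E'\<^esub>" by (rule hom_one[OF dh page_group(2) page_group(2)])
      then have "x \<in> carrier K" unfolding x using oneE(1) by (simp add: K_def kernel_def)
      moreover have "?b x = \<one>\<^bsub>K'\<^esub>" unfolding x one_b by (simp add: K'_def)
      ultimately show "x \<in> {x \<in> carrier K. ?b x = \<one>\<^bsub>K'\<^esub>}" by blast
    qed
    ultimately show ?thesis by (simp only:)
  qed
  ultimately have "(\<lambda>Q. the_elem (?b ` Q)) \<in> iso (K Mod (page_d 1 (- 1) q ` carrier (page 1 (- 1) q))) K'"
    by (intro Mod_iso(1) K)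
  then have "K Mod (page_d 1 (- 1) q ` carrier (page 1 (- 1) q)) \<cong> K'"
    unfolding is_iso_def by blast
  moreover have "page 2 0 q \<cong> K Mod (page_d 1 (- 1) q ` carrier (page 1 (- 1) q))"
    using page_2[of 0 q] by (simp add: homology_def K_def)
  ultimately have "page 2 0 q \<cong> K'" using iso_trans by blast
  then show ?thesis by (simp only: K'_def)
qed

end

text \<open>Column \<open>p\<close> belongs to the coefficient of \<open>u ^ p\<close>, and
  \<open>p + q\<close> is the homological degree. Passing from \<open>p\<close> to
  \<open>p + 1\<close> with \<open>q\<close> fixed raises this degree by 1 and the
  \<open>q\<close>-grading by 2, which is the bidegree of \<open>beta_star\<close>. Columns
  \<open>p < 0\<close> vanish because the filtration begins at 0.\<close>

theorem theorem4p2: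
  fixes D :: diagram and j :: int
  assumes "oriented_link_diagram D"
  shows "\<exists>(E :: nat \<Rightarrow> int \<Rightarrow> int \<Rightarrow> (gen \<Rightarrow> bit poly) set monoid) d.
    spectral_sequence E d \<and>
    (\<forall>p q. p < 0 \<longrightarrow> trivial_group (E 1 p q)) \<and>
    (\<exists>\<phi>. \<forall>p q. p \<ge> 0 \<longrightarrow>
       \<phi> p q \<in> iso (E 1 p q) (KH D (p + q) (j + 2 * p)) \<and>
       (\<forall>x \<in> carrier (E 1 p q).
          \<phi> (p + 1) q (d 1 p q x) = beta_star D (p + q) (j + 2 * p) (\<phi> p q x))) \<and>
    (\<forall>p q. p < 0 \<longrightarrow> trivial_group (E 2 p q)) \<and>
    (\<forall>q. E 2 0 q \<cong>
       (KH D q j)\<lparr>carrier := kernel (KH D q j) (KH D (q + 1) (j + 2)) (beta_star D q j)\<rparr>) \<and>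
    (\<forall>p q. p > 0 \<longrightarrow> E 2 p q \<cong>
       homology (beta_star D (p + q - 1) (j + 2 * p - 2)) (beta_star D (p + q) (j + 2 * p))
         (KH D (p + q - 1) (j + 2 * p - 2)) (KH D (p + q) (j + 2 * p))
         (KH D (p + q + 1) (j + 2 * p + 2))) \<and>
    converges_to E d (\<lambda>n. BN D n j)"
proof -
  interpret bar_natan D j by unfold_locales (rule assms)
  show ?thesis
  proof (intro exI[of _ page] exI[of _ page_d] conjI)
    show "spectral_sequence page page_d" by (rule spectral_sequence_page)
    show "\<exists>\<phi>. \<forall>p q. p \<ge> 0 \<longrightarrow> \<phi> p q \<in> iso (page 1 p q) (KH D (p + q) (j + 2 * p)) \<and>
       (\<forall>x \<in> carrier (page 1 p q). \<phi> (p + 1) q (page_d 1 p q x) = beta_star D (p + q) (j + 2 * p) (\<phi> p q x))"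
      using page_1_KH(1) page_1_KH_d by (intro exI[of _ page_1_KH]) blast
    show "converges_to page page_d (\<lambda>n. BN D n j)" unfolding BN_eq by (rule page_converges)
    show "\<forall>p q. p < 0 \<longrightarrow> trivial_group (page 1 p q)" "\<forall>p q. p < 0 \<longrightarrow> trivial_group (page 2 p q)"
      using page_neg by blast+
    show "\<forall>q. page 2 0 q \<cong>
       (KH D q j)\<lparr>carrier := kernel (KH D q j) (KH D (q + 1) (j + 2)) (beta_star D q j)\<rparr>"
      using page_2_zero by blast
    show "\<forall>p q. p > 0 \<longrightarrow> page 2 p q \<cong>
       homology (beta_star D (p + q - 1) (j + 2 * p - 2)) (beta_star D (p + q) (j + 2 * p))
         (KH D (p + q - 1) (j + 2 * p - 2)) (KH D (p + q) (j + 2 * p))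
         (KH D (p + q + 1) (j + 2 * p + 2))"
      using page_2_pos by blast
  qed
qed

end
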